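(* Let $d\ge 1$, let $w\in L^1(\mathbb{R}^d)+L^\infty(\mathbb{R}^d)$ be a positive (radial) function and let $\rho,T\ge 0$. Then the minimisers of the spin problem $E^{\rm HF}(\rho,T)$ are all of the form $$\gamma(k)=U\begin{pmatrix}g_\uparrow(k)&0\\0&g_\downarrow(k)\end{pmatrix}U^*,$$ where $U\in \mathrm{SU}(2)$ is a $k$-independent unitary matrix and where $g_\uparrow$ and $g_\downarrow$ are minimisers of the no-spin problems $E^{\rm HF}_{\text{no-spin}}(\rho^\uparrow,T)$ and $E^{\rm HF}_{\text{no-spin}}(\rho^\downarrow,T)$, for some densities $\rho^\uparrow,\rho^\downarrow\ge0$ satisfying $\rho^\uparrow+\rho^\downarrow=\rho$. In particular, $$E^{\rm HF}(\rho,T)=\min_{\rho^\uparrow+\rho^\downarrow=\rho}\big\{E^{\rm HF}_{\text{no-spin}}(\rho^\uparrow,T)+E^{\rm HF}_{\text{no-spin}}(\rho^\downarrow,T)\big\}=\min_{0\le t\le 1/2}\big\{E^{\rm HF}_{\text{no-spin}}(t\rho,T)+E^{\rm HF}_{\text{no-spin}}((1-t)\rho,T)\big\}.$$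
   Context: $w:\mathbb{R}^d\to\mathbb{R}$ is a real-valued radial function (the Fourier transform, up to a constant, of a radial interaction potential). Let $S(t)=-t\log t-(1-t)\log(1-t)$ on $[0,1]$. Spin problem: for measurable $\gamma$ on $\mathbb{R}^d$ with values in $2\times2$ hermitian matrices satisfying $0\le\gamma(k)\le \mathbb{I}_2$, $$\mathcal{E}^{\rm HF}(\gamma,T)=\frac1{(2\pi)^d}\int_{\mathbb{R}^d}\Big(\tfrac{|k|^2}{2}\,\mathrm{tr}_{\mathbb{C}^2}\gamma(k)-T\,\mathrm{tr}_{\mathbb{C}^2}S(\gamma(k))\Big)dk-\frac{1}{2(2\pi)^d}\iint w(k-k')\,\mathrm{tr}_{\mathbb{C}^2}[\gamma(k)\gamma(k')]\,dk\,dk',$$ with $S(\gamma(k))$ defined by functional calculus (the first integral takes values in $(-\infty,+\infty]$), and $$E^{\rm HF}(\rho,T)=\min\Big\{\mathcal{E}^{\rm HF}(\gamma,T):\ 0\le\gamma=\gamma^*\le\mathbb{I}_2,\ (2\pi)^{-d}\int\mathrm{tr}_{\mathbb{C}^2}\gamma=\rho\Big\}.$$ No-spin problem: for measurable $g:\mathbb{R}^d\to[0,1]$, $$\mathcal{E}^{\rm HF}_{\text{no-spin}}(g,T)=\frac1{(2\pi)^d}\int_{\mathbb{R}^d}\Big(\tfrac{|k|^2}{2}g(k)-T\,S(g(k))\Big)dk-\frac{1}{2(2\pi)^d}\iint w(k-k')g(k)g(k')\,dk\,dk',$$ $$E^{\rm HF}_{\text{no-spin}}(\rho,T)=\min\Big\{\mathcal{E}^{\rm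 HF}_{\text{no-spin}}(g,T):\ 0\le g\le 1,\ (2\pi)^{-d}\int g=\rho\Big\}.$$ Functions are identified when they agree almost everywhere. *)

theory Defs
  imports "HOL-Analysis.Analysis"
begin

definition conj_transpose :: "complex^'n^'m \<Rightarrow> complex^'m^'n"
  where "conj_transpose A = (\<chi> i j. cnj (A $ j $ i))"

definition unitary :: "complex^'n^'n \<Rightarrow> bool"
  where "unitary U \<longleftrightarrow> conj_transpose U ** U = mat 1 \<and> U ** conj_transpose U = mat 1"

definition hermitian :: "complex^'n^'n \<Rightarrow> bool"
  where "hermitian A \<longleftrightarrow> conj_transpose A = A"

definition pos_semidef :: "complex^'n^'n \<Rightarrow> bool"
  where "pos_semidef A \<longleftrightarrow>
    hermitian A \<and> (\<forall>v. 0 \<le> Re (\<Sum>i\<in>UNIV. cnj (v $ i) * (A *v v) $ i))"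

definition diag_mat :: "real^'n \<Rightarrow> complex^'n^'n"
  where "diag_mat l = (\<chi> i j. if i = j then complex_of_real (l $ i) else 0)"

text \<open>
  Functional calculus: \<open>f(U diag(l) U\<^sup>*) = U diag(f \<circ> l) U\<^sup>*\<close>. The result does not depend on the
  chosen diagonalisation (lemma \<open>matrix_fun_diag\<close>). The value is unspecified if \<open>A\<close> is not hermitian.
\<close>

definition matrix_fun :: "(real \<Rightarrow> real) \<Rightarrow> complex^'n^'n \<Rightarrow> complex^'n^'n"
  where "matrix_fun f A = (THE B. \<exists>U l. unitary U \<and> A = U ** diag_mat l ** conj_transpose U \<and>
           B = U ** diag_mat (\<chi> i. f (l $ i)) ** conj_transpose U)"

lemma diag_mat_mult_left: "(diag_mat l ** A) $ i $ j = complex_of_real (l $ i) * A $ i $ j"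
proof -
  have "(diag_mat l ** A) $ i $ j = (\<Sum>k\<in>UNIV. if k = i then complex_of_real (l $ i) * A $ i $ j else 0)"
    unfolding matrix_matrix_mult_def diag_mat_def vec_lambda_beta by (rule sum.cong) auto
  then show ?thesis by simp
qed

lemma diag_mat_mult_right: "(A ** diag_mat l) $ i $ j = A $ i $ j * complex_of_real (l $ j)"
proof -
  have "(A ** diag_mat l) $ i $ j = (\<Sum>k\<in>UNIV. if k = j then A $ i $ j * complex_of_real (l $ j) else 0)"
    unfolding matrix_matrix_mult_def diag_mat_def vec_lambda_beta by (rule sum.cong) auto
  then show ?thesis by simp
qed

lemma matrix_fun_unique:
  assumes U: "unitary U" and V: "unitary V"
    and eq: "U ** diag_mat l ** conj_transpose U = V ** diag_mat m ** conj_transpose V"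
  shows "U ** diag_mat (\<chi> i. f (l $ i)) ** conj_transpose U
       = V ** diag_mat (\<chi> i. f (m $ i)) ** conj_transpose V"
proof -
  define W where "W = conj_transpose V ** U"
  have UU: "conj_transpose U ** U = mat 1" "U ** conj_transpose U = mat 1"
    and VV: "conj_transpose V ** V = mat 1" "V ** conj_transpose V = mat 1"
    using U V by (auto simp: unitary_def)
  have "W ** diag_mat l = conj_transpose V ** (U ** diag_mat l ** conj_transpose U) ** U"
    unfolding W_def using UU by (simp add: matrix_mul_assoc[symmetric])
  also have "\<dots> = (conj_transpose V ** V) ** diag_mat m ** W"
    unfolding eq W_def by (simp add: matrix_mul_assoc)
  finally have c: "W ** diag_mat l = diag_mat m ** W" using VV by simp
  have "W $ i $ j * complex_of_real (f (l $ j)) = complex_of_real (f (m $ i)) * W $ i $ j" for i j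
  proof -
    have "W $ i $ j * complex_of_real (l $ j) = complex_of_real (m $ i) * W $ i $ j"
      using c by (metis diag_mat_mult_left diag_mat_mult_right)
    then have "W $ i $ j = 0 \<or> l $ j = m $ i" by auto
    then show ?thesis by auto
  qed
  then have "W ** diag_mat (\<chi> i. f (l $ i)) = diag_mat (\<chi> i. f (m $ i)) ** W"
    by (simp add: vec_eq_iff diag_mat_mult_left diag_mat_mult_right)
  then have "V ** (W ** diag_mat (\<chi> i. f (l $ i))) ** conj_transpose U
           = V ** (diag_mat (\<chi> i. f (m $ i)) ** W) ** conj_transpose U" by simp
  moreover have "V ** (W ** diag_mat (\<chi> i. f (l $ i))) ** conj_transpose U
      = (V ** conj_transpose V) ** U ** diag_mat (\<chi> i. f (l $ i)) ** conj_transpose U"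
    by (simp add: W_def matrix_mul_assoc)
  moreover have "V ** (diag_mat (\<chi> i. f (m $ i)) ** W) ** conj_transpose U
      = V ** diag_mat (\<chi> i. f (m $ i)) ** conj_transpose V ** (U ** conj_transpose U)"
    by (simp add: W_def matrix_mul_assoc)
  ultimately show ?thesis using UU VV by simp
qed

lemma matrix_fun_diag:
  assumes "unitary U"
  shows "matrix_fun f (U ** diag_mat l ** conj_transpose U)
       = U ** diag_mat (\<chi> i. f (l $ i)) ** conj_transpose U"
  unfolding matrix_fun_def
proof (rule the_equality)
  show "\<exists>V m. unitary V \<and> U ** diag_mat l ** conj_transpose U = V ** diag_mat m ** conj_transpose V \<and>
      U ** diag_mat (\<chi> i. f (l $ i)) ** conj_transpose U
        = V ** diag_mat (\<chi> i. f (m $ i)) ** conj_transpose V"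
    using assms by blast
  show "B = U ** diag_mat (\<chi> i. f (l $ i)) ** conj_transpose U"
    if "\<exists>V m. unitary V \<and> U ** diag_mat l ** conj_transpose U = V ** diag_mat m ** conj_transpose V \<and>
      B = V ** diag_mat (\<chi> i. f (m $ i)) ** conj_transpose V" for B
    using that matrix_fun_unique[OF assms] by metis
qed

text \<open>Since \<open>ln 0 = 0\<close>, this has the right value \<open>0\<close> at the end points.\<close>

definition entropy_fun :: "real \<Rightarrow> real"
  where "entropy_fun t = - t * ln t - (1 - t) * ln (1 - t)"

text \<open>
  The extended integral of a function whose negative part is integrable. For the kinetic and entropy
  terms below this is always so, because \<open>|k|\<^sup>2/2 t - T entropy_fun(t) \<ge> - T ln (1 + exp (- |k|\<^sup>2/(2T)))\<close>
  when \<open>T > 0\<close>.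
\<close>

definition ext_integral :: "'a measure \<Rightarrow> ('a \<Rightarrow> real) \<Rightarrow> ereal"
  where "ext_integral M f =
    enn2ereal (\<integral>\<^sup>+ x. ennreal (f x) \<partial>M) - enn2ereal (\<integral>\<^sup>+ x. ennreal (- f x) \<partial>M)"

text \<open>
  Functions are identified when they agree almost everywhere, so every measurable function is
  represented by a Borel one. With Borel representatives \<open>w (k - k')\<close> is measurable
  for the product measure.
\<close>

definition spin_admissible :: "real \<Rightarrow> (real^'d \<Rightarrow> complex^2^2) \<Rightarrow> bool"
  where "spin_admissible \<rho> \<gamma> \<longleftrightarrow>
    \<gamma> \<in> borel_measurable borel \<and>
    (\<forall>k. pos_semidef (\<gamma> k) \<and> pos_semidef (mat 1 - \<gamma> k)) \<and>
    integrable lborel (\<lambda>k. Re (trace (\<gamma> k))) \<and>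
    1 / (2 * pi) ^ CARD('d) * (\<integral>k. Re (trace (\<gamma> k)) \<partial>lborel) = \<rho>"

text \<open>All traces below are traces of a hermitian matrix, or of a product of two, hence real.\<close>

definition spin_energy :: "(real^'d \<Rightarrow> real) \<Rightarrow> real \<Rightarrow> (real^'d \<Rightarrow> complex^2^2) \<Rightarrow> ereal"
  where "spin_energy w T \<gamma> =
    ereal (1 / (2 * pi) ^ CARD('d)) *
      ext_integral lborel
        (\<lambda>k. (norm k)\<^sup>2 / 2 * Re (trace (\<gamma> k)) - T * Re (trace (matrix_fun entropy_fun (\<gamma> k))))
    - ereal (1 / (2 * (2 * pi) ^ CARD('d)) *
        (\<integral>(k, k'). w (k - k') * Re (trace (\<gamma> k ** \<gamma> k')) \<partial>(lborel \<Otimes>\<^sub>M lborel)))"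

definition spin_minimiser :: "(real^'d \<Rightarrow> real) \<Rightarrow> real \<Rightarrow> real \<Rightarrow> (real^'d \<Rightarrow> complex^2^2) \<Rightarrow> bool"
  where "spin_minimiser w \<rho> T = is_arg_min (spin_energy w T) (spin_admissible \<rho>)"

definition E_spin :: "(real^'d \<Rightarrow> real) \<Rightarrow> real \<Rightarrow> real \<Rightarrow> ereal"
  where "E_spin w \<rho> T = Inf (spin_energy w T ` Collect (spin_admissible \<rho>))"

definition nospin_admissible :: "real \<Rightarrow> (real^'d \<Rightarrow> real) \<Rightarrow> bool"
  where "nospin_admissible \<rho> g \<longleftrightarrow>
    g \<in> borel_measurable borel \<and>
    (\<forall>k. 0 \<le> g k \<and> g k \<le> 1) \<and>
    integrable lborel g \<and>
    1 / (2 * pi) ^ CARD('d) * (\<integral>k. g k \<partial>lborel) = \<rho>"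

definition nospin_energy :: "(real^'d \<Rightarrow> real) \<Rightarrow> real \<Rightarrow> (real^'d \<Rightarrow> real) \<Rightarrow> ereal"
  where "nospin_energy w T g =
    ereal (1 / (2 * pi) ^ CARD('d)) *
      ext_integral lborel (\<lambda>k. (norm k)\<^sup>2 / 2 * g k - T * entropy_fun (g k))
    - ereal (1 / (2 * (2 * pi) ^ CARD('d)) *
        (\<integral>(k, k'). w (k - k') * g k * g k' \<partial>(lborel \<Otimes>\<^sub>M lborel)))"

definition nospin_minimiser :: "(real^'d \<Rightarrow> real) \<Rightarrow> real \<Rightarrow> real \<Rightarrow> (real^'d \<Rightarrow> real) \<Rightarrow> bool"
  where "nospin_minimiser w \<rho> T = is_arg_min (nospin_energy w T) (nospin_admissible \<rho>)"

definition E_nospin :: "(real^'d \<Rightarrow> real) \<Rightarrow> real \<Rightarrow> real \<Rightarrow> ereal"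
  where "E_nospin w \<rho> T = Inf (nospin_energy w T ` Collect (nospin_admissible \<rho>))"

text \<open>Membership in \<open>L\<^sup>1 + L\<^sup>\<infinity>\<close>.\<close>

definition L1_plus_Linf :: "(real^'d \<Rightarrow> real) \<Rightarrow> bool"
  where "L1_plus_Linf w \<longleftrightarrow>
    w \<in> borel_measurable borel \<and>
    (\<exists>w1 w2 C. integrable lborel w1 \<and>
       w2 \<in> borel_measurable borel \<and> (AE k in lborel. \<bar>w2 k\<bar> \<le> C) \<and>
       (AE k in lborel. w k = w1 k + w2 k))"

definition radial :: "(real^'d \<Rightarrow> real) \<Rightarrow> bool"
  where "radial w \<longleftrightarrow> (\<exists>f. AE k in lborel. w k = f (norm k))"

text \<open>\<open>m = min A\<close>, the minimum being attained; \<open>Min\<close> is meaningful for finite sets only.\<close>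

definition is_minimum :: "ereal \<Rightarrow> ereal set \<Rightarrow> bool"
  where "is_minimum m A \<longleftrightarrow> m \<in> A \<and> (\<forall>x\<in>A. m \<le> x)"

end

theory Submission
  imports Defs "HOL-Complex_Analysis.Great_Picard" "HOL-Real_Asymp.Real_Asymp"
begin

text \<open>
  Writing \<open>\<gamma> = (t I + n \<cdot> \<sigma>) / 2\<close>, the eigenvalues of \<open>\<gamma>(k)\<close> are \<open>(t \<plusminus> |n|) / 2\<close>, and
  \<open>tr \<gamma>(k) \<gamma>(k') = (t t' + n \<bullet> n') / 2\<close>. Hence the spin energy of \<open>\<gamma>\<close> exceeds the sum of the no-spin
  energies of its two eigenvalue functions by a positive multiple of
  \<open>\<integral>\<integral> w(k - k') (|n| |n'| - n \<bullet> n')\<close>. As \<open>w > 0\<close>, this deficit is nonnegative, and it vanishes only if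
  almost all Bloch vectors \<open>n(k)\<close> point in one fixed direction, which means that one constant unitary
  diagonalises almost all \<open>\<gamma>(k)\<close>.

  Minimisers exist by the direct method: a minimising sequence has bounded second moments, so a
  subsequence converges weakly without loss of mass; the exchange term is weakly continuous because
  convolution with \<open>w\<close> turns weak into pointwise convergence, and the convex kinetic and entropy part is
  weakly lower semicontinuous. The same argument shows that the no-spin minimum is lower
  semicontinuous in the density, so the optimal splitting of the density is attained.
\<close>

section \<open>Weak compactness of functions with values in the unit interval\<close>

text \<open>The spin problem itself is never treated by compactness. Its lower bound comes from the
  eigenvalues, its upper bound from diagonal test states, and both lead to the same optimal
  splitting, so only scalar functions with values in [0, 1] need weak limits. How the mass divides
  between the two eigenvalue functions is not prescribed; therefore compactness is stated along a
  converging sequence of densities.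

  The obstacle is the bookkeeping of infinities. The kinetic and entropy part is a difference of two
  extended integrals. An explicit integrable shift, whose integral depends on the function only
  through its mass, turns it into a nonnegative integral, and the moment bound, the lower bound and
  semicontinuity are all proved for that integral. Finiteness of \<open>E_nospin\<close> then
  permits cancellation in the equality case.

  Positivity of \<open>w\<close> holds only almost everywhere, so it is transported to pairs of
  momenta, and the common direction is read off at one momentum where the Bloch vector does not
  vanish.\<close>

lemma (in finite_measure) measure_disjoint_tail:
  fixes A :: "nat \<Rightarrow> 'a set"
  assumes A: "range A \<subseteq> sets M" and disj: "disjoint_family A"
  shows "(\<lambda>N. measure M (\<Union>i\<in>{N..}. A i)) \<longlonglongrightarrow> 0"
proof -
  have "(\<lambda>N. measure M (\<Union>i\<in>{N..}. A i)) \<longlonglongrightarrow> measure M (\<Inter>N. \<Union>i\<in>{N..}. A i)"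
    using A by (intro finite_Lim_measure_decseq monotoneI UN_mono) auto
  moreover have "(\<Inter>N. \<Union>i\<in>{N..}. A i) = {}"
  proof -
    have False if x: "x \<in> (\<Inter>N. \<Union>i\<in>{N..}. A i)" for x
    proof -
      from x obtain i where i: "x \<in> A i" by auto
      from x obtain j where j: "Suc i \<le> j" "x \<in> A j" by (metis INT_iff UN_iff UNIV_I atLeast_iff)
      then have "A i \<inter> A j = {}" using disj by (intro disjoint_family_onD[of A UNIV]) auto
      then show False using i j by blast
    qed
    then show ?thesis by blast
  qed
  ultimately show ?thesis by simp
qed

text \<open>Finite intersections of a countable basis work, the empty one giving
  \<open>UNIV\<close>. Countability serves the diagonal extraction, closure under intersections the
  Dynkin induction, and \<open>UNIV\<close> its complement step.\<close>

lemma countable_Int_stable_generator: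
  obtains G :: "'a::second_countable_topology set set"
    where "countable G" "Int_stable G" "UNIV \<in> G" "sigma_sets UNIV G = sets borel"
proof -
  obtain B :: "'a set set" where B: "countable B" "topological_basis B" using ex_countable_basis by auto
  define G where "G = Inter ` {X. finite X \<and> X \<subseteq> B}"
  have "countable G"
    unfolding G_def by (intro countable_image countable_Collect_finite_subset B)
  moreover have "Int_stable G"
  proof (rule Int_stableI)
    fix a b assume "a \<in> G" "b \<in> G"
    then obtain X Y where "finite X" "X \<subseteq> B" "a = \<Inter>X" "finite Y" "Y \<subseteq> B" "b = \<Inter>Y"
      unfolding G_def by auto
    then show "a \<inter> b \<in> G" unfolding G_def by (intro image_eqI[of _ _ "X \<union> Y"]) auto
  qed
  moreover have "UNIV \<in> G" unfolding G_def by (intro image_eqI[of _ _ "{}"]) auto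
  moreover have "sigma_sets UNIV G = sets borel"
  proof
    have "open A" if "A \<in> G" for A
      using that topological_basis_open[OF B(2)] by (auto simp: G_def intro!: open_Inter)
    then show "sigma_sets UNIV G \<subseteq> sets borel"
      by (metis borel_open sets.sigma_sets_subset space_borel subsetI)
    have "B \<subseteq> G"
    proof
      fix b assume "b \<in> B"
      then show "b \<in> G" unfolding G_def by (intro image_eqI[of _ _ "{b}"]) auto
    qed
    then show "sets borel \<subseteq> sigma_sets UNIV G"
      by (simp add: borel_eq_countable_basis[OF B] sigma_sets_mono' sets_measure_of)
  qed
  ultimately show ?thesis by (rule that)
qed

text \<open>On the set where f exceeds 1, write f = (f - 1) + 1 and cancel the finite mass of the
  set: the excess integrates to 0. Subtraction in \<open>ennreal\<close> is truncated, so the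
  splitting is made on that set only.\<close>

lemma (in finite_measure) density_le_imp_AE_le_1:
  assumes f[measurable]: "f \<in> borel_measurable M"
    and le: "\<And>A. A \<in> sets M \<Longrightarrow> emeasure (density M f) A \<le> emeasure M A"
  shows "AE x in M. f x \<le> 1"
proof -
  define A where "A = {x\<in>space M. 1 < f x}"
  have [measurable]: "A \<in> sets M" unfolding A_def by measurable
  have "(\<integral>\<^sup>+x. f x * indicator A x \<partial>M) = (\<integral>\<^sup>+x. (f x - 1) * indicator A x + indicator A x \<partial>M)"
    by (intro nn_integral_cong) (auto simp: A_def diff_add_cancel_ennreal split: split_indicator)
  also have "\<dots> = (\<integral>\<^sup>+x. (f x - 1) * indicator A x \<partial>M) + emeasure M A"
    by (subst nn_integral_add) auto
  finally have "(\<integral>\<^sup>+x. (f x - 1) * indicator A x \<partial>M) + emeasure M A \<le> 0 + emeasure M A"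
    using le[of A] by (simp add: emeasure_density)
  then have "(\<integral>\<^sup>+x. (f x - 1) * indicator A x \<partial>M) = 0"
    using emeasure_finite[of A] by (simp add: ennreal_add_left_cancel_le add.commute top_unique)
  then have "AE x in M. (f x - 1) * indicator A x = 0" by (subst (asm) nn_integral_0_iff_AE) auto
  then show ?thesis
    by (rule AE_mp) (auto simp: A_def indicator_def diff_eq_0_iff_ennreal intro!: AE_I2 split: if_splits)
qed

text \<open>
  A diagonal argument gives convergence of the masses on a countable \<open>\<pi>\<close>-system. The sets with
  convergent masses form a Dynkin system, and the limit masses form a measure below \<open>\<mu>\<close>, whose density is
  the weak limit.
\<close>

lemma weak_star_subsequence_finite_measure:
  fixes \<mu> :: "'a::second_countable_topology measure" and g :: "nat \<Rightarrow> 'a \<Rightarrow> real"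
  assumes "finite_measure \<mu>" and sets: "sets \<mu> = sets borel"
    and g[measurable]: "\<And>n. g n \<in> borel_measurable borel"
    and g01: "\<And>n x. 0 \<le> g n x \<and> g n x \<le> 1"
  obtains r h where "strict_mono r" "h \<in> borel_measurable borel" "\<And>x. 0 \<le> h x \<and> h x \<le> 1"
    "\<And>f. integrable \<mu> f \<Longrightarrow> (\<lambda>n. \<integral>x. f x * g (r n) x \<partial>\<mu>) \<longlonglongrightarrow> (\<integral>x. f x * h x \<partial>\<mu>)"
proof -
  interpret finite_measure \<mu> by fact
  have space: "space \<mu> = UNIV" using sets_eq_imp_space_eq[OF sets] by simp
  note [measurable_cong] = sets
  have int_fg: "integrable \<mu> (\<lambda>x. f x * u x)"
    if "integrable \<mu> f" "u \<in> borel_measurable borel" "\<And>x. 0 \<le> u x \<and> u x \<le> 1" for f u :: "'a \<Rightarrow> real"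
    using that by (intro Bochner_Integration.integrable_bound[OF that(1)]) (auto simp: abs_mult mult_left_le)
  have int_ind: "integrable \<mu> (indicator A :: 'a \<Rightarrow> real)" if "A \<in> sets borel" for A
    using that sets by (auto simp: integrable_indicator_iff less_top[symmetric])
  define \<nu> where "\<nu> n A = (\<integral>x. indicator A x * g n x \<partial>\<mu>)" for n A
  have \<nu>_int: "integrable \<mu> (\<lambda>x. indicator A x * g n x)" if "A \<in> sets borel" for n A
    using int_fg[OF int_ind[OF that] g g01] .
  have \<nu>_ge: "0 \<le> \<nu> n A" for n A unfolding \<nu>_def by (intro integral_nonneg_AE) (auto simp: g01)
  have \<nu>_le: "\<nu> n A \<le> measure \<mu> A" if A: "A \<in> sets borel" for n A
  proof -
    have "\<nu> n A \<le> (\<integral>x. indicator A x \<partial>\<mu>)"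
      unfolding \<nu>_def by (intro integral_mono int_ind[OF A] \<nu>_int[OF A]) (auto simp: g01 split: split_indicator)
    then show ?thesis by (simp add: space)
  qed
  have \<nu>_add: "\<nu> n (A \<union> B) = \<nu> n A + \<nu> n B" if "A \<in> sets borel" "B \<in> sets borel" "A \<inter> B = {}" for n A B
  proof -
    have "\<nu> n A + \<nu> n B = (\<integral>x. indicator A x * g n x + indicator B x * g n x \<partial>\<mu>)"
      unfolding \<nu>_def using that by (intro Bochner_Integration.integral_add[symmetric] \<nu>_int)
    also have "\<dots> = \<nu> n (A \<union> B)"
      unfolding \<nu>_def using that by (intro Bochner_Integration.integral_cong) (auto split: split_indicator)
    finally show ?thesis by simp
  qed
  obtain G :: "'a set set" where G: "countable G" "Int_stable G" "UNIV \<in> G" "sigma_sets UNIV G = sets borel"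
    by (rule countable_Int_stable_generator)
  have G_borel: "A \<in> sets borel" if "A \<in> G" for A using that G(4) by auto
  obtain r where r: "strict_mono r" and rG: "\<And>A. A \<in> G \<Longrightarrow> \<exists>l. (\<lambda>n. \<nu> (r n) A) \<longlonglongrightarrow> l"
  proof (rule function_convergent_subsequence[OF G(1), of \<nu> "measure \<mu> UNIV"])
    show "norm (\<nu> n A) \<le> measure \<mu> UNIV" if "A \<in> G" for n A
      using \<nu>_ge[of n A] \<nu>_le[OF G_borel[OF that], of n] bounded_measure[of A] by (simp add: space)
  qed blast
  have conv: "convergent (\<lambda>n. \<nu> (r n) A)" if "A \<in> sets borel" for A
  proof -
    note G(2)
    moreover have "G \<subseteq> Pow UNIV" by simp
    moreover have "A \<in> sigma_sets UNIV G" using that G(4) by simp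
    ultimately show ?thesis
    proof (induction rule: sigma_sets_induct_disjoint)
      case (basic A)
      then show ?case using rG by (auto simp: convergent_def)
    next
      case empty
      have "\<nu> n {} = 0" for n by (simp add: \<nu>_def)
      then show ?case by (simp add: convergent_const)
    next
      case (compl A)
      have "A \<in> sets borel" using compl(1) G(4) by simp
      then have "\<nu> n UNIV = \<nu> n A + \<nu> n (UNIV - A)" for n
        using \<nu>_add[of A "UNIV - A" n] by (simp add: Un_Diff_cancel)
      then have eq: "(\<lambda>n. \<nu> (r n) (UNIV - A)) = (\<lambda>n. \<nu> (r n) UNIV - \<nu> (r n) A)"
        by (auto simp: algebra_simps)
      show ?case unfolding eq using rG[OF G(3)] compl(2) by (intro convergent_diff) (auto simp: convergent_def)
    next
      case (union A)
      have A[measurable]: "A i \<in> sets borel" for i using union(2) G(4) by auto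
      have fin: "\<nu> n (\<Union>i\<in>{..<N}. A i) = (\<Sum>i<N. \<nu> n (A i))" for n N
      proof (induction N)
        case (Suc N)
        have "A i \<inter> A N = {}" if "i < N" for i
          using that union(1) by (intro disjoint_family_onD[of A UNIV]) auto
        then have "(\<Union>i\<in>{..<N}. A i) \<inter> A N = {}" by blast
        then show ?case
          using \<nu>_add[of "\<Union>i\<in>{..<N}. A i" "A N" n] Suc by (simp add: lessThan_Suc Un_commute)
      qed (simp add: \<nu>_def)
      have split: "\<nu> n (\<Union>i. A i) = (\<Sum>i<N. \<nu> n (A i)) + \<nu> n (\<Union>i\<in>{N..}. A i)" for n N
      proof -
        have "{..<N} \<union> {N..} = UNIV" by auto
        then have "(\<Union>i. A i) = (\<Union>i\<in>{..<N}. A i) \<union> (\<Union>i\<in>{N..}. A i)" by (metis UN_Un)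
        moreover have "A i \<inter> A j = {}" if "i < N" "N \<le> j" for i j
          using that union(1) by (intro disjoint_family_onD[of A UNIV]) auto
        then have "(\<Union>i\<in>{..<N}. A i) \<inter> (\<Union>i\<in>{N..}. A i) = {}" by blast
        ultimately show ?thesis using \<nu>_add[of "\<Union>i\<in>{..<N}. A i" "\<Union>i\<in>{N..}. A i" n] fin by simp
      qed
      \<comment> \<open>The tail mass of \<open>\<mu>\<close> dominates the tails of all
        \<open>\<nu> n\<close> at once. This uniformity in n carries the Cauchy property from the
        finite partial sums to the whole union.\<close>
      have tail: "(\<lambda>N. measure \<mu> (\<Union>i\<in>{N..}. A i)) \<longlonglongrightarrow> 0"
        using union(1) by (intro measure_disjoint_tail) (auto simp: sets)
      have "Cauchy (\<lambda>n. \<nu> (r n) (\<Union>i. A i))"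
      proof (rule metric_CauchyI)
        fix e :: real assume "e > 0"
        then obtain N where N: "measure \<mu> (\<Union>i\<in>{N..}. A i) < e/2"
          using order_tendstoD(2)[OF tail, of "e/2"] by (auto simp: eventually_sequentially)
        have "convergent (\<lambda>n. \<Sum>i<N. \<nu> (r n) (A i))" using union(3) by (intro convergent_sum)
        then have "Cauchy (\<lambda>n. \<Sum>i<N. \<nu> (r n) (A i))" by (rule convergent_Cauchy)
        then obtain M where M: "\<And>m n. m \<ge> M \<Longrightarrow> n \<ge> M \<Longrightarrow>
            dist (\<Sum>i<N. \<nu> (r m) (A i)) (\<Sum>i<N. \<nu> (r n) (A i)) < e/2"
          using \<open>e > 0\<close> by (meson half_gt_zero metric_CauchyD)
        have "dist (\<nu> (r m) (\<Union>i. A i)) (\<nu> (r n) (\<Union>i. A i)) < e" if "m \<ge> M" "n \<ge> M" for m n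
        proof -
          have U: "(\<Union>i\<in>{N..}. A i) \<in> sets borel" by auto
          show ?thesis
            using M[OF that] N \<nu>_ge[of "r m" "\<Union>i\<in>{N..}. A i"] \<nu>_ge[of "r n" "\<Union>i\<in>{N..}. A i"]
              \<nu>_le[OF U, of "r m"] \<nu>_le[OF U, of "r n"]
            unfolding split[of _ N] dist_real_def by linarith
        qed
        then show "\<exists>M. \<forall>m\<ge>M. \<forall>n\<ge>M. dist (\<nu> (r m) (\<Union>i. A i)) (\<nu> (r n) (\<Union>i. A i)) < e" by blast
      qed
      then show ?case by (simp add: Cauchy_convergent_iff)
    qed
  qed
  define L where "L A = lim (\<lambda>n. \<nu> (r n) A)" for A
  have L: "(\<lambda>n. \<nu> (r n) A) \<longlonglongrightarrow> L A" if "A \<in> sets borel" for A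
    unfolding L_def using conv[OF that] by (simp add: convergent_LIMSEQ_iff)
  have L_ge: "0 \<le> L A" if "A \<in> sets borel" for A
    by (rule LIMSEQ_le_const[OF L[OF that]]) (auto simp: \<nu>_ge)
  have L_le: "L A \<le> measure \<mu> A" if "A \<in> sets borel" for A
    by (rule LIMSEQ_le_const2[OF L[OF that]]) (auto simp: \<nu>_le that)
  have L_add: "L (A \<union> B) = L A + L B" if AB: "A \<in> sets borel" "B \<in> sets borel" "A \<inter> B = {}" for A B
  proof -
    have "(\<lambda>n. \<nu> (r n) (A \<union> B)) \<longlonglongrightarrow> L A + L B"
      unfolding \<nu>_add[OF AB] by (intro tendsto_add L AB)
    then show ?thesis using L[of "A \<union> B"] AB LIMSEQ_unique by blast
  qed
  have L0: "L {} = 0" using L_add[of "{}" "{}"] by simp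
  define N where "N = measure_of UNIV (sets borel :: 'a set set) (\<lambda>A. ennreal (L A))"
  have setsN: "sets N = sets borel"
    unfolding N_def by (metis sets.sets_measure_of_eq space_borel)
  have posL: "positive (sets borel) (\<lambda>A. ennreal (L A))" by (simp add: positive_def L0)
  have cadd: "countably_additive (sets borel) (\<lambda>A. ennreal (L A))"
  \<comment> \<open>Limits of masses are so far only finitely additive. Domination by the finite
    measure \<open>\<mu>\<close> gives continuity at the empty set, and with it countable
    additivity.\<close>
  proof (rule ring_of_sets.empty_continuous_imp_countably_additive[of UNIV])
    show "ring_of_sets UNIV (sets (borel::'a measure))"
      by (metis sets.ring_of_sets_axioms space_borel)
    show "additive (sets borel) (\<lambda>A. ennreal (L A))"
      by (auto simp: additive_def L_add L_ge ennreal_plus[symmetric] simp del: ennreal_plus)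
    show "(\<lambda>i. ennreal (L (A i))) \<longlonglongrightarrow> 0"
      if A: "range A \<subseteq> sets borel" "decseq A" "(\<Inter>i. A i) = {}" for A :: "nat \<Rightarrow> 'a set"
    proof -
      have m: "(\<lambda>i. measure \<mu> (A i)) \<longlonglongrightarrow> 0"
        using finite_Lim_measure_decseq[of A] A by (simp add: sets)
      have "(\<lambda>i. L (A i)) \<longlonglongrightarrow> 0"
        by (rule tendsto_sandwich[OF _ _ tendsto_const m]) (use A L_ge L_le in \<open>auto intro!: always_eventually\<close>)
      then show ?thesis using tendsto_ennrealI[of "\<lambda>i. L (A i)" 0] by simp
    qed
  qed (simp_all add: posL)
  have emN: "emeasure N A = ennreal (L A)" if "A \<in> sets borel" for A
    unfolding N_def by (rule emeasure_measure_of_sigma[OF _ posL cadd that])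
      (metis sets.sigma_algebra_axioms space_borel)
  have em_le: "emeasure N A \<le> emeasure \<mu> A" if "A \<in> sets borel" for A
    using L_le[OF that] by (simp add: emN[OF that] emeasure_eq_measure ennreal_leI)
  have "absolutely_continuous \<mu> N"
    unfolding absolutely_continuous_def null_sets_def
    using em_le by (auto simp: sets setsN) (metis le_zero_eq)
  from Radon_Nikodym[OF this] obtain f where f[measurable]: "f \<in> borel_measurable \<mu>" and fN: "density \<mu> f = N"
    using setsN sets by auto
  have f1: "AE x in \<mu>. f x \<le> 1"
    by (rule density_le_imp_AE_le_1[OF f]) (use em_le fN sets in auto)
  \<comment> \<open>The density is at most 1 only almost everywhere; the minimum makes the bounds
    hold everywhere without changing any integral.\<close>
  define h where "h x = enn2real (min 1 (f x))" for x
  have h01: "0 \<le> h x \<and> h x \<le> 1" for x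
    unfolding h_def using enn2real_mono[of "min 1 (f x)" 1] by auto
  have h[measurable]: "h \<in> borel_measurable borel" unfolding h_def by measurable
  have Lh: "L A = (\<integral>x. indicator A x * h x \<partial>\<mu>)" if A: "A \<in> sets borel" for A
  proof -
    have [measurable]: "A \<in> sets \<mu>" using A sets by simp
    have "ennreal (L A) = (\<integral>\<^sup>+x. f x * indicator A x \<partial>\<mu>)"
      using emN[OF A] fN by (simp add: emeasure_density[symmetric])
    also have "\<dots> = (\<integral>\<^sup>+x. ennreal (indicator A x * h x) \<partial>\<mu>)"
    proof (intro nn_integral_cong_AE, use f1 in eventually_elim)
      fix x assume fx: "f x \<le> 1"
      then have "f x < top" using ennreal_one_less_top le_less_trans by blast
      with fx have "ennreal (h x) = f x" by (simp add: h_def min_absorb2 ennreal_enn2real)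
      then show "f x * indicator A x = ennreal (indicator A x * h x)" by (simp split: split_indicator)
    qed
    also have "\<dots> = ennreal (\<integral>x. indicator A x * h x \<partial>\<mu>)"
      using h01 by (intro nn_integral_eq_integral int_fg int_ind A h) auto
    finally show ?thesis using L_ge[OF A] h01 by (simp add: ennreal_inj integral_nonneg_AE)
  qed
  have lim: "(\<lambda>n. \<integral>x. f x * g (r n) x \<partial>\<mu>) \<longlonglongrightarrow> (\<integral>x. f x * h x \<partial>\<mu>)" if "integrable \<mu> f" for f :: "'a \<Rightarrow> real"
    using that
  proof (induction rule: integrable_induct)
    case (base A c)
    then have A: "A \<in> sets borel" using sets by simp
    have "(\<lambda>n. c * \<nu> (r n) A) \<longlonglongrightarrow> c * L A" by (intro tendsto_mult_left L A)
    then show ?case unfolding \<nu>_def Lh[OF A] by (simp add: mult_ac)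
  next
    case (add f1 f2)
    have "(\<integral>x. (f1 x + f2 x) * u x \<partial>\<mu>) = (\<integral>x. f1 x * u x \<partial>\<mu>) + (\<integral>x. f2 x * u x \<partial>\<mu>)"
      if "u \<in> borel_measurable borel" "\<And>x. 0 \<le> u x \<and> u x \<le> 1" for u
      using int_fg[OF add.hyps(1) that] int_fg[OF add.hyps(2) that] by (simp add: distrib_right)
    from this[OF h h01] this[OF g g01] show ?case using tendsto_add[OF add.IH] by simp
  next
    case (lim f s)
    have "(\<lambda>i. \<integral>x. \<bar>s i x - f x\<bar> \<partial>\<mu>) \<longlonglongrightarrow> (\<integral>x. 0 \<partial>\<mu>)"
    proof (rule integral_dominated_convergence)
      \<comment> \<open>The approximants of the induction rule satisfy |s i| \<le> 2 |f|, hence |s i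
        - f| \<le> 3 |f|.\<close>
      show "integrable \<mu> (\<lambda>x. 3 * \<bar>f x\<bar>)" using lim by auto
      show "AE x in \<mu>. (\<lambda>i. \<bar>s i x - f x\<bar>) \<longlonglongrightarrow> 0"
        using lim.hyps(2) by (intro AE_I2 tendsto_rabs_zero) (simp add: LIM_zero)
      show "AE x in \<mu>. norm \<bar>s i x - f x\<bar> \<le> 3 * \<bar>f x\<bar>" for i
      proof (intro AE_I2)
        fix x assume "x \<in> space \<mu>"
        from lim.hyps(3)[OF this, of i] show "norm \<bar>s i x - f x\<bar> \<le> 3 * \<bar>f x\<bar>"
          unfolding real_norm_def by linarith
      qed
    qed (use lim in auto)
    then have d: "(\<lambda>i. \<integral>x. \<bar>s i x - f x\<bar> \<partial>\<mu>) \<longlonglongrightarrow> 0" by simp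
    \<comment> \<open>The bound does not depend on \<open>u\<close>, so one approximant
      \<open>s i\<close> serves every \<open>g (r n)\<close> and the limit \<open>h\<close>
      simultaneously.\<close>
    have close: "\<bar>(\<integral>x. s i x * u x \<partial>\<mu>) - (\<integral>x. f x * u x \<partial>\<mu>)\<bar> \<le> (\<integral>x. \<bar>s i x - f x\<bar> \<partial>\<mu>)"
      if u: "u \<in> borel_measurable borel" "\<And>x. 0 \<le> u x \<and> u x \<le> 1" for i u
    proof -
      have "(\<integral>x. s i x * u x \<partial>\<mu>) - (\<integral>x. f x * u x \<partial>\<mu>) = (\<integral>x. (s i x - f x) * u x \<partial>\<mu>)"
        using int_fg[OF lim.hyps(1) u, of i] int_fg[OF lim.hyps(4) u] by (simp add: left_diff_distrib)
      also have "\<bar>\<dots>\<bar> \<le> (\<integral>x. \<bar>(s i x - f x) * u x\<bar> \<partial>\<mu>)" by (rule integral_abs_bound)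
      also have "\<dots> \<le> (\<integral>x. \<bar>s i x - f x\<bar> \<partial>\<mu>)"
        using u lim.hyps(1,4)
        by (intro integral_mono Bochner_Integration.integrable_abs int_fg Bochner_Integration.integrable_diff)
          (auto simp: abs_mult mult_left_le)
      finally show ?thesis .
    qed
    show ?case
    proof (rule metric_LIMSEQ_I)
      fix e :: real assume "e > 0"
      then obtain i where i: "(\<integral>x. \<bar>s i x - f x\<bar> \<partial>\<mu>) < e/3"
        using order_tendstoD(2)[OF d, of "e/3"] by (auto simp: eventually_sequentially)
      from metric_LIMSEQ_D[OF lim.IH[of i], of "e/3"] \<open>e > 0\<close> obtain M where
        M: "\<And>n. n \<ge> M \<Longrightarrow> dist (\<integral>x. s i x * g (r n) x \<partial>\<mu>) (\<integral>x. s i x * h x \<partial>\<mu>) < e/3" by auto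
      have "dist (\<integral>x. f x * g (r n) x \<partial>\<mu>) (\<integral>x. f x * h x \<partial>\<mu>) < e" if "n \<ge> M" for n
        using M[OF that] i close[OF g g01, of i "r n"] close[OF h h01, of i]
        unfolding dist_real_def by linarith
      then show "\<exists>M. \<forall>n\<ge>M. dist (\<integral>x. f x * g (r n) x \<partial>\<mu>) (\<integral>x. f x * h x \<partial>\<mu>) < e" by blast
    qed
  qed
  show ?thesis by (rule that[OF r h h01 lim])
qed

section \<open>Passage from finite measures to Lebesgue measure\<close>

lemma ball_in_sets_borel [measurable]: "ball (c::'a::metric_space) r \<in> sets borel"
  by simp

lemma cball_in_sets_borel [measurable]: "cball (c::'a::metric_space) r \<in> sets borel"
  by simp

text \<open>Where the integer part of |x| is n, the integrand is at most exp(-n), and such x lie in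
  a ball of volume V (n + 1)^d, so summability of exp(-n) (n + 1)^d suffices. The function serves
  twice: as a finite weight equivalent to Lebesgue measure and as a part of the shift of the entropy
  term.\<close>

lemma integrable_exp_minus_norm: "integrable lborel (\<lambda>x::'a::euclidean_space. exp (- norm x))"
proof (rule integrableI_nonneg)
  define V where "V = unit_ball_vol (DIM('a))"
  have V: "0 \<le> V" by (simp add: V_def)
  let ?a = "\<lambda>n::nat. exp (- real n) * (V * (real n + 1) ^ DIM('a))"
  have bound: "exp (- real n) * (real n + 1) ^ DIM('a) \<le> (2 * DIM('a)) ^ DIM('a) * exp (1/2) * exp (- 1 / 2) ^ n" for n
  proof -
    \<comment> \<open>With the scale 2 d, where d is the dimension, the d-th power of y \<le> exp y
      costs only exp((n + 1) / 2), about half of the available decay.\<close>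
    have "((real n + 1) / (2 * DIM('a))) ^ DIM('a) \<le> exp ((real n + 1) / (2 * DIM('a))) ^ DIM('a)"
      using exp_ge_add_one_self[of "(real n + 1) / (2 * DIM('a))"] by (intro power_mono; (linarith | simp))
    also have "\<dots> = exp ((real n + 1) / 2)" by (simp add: exp_of_nat_mult[symmetric])
    finally have "(real n + 1) ^ DIM('a) \<le> (2 * DIM('a)) ^ DIM('a) * exp ((real n + 1) / 2)"
      by (simp add: power_divide pos_divide_le_eq mult.commute)
    then have "exp (- real n) * (real n + 1) ^ DIM('a)
        \<le> exp (- real n) * ((2 * DIM('a)) ^ DIM('a) * exp ((real n + 1) / 2))"
      by (intro mult_left_mono) auto
    also have "\<dots> = (2 * DIM('a)) ^ DIM('a) * exp (1/2) * exp (- 1 / 2) ^ n"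
    proof -
      have "exp (- real n) * exp ((real n + 1) / 2) = exp (1/2) * exp (real n * (- 1 / 2))"
        unfolding mult_exp_exp by (rule arg_cong[of _ _ exp]) (simp add: field_simps)
      then show ?thesis unfolding exp_of_nat_mult by (simp add: mult.left_commute mult.assoc)
    qed
    finally show ?thesis .
  qed
  have "summable (\<lambda>n. (2 * DIM('a)) ^ DIM('a) * exp (1/2) * exp (- 1 / 2 :: real) ^ n)"
    by (intro summable_mult summable_geometric) auto
  then have "summable (\<lambda>n. exp (- real n) * (real n + 1) ^ DIM('a))"
    by (rule summable_comparison_test'[of _ 0]) (use bound in auto)
  from summable_mult[OF this, of V] have summable: "summable ?a" by (simp add: mult_ac)
  have "(\<integral>\<^sup>+(x::'a). ennreal (exp (- norm x)) \<partial>lborel)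
      \<le> (\<integral>\<^sup>+(x::'a). (\<Sum>n. ennreal (exp (- real n)) * indicator (cball 0 (real n + 1)) x) \<partial>lborel)"
  proof (intro nn_integral_mono)
    fix x :: 'a
    define n where "n = nat \<lfloor>norm x\<rfloor>"
    have n: "real n \<le> norm x" "norm x \<le> real n + 1"
      using norm_ge_zero[of x] unfolding n_def by linarith+
    have "ennreal (exp (- norm x)) \<le> ennreal (exp (- real n)) * indicator (cball 0 (real n + 1)) x"
      using n by (simp add: ennreal_leI)
    also have "\<dots> \<le> (\<Sum>n. ennreal (exp (- real n)) * indicator (cball 0 (real n + 1)) x)"
    proof -
      define a :: "nat \<Rightarrow> ennreal" where "a m = ennreal (exp (- real m)) * indicator (cball 0 (real m + 1)) x" for m
      have "a n \<le> (\<Sum>m. a m)" using sum_le_suminf[of a "{n}"] by simp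
      then show ?thesis by (simp only: a_def)
    qed
    finally show "ennreal (exp (- norm x)) \<le> (\<Sum>n. ennreal (exp (- real n)) * indicator (cball 0 (real n + 1)) x)" .
  qed
  also have "\<dots> = (\<Sum>n. ennreal (exp (- real n)) * emeasure lborel (cball (0::'a) (real n + 1)))"
  proof (subst nn_integral_suminf)
    show "(\<lambda>x::'a. ennreal (exp (- real n)) * indicator (cball 0 (real n + 1)) x) \<in> borel_measurable lborel" for n
      by measurable
    show "(\<Sum>n. \<integral>\<^sup>+(x::'a). ennreal (exp (- real n)) * indicator (cball 0 (real n + 1)) x \<partial>lborel)
        = (\<Sum>n. ennreal (exp (- real n)) * emeasure lborel (cball (0::'a) (real n + 1)))"
      by (intro suminf_cong nn_integral_cmult_indicator) simp
  qed
  also have "\<dots> = (\<Sum>n. ennreal (?a n))"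
  proof (intro suminf_cong)
    fix n :: nat
    have "emeasure lborel (cball (0::'a) (real n + 1)) = ennreal (V * (real n + 1) ^ DIM('a))"
      unfolding V_def by (rule emeasure_cball) simp
    then show "ennreal (exp (- real n)) * emeasure lborel (cball (0::'a) (real n + 1)) = ennreal (?a n)"
      using V by (simp only: ennreal_mult' exp_ge_zero)
  qed
  also have "\<dots> < \<infinity>"
    unfolding infinity_ennreal_def top.not_eq_extremum[symmetric]
    by (rule ennreal_suminf_neq_top[OF summable]) (use V in simp)
  finally show "(\<integral>\<^sup>+(x::'a). ennreal (exp (- norm x)) \<partial>lborel) < \<infinity>" .
qed auto

text \<open>The weight exp(-|x|) makes Lebesgue measure finite, and multiplying an integrable test
  function by exp(|x|) undoes the weight.\<close>

lemma weak_star_subsequence_lborel: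
  fixes g :: "nat \<Rightarrow> 'a::euclidean_space \<Rightarrow> real"
  assumes g[measurable]: "\<And>n. g n \<in> borel_measurable borel"
    and g01: "\<And>n x. 0 \<le> g n x \<and> g n x \<le> 1"
  obtains r h where "strict_mono r" "h \<in> borel_measurable borel" "\<And>x. 0 \<le> h x \<and> h x \<le> 1"
    "\<And>f. integrable lborel f \<Longrightarrow> (\<lambda>n. \<integral>x. f x * g (r n) x \<partial>lborel) \<longlonglongrightarrow> (\<integral>x. f x * h x \<partial>lborel)"
proof -
  define \<mu> :: "'a measure" where "\<mu> = density lborel (\<lambda>x. ennreal (exp (- norm x)))"
  have fin: "finite_measure \<mu>"
  proof (rule finite_measureI)
    have "emeasure \<mu> (space \<mu>) = (\<integral>\<^sup>+(x::'a). ennreal (exp (- norm x)) \<partial>lborel)"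
      by (simp add: \<mu>_def emeasure_density)
    then show "emeasure \<mu> (space \<mu>) \<noteq> \<infinity>"
      using integrableD(2)[OF integrable_exp_minus_norm] by simp
  qed
  have sets: "sets \<mu> = sets borel" by (simp add: \<mu>_def)
  obtain r h where r: "strict_mono r" and h[measurable]: "h \<in> borel_measurable borel"
    and h01: "\<And>x. 0 \<le> h x \<and> h x \<le> 1"
    and lim: "\<And>f. integrable \<mu> f \<Longrightarrow> (\<lambda>n. \<integral>x. f x * g (r n) x \<partial>\<mu>) \<longlonglongrightarrow> (\<integral>x. f x * h x \<partial>\<mu>)"
    by (rule weak_star_subsequence_finite_measure[of \<mu> g, OF fin sets g g01]) blast
  have "(\<lambda>n. \<integral>x. f x * g (r n) x \<partial>lborel) \<longlonglongrightarrow> (\<integral>x. f x * h x \<partial>lborel)"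
    if f: "integrable lborel f" for f
  proof -
    have [measurable]: "f \<in> borel_measurable borel" using f by auto
    have cancel: "exp (- norm x) * (f x * exp (norm x)) = f x" for x by (simp add: exp_minus)
    have "integrable \<mu> (\<lambda>x. f x * exp (norm x))"
      unfolding \<mu>_def by (subst integrable_density) (auto simp: cancel f)
    from lim[OF this] have "(\<lambda>n. \<integral>x. f x * exp (norm x) * g (r n) x \<partial>\<mu>) \<longlonglongrightarrow> (\<integral>x. f x * exp (norm x) * h x \<partial>\<mu>)" .
    moreover have "(\<integral>x. f x * exp (norm x) * u x \<partial>\<mu>) = (\<integral>x. f x * u x \<partial>lborel)"
      if [measurable]: "u \<in> borel_measurable borel" for u
    proof -
      have eq: "exp (- norm x) *\<^sub>R (f x * exp (norm x) * u x) = f x * u x" for x by (simp add: exp_minus)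
      show ?thesis unfolding \<mu>_def by (subst integral_density) (simp_all only: eq, measurable)
    qed
    ultimately show ?thesis by simp
  qed
  then show ?thesis using that[OF r h h01] by blast
qed

section \<open>Second moments and weak limits without loss of mass\<close>

lemma nn_integral_le_if_balls:
  fixes f :: "'a::euclidean_space \<Rightarrow> ennreal"
  assumes [measurable]: "f \<in> borel_measurable borel"
    and le: "\<And>n::nat. (\<integral>\<^sup>+x. f x * indicator (ball 0 (real n)) x \<partial>lborel) \<le> C"
  shows "(\<integral>\<^sup>+x. f x \<partial>lborel) \<le> C"
proof -
  let ?N = "density lborel f"
  have "(\<Union>n::nat. ball (0::'a) (real n)) = UNIV"
    using reals_Archimedean2 by auto
  moreover have "(SUP n::nat. emeasure ?N (ball 0 (real n))) = emeasure ?N (\<Union>n::nat. ball 0 (real n))"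
    by (intro SUP_emeasure_incseq) (auto simp: incseq_def)
  moreover have "(SUP n::nat. emeasure ?N (ball 0 (real n))) \<le> C"
    using le by (intro SUP_least) (simp add: emeasure_density)
  ultimately show ?thesis by (simp add: emeasure_density)
qed

text \<open>Chebyshev's inequality: outside the ball 1 \<le> |x|^2 / R^2. The error depends on
  \<open>u\<close> only through \<open>K\<close>, so tails are uniformly small along a sequence with
  bounded second moments.\<close>

lemma second_moment_tail_bound:
  fixes u f :: "'a::euclidean_space \<Rightarrow> real"
  assumes u: "integrable lborel u" "\<And>x. 0 \<le> u x" 
    and m: "(\<integral>\<^sup>+x. ennreal ((norm x)\<^sup>2 * u x) \<partial>lborel) \<le> ennreal K" "0 \<le> K"
    and f[measurable]: "f \<in> borel_measurable borel" and bd: "\<And>x. \<bar>f x\<bar> \<le> C" and R: "R > 0"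
  shows "\<bar>(\<integral>x. f x * u x \<partial>lborel) - (\<integral>x. (indicator (ball 0 R) x * f x) * u x \<partial>lborel)\<bar> \<le> C * K / R\<^sup>2"
proof -
  have [measurable]: "u \<in> borel_measurable borel" using u by auto
  have C: "0 \<le> C" using bd[of undefined] by linarith
  have int: "integrable lborel (\<lambda>x. v x * u x)"
    if [measurable]: "v \<in> borel_measurable borel" and "\<And>x. \<bar>v x\<bar> \<le> C" for v
    by (rule Bochner_Integration.integrable_bound[OF integrable_mult_right[OF u(1), of C]])
      (use that u in \<open>auto simp: abs_mult abs_of_nonneg[OF C] intro!: mult_right_mono\<close>)
  have i2: "integrable lborel (\<lambda>x. (norm x)\<^sup>2 * u x)"
    using m u by (intro integrableI_nonneg) (auto simp: le_less_trans)
  have "ennreal (\<integral>x. (norm x)\<^sup>2 * u x \<partial>lborel) \<le> ennreal K"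
    using m u by (subst nn_integral_eq_integral[symmetric, OF i2]) auto
  then have K: "(\<integral>x. (norm x)\<^sup>2 * u x \<partial>lborel) \<le> K" using m(2) by simp
  have fu: "integrable lborel (\<lambda>x. f x * u x)" by (rule int[OF f bd])
  have ifu: "integrable lborel (\<lambda>x. (indicator (ball 0 R) x * f x) * u x)"
  proof (rule int)
    show "\<bar>indicator (ball 0 R) x * f x\<bar> \<le> C" for x using bd[of x] C by (auto split: split_indicator)
    show "(\<lambda>x. indicator (ball 0 R) x * f x) \<in> borel_measurable borel"
      by (intro borel_measurable_times borel_measurable_indicator f) simp
  qed
  have "(\<integral>x. f x * u x \<partial>lborel) - (\<integral>x. (indicator (ball 0 R) x * f x) * u x \<partial>lborel)
      = (\<integral>x. f x * u x - (indicator (ball 0 R) x * f x) * u x \<partial>lborel)"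
    by (rule Bochner_Integration.integral_diff[symmetric, OF fu ifu])
  also have "\<bar>\<dots>\<bar> \<le> (\<integral>x. \<bar>f x * u x - (indicator (ball 0 R) x * f x) * u x\<bar> \<partial>lborel)"
    by (rule integral_abs_bound)
  also have "\<dots> \<le> (\<integral>x. C / R\<^sup>2 * ((norm x)\<^sup>2 * u x) \<partial>lborel)"
  proof (rule integral_mono)
    show "integrable lborel (\<lambda>x. \<bar>f x * u x - (indicator (ball 0 R) x * f x) * u x\<bar>)"
      by (intro Bochner_Integration.integrable_abs Bochner_Integration.integrable_diff fu ifu)
    show "integrable lborel (\<lambda>x. C / R\<^sup>2 * ((norm x)\<^sup>2 * u x))" using i2 by simp
    fix x :: 'a
    show "\<bar>f x * u x - (indicator (ball 0 R) x * f x) * u x\<bar> \<le> C / R\<^sup>2 * ((norm x)\<^sup>2 * u x)"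
    proof (cases "x \<in> ball 0 R")
      case False
      then have "R\<^sup>2 \<le> (norm x)\<^sup>2" using R by (intro power_mono) auto
      then have "1 \<le> (norm x)\<^sup>2 / R\<^sup>2" using R by simp
      then have "\<bar>f x\<bar> * u x * 1 \<le> C * u x * ((norm x)\<^sup>2 / R\<^sup>2)"
        using bd[of x] u(2)[of x] C by (intro mult_mono) auto
      then show ?thesis using False u(2)[of x] by (simp add: abs_mult mult_ac)
    qed (use C u in auto)
  qed
  also have "\<dots> \<le> C / R\<^sup>2 * K" using K C R by (simp add: divide_right_mono mult_left_mono)
  finally show ?thesis by simp
qed

lemma integrable_indicator_ball_bounded:
  fixes f :: "'a::euclidean_space \<Rightarrow> real"
  assumes [measurable]: "f \<in> borel_measurable borel" and bd: "\<And>x. norm x < R \<Longrightarrow> \<bar>f x\<bar> \<le> B"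
  shows "integrable lborel (\<lambda>x. indicator (ball 0 R) x * f x)"
proof (rule Bochner_Integration.integrable_bound[of _ "\<lambda>x. B * indicator (ball (0::'a) R) x"])
  show "integrable lborel (\<lambda>x. B * indicator (ball (0::'a) R) x)"
    using emeasure_lborel_ball_finite[of "0::'a" R] by (auto simp: integrable_indicator_iff)
  show "AE x in lborel. norm (indicator (ball 0 R) x * f x) \<le> norm (B * indicator (ball 0 R) x)"
  proof (intro AE_I2)
    show "norm (indicator (ball 0 R) x * f x) \<le> norm (B * indicator (ball 0 R) x)" for x
      using bd[of x] by (cases "norm x < R") auto
  qed
qed measurable

text \<open>Both classes of test functions matter: the constant 1 makes the masses converge, and the
  two classes match the two parts of an interaction in L1 + Linf.\<close>

definition weakly_convergent :: "(nat \<Rightarrow> 'a::euclidean_space \<Rightarrow> real) \<Rightarrow> ('a \<Rightarrow> real) \<Rightarrow> bool"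
  where "weakly_convergent g h \<longleftrightarrow>
    (\<forall>f. integrable lborel f \<or> f \<in> borel_measurable borel \<and> bounded (range f) \<longrightarrow>
      (\<lambda>n. \<integral>x. f x * g n x \<partial>lborel) \<longlonglongrightarrow> (\<integral>x. f x * h x \<partial>lborel))"

text \<open>Weak-star compactness handles integrable test functions. Truncated to a ball, |x|^2 is
  one of them, so the limit inherits the moment bound; with that bound on both sides, a bounded test
  function may be cut off to a large ball.\<close>

lemma weakly_convergent_subsequence:
  fixes g :: "nat \<Rightarrow> 'a::euclidean_space \<Rightarrow> real"
  assumes g: "\<And>n. integrable lborel (g n)"
    and g01: "\<And>n x. 0 \<le> g n x \<and> g n x \<le> 1"
    and m: "\<And>n. (\<integral>\<^sup>+x. ennreal ((norm x)\<^sup>2 * g n x) \<partial>lborel) \<le> ennreal K" and K: "0 \<le> K"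
  obtains r h where "strict_mono r" "integrable lborel h" "\<And>x. 0 \<le> h x \<and> h x \<le> 1"
    "(\<integral>\<^sup>+x. ennreal ((norm x)\<^sup>2 * h x) \<partial>lborel) \<le> ennreal K"
    "weakly_convergent (\<lambda>n. g (r n)) h"
proof -
  have gm[measurable]: "\<And>n. g n \<in> borel_measurable borel" using g by (auto dest: borel_measurable_integrable)
  obtain r h where r: "strict_mono r" and h[measurable]: "h \<in> borel_measurable borel"
    and h01: "\<And>x. 0 \<le> h x \<and> h x \<le> 1"
    and lim: "\<And>f. integrable lborel f \<Longrightarrow> (\<lambda>n. \<integral>x. f x * g (r n) x \<partial>lborel) \<longlonglongrightarrow> (\<integral>x. f x * h x \<partial>lborel)"
    by (rule weak_star_subsequence_lborel[of g, OF gm g01]) blast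
  have mh: "(\<integral>\<^sup>+x. ennreal ((norm x)\<^sup>2 * h x) \<partial>lborel) \<le> ennreal K"
  proof (rule nn_integral_le_if_balls)
    fix n :: nat
    let ?f = "\<lambda>x::'a. indicator (ball 0 (real n)) x * (norm x)\<^sup>2"
    have f: "integrable lborel ?f"
      by (rule integrable_indicator_ball_bounded[of _ _ "(real n)\<^sup>2"]) (auto intro!: power_mono)
    have ifu: "integrable lborel (\<lambda>x. ?f x * u x)" if [measurable]: "u \<in> borel_measurable borel"
      and "\<And>x. 0 \<le> u x \<and> u x \<le> 1" for u
      using that(2) by (intro Bochner_Integration.integrable_bound[OF f]) (auto simp: abs_mult intro!: mult_left_le)
    have "(\<integral>x. ?f x * g k x \<partial>lborel) \<le> K" for k
    proof -
      have "ennreal (\<integral>x. ?f x * g k x \<partial>lborel) = (\<integral>\<^sup>+x. ennreal (?f x * g k x) \<partial>lborel)"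
        using g01 by (intro nn_integral_eq_integral[symmetric] ifu) auto
      also have "\<dots> \<le> (\<integral>\<^sup>+x. ennreal ((norm x)\<^sup>2 * g k x) \<partial>lborel)"
        using g01 by (intro nn_integral_mono ennreal_leI) (auto split: split_indicator)
      also have "\<dots> \<le> ennreal K" by (rule m)
      finally show ?thesis using K by simp
    qed
    then have "(\<integral>x. ?f x * h x \<partial>lborel) \<le> K"
      by (intro LIMSEQ_le_const2[OF lim[OF f]]) auto
    then have "ennreal (\<integral>x. ?f x * h x \<partial>lborel) \<le> ennreal K" by (rule ennreal_leI)
    moreover have "ennreal (\<integral>x. ?f x * h x \<partial>lborel) = (\<integral>\<^sup>+x. ennreal (?f x * h x) \<partial>lborel)"
      using h01 by (intro nn_integral_eq_integral[symmetric] ifu) auto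
    moreover have "\<dots> = (\<integral>\<^sup>+x. ennreal ((norm x)\<^sup>2 * h x) * indicator (ball 0 (real n)) x \<partial>lborel)"
      by (intro nn_integral_cong) (auto split: split_indicator)
    ultimately show "(\<integral>\<^sup>+x. ennreal ((norm x)\<^sup>2 * h x) * indicator (ball 0 (real n)) x \<partial>lborel) \<le> ennreal K"
      by simp
  qed simp
  \<comment> \<open>Inside the unit ball h \<le> 1, outside it h \<le> |x|^2 h.\<close>
  have hi: "integrable lborel h"
  proof (rule integrableI_nonneg)
    have "(\<integral>\<^sup>+x. ennreal (h x) \<partial>lborel)
        \<le> (\<integral>\<^sup>+x. indicator (ball 0 1) x + ennreal ((norm x)\<^sup>2 * h x) \<partial>lborel)"
    proof (intro nn_integral_mono)
      fix x :: 'a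
      show "ennreal (h x) \<le> indicator (ball 0 1) x + ennreal ((norm x)\<^sup>2 * h x)"
      proof (cases "x \<in> ball 0 1")
        case True
        then have "ennreal (h x) \<le> indicator (ball 0 1) x" using h01[of x] by simp
        then show ?thesis by (rule order_trans) simp
      next
        case False
        then have "1 * h x \<le> (norm x)\<^sup>2 * h x" using h01[of x] by (intro mult_right_mono) auto
        then show ?thesis using False by (simp add: ennreal_leI)
      qed
    qed
    also have "\<dots> = emeasure lborel (ball (0::'a) 1) + (\<integral>\<^sup>+x. ennreal ((norm x)\<^sup>2 * h x) \<partial>lborel)"
      by (subst nn_integral_add) auto
    also have "\<dots> < \<infinity>" using emeasure_lborel_ball_finite[of "0::'a" 1] le_less_trans[OF mh] by simp
    finally show "(\<integral>\<^sup>+x. ennreal (h x) \<partial>lborel) < \<infinity>" .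
  qed (use h01 in auto)
  have limb: "(\<lambda>n. \<integral>x. f x * g (r n) x \<partial>lborel) \<longlonglongrightarrow> (\<integral>x. f x * h x \<partial>lborel)"
    if fm[measurable]: "f \<in> borel_measurable borel" and fb: "bounded (range f)" for f
  proof -
    obtain C where C: "\<And>x. \<bar>f x\<bar> \<le> C" using fb by (auto simp: bounded_iff)
    have C0: "0 \<le> C" using C[of undefined] by linarith
    show ?thesis
    proof (rule metric_LIMSEQ_I)
      fix e :: real assume e: "e > 0"
      \<comment> \<open>Chosen so that the tail error C K / R^2 is below e/3; the summand 1 keeps
        \<open>R\<close> positive when C K = 0.\<close>
      define R where "R = sqrt (3 * (C * K + 1) / e)"
      have CK: "0 \<le> C * K" using C0 K by simp
      have R: "R > 0" "R\<^sup>2 = 3 * (C * K + 1) / e" unfolding R_def using e CK by auto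
      have small: "C * K / R\<^sup>2 < e / 3" unfolding R(2) using e CK by (simp add: field_simps)
      have "integrable lborel (\<lambda>x. indicator (ball 0 R) x * f x)"
        by (rule integrable_indicator_ball_bounded[of _ _ C]) (use C in auto)
      from metric_LIMSEQ_D[OF lim[OF this], of "e/3"] e obtain M where
        M: "\<And>n. n \<ge> M \<Longrightarrow> dist (\<integral>x. indicator (ball 0 R) x * f x * g (r n) x \<partial>lborel)
            (\<integral>x. indicator (ball 0 R) x * f x * h x \<partial>lborel) < e/3" by auto
      have "dist (\<integral>x. f x * g (r n) x \<partial>lborel) (\<integral>x. f x * h x \<partial>lborel) < e" if "n \<ge> M" for n
        using M[OF that] small
          second_moment_tail_bound[OF g conjunct1[OF g01] m K fm C R(1), of "r n"]
          second_moment_tail_bound[OF hi conjunct1[OF h01] mh K fm C R(1)]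
        unfolding dist_real_def by linarith
      then show "\<exists>M. \<forall>n\<ge>M. dist (\<integral>x. f x * g (r n) x \<partial>lborel) (\<integral>x. f x * h x \<partial>lborel) < e" by blast
    qed
  qed
  show ?thesis
    by (rule that[OF r hi h01 mh]) (auto simp: weakly_convergent_def lim limb)
qed

section \<open>Kinetic energy and entropy\<close>

lemma entropy_fun_measurable [measurable]: "entropy_fun \<in> borel_measurable borel"
  unfolding entropy_fun_def[abs_def] by measurable

lemma entropy_fun_0 [simp]: "entropy_fun 0 = 0" and entropy_fun_1 [simp]: "entropy_fun 1 = 0"
  by (simp_all add: entropy_fun_def)

lemma entropy_fun_one_minus: "entropy_fun (1 - t) = entropy_fun t"
  by (simp add: entropy_fun_def algebra_simps)

lemma entropy_fun_nonneg:
  assumes "0 \<le> t" "t \<le> 1" shows "0 \<le> entropy_fun t"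
proof -
  have "t * ln t \<le> 0" using assms by (cases "t = 0") (auto simp: mult_le_0_iff)
  moreover have "(1 - t) * ln (1 - t) \<le> 0" using assms by (cases "t = 1") (auto simp: mult_le_0_iff)
  ultimately show ?thesis by (simp add: entropy_fun_def)
qed

text \<open>Relative entropy of two Bernoulli laws is nonnegative: ln y \<le> y - 1 is applied to t
  against s and to 1 - t against 1 - s, and the errors s - t and t - s cancel. As a function of t,
  the right side is the tangent of the concave entropy at s.\<close>

lemma entropy_fun_Gibbs:
  assumes t: "0 \<le> t" "t \<le> 1" and s: "0 < s" "s < 1"
  shows "entropy_fun t \<le> - t * ln s - (1 - t) * ln (1 - s)"
proof -
  have rel: "t * ln s - t * ln t \<le> s - t" if "0 \<le> t" "0 < s" for t s :: real
  proof (cases "t = 0")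
    case False
    with that have t: "0 < t" by simp
    have "t * ln (s / t) \<le> t * (s / t - 1)"
      using t that by (intro mult_left_mono ln_le_minus_one) auto
    then show ?thesis using t that by (simp add: ln_div right_diff_distrib)
  qed (use that in auto)
  show ?thesis
    using rel[of t s] rel[of "1 - t" "1 - s"] t s by (simp add: entropy_fun_def)
qed

text \<open>Gibbs' inequality at the Fermi-Dirac occupation \<open>s\<close> of a level with energy
  l gives the sharper remainder ln(1 + exp(-l)). With l = |x| the remainder exp(-|x|) is
  integrable.\<close>

lemma entropy_fun_le_exp:
  assumes t: "0 \<le> t" "t \<le> 1"
  shows "entropy_fun t \<le> l * t + exp (- l)"
proof -
  define s where "s = exp (- l) / (1 + exp (- l))"
  have pos: "0 < 1 + exp (- l)" by (simp add: add_pos_pos)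
  have s: "0 < s" "s < 1" "1 - s = 1 / (1 + exp (- l))"
    unfolding s_def using pos by (auto simp: field_simps)
  have ln: "ln s = - l - ln (1 + exp (- l))" "ln (1 - s) = - ln (1 + exp (- l))"
    unfolding s(3) unfolding s_def using pos by (simp_all add: ln_div)
  have "entropy_fun t \<le> l * t + ln (1 + exp (- l))"
    using entropy_fun_Gibbs[OF t s(1,2)] unfolding ln by (simp add: algebra_simps)
  also have "ln (1 + exp (- l)) \<le> exp (- l)" by (rule ln_add_one_self_le_self) simp
  finally show ?thesis by simp
qed

lemma entropy_fun_le_1: "0 \<le> t \<Longrightarrow> t \<le> 1 \<Longrightarrow> entropy_fun t \<le> 1"
  using entropy_fun_le_exp[of t 0] by simp

text \<open>
  Adding the integrable function \<open>T\<^sup>2 g + T exp (- |x|)\<close> makes the integrand of the kinetic and entropy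
  terms nonnegative and even leaves half of the kinetic energy for the moment bound.
\<close>

definition shifted_density :: "real \<Rightarrow> 'a::real_normed_vector \<Rightarrow> real \<Rightarrow> real"
  where "shifted_density T x t = (norm x)\<^sup>2 / 2 * t - T * entropy_fun t + (T\<^sup>2 * t + T * exp (- norm x))"

text \<open>The entropy costs at most T |x| t + T exp(-|x|). The second part is compensated by the
  shift; the first is absorbed by completing the square, (|x|/2 - T)^2 = |x|^2/4 - T |x| + T^2,
  which is the origin of the constant T^2 in the shift.\<close>

lemma shifted_density_ge:
  assumes t: "0 \<le> t" "t \<le> 1" and T: "0 \<le> T"
  shows "(norm x)\<^sup>2 / 4 * t \<le> shifted_density T x t"
proof -
  have "T * entropy_fun t \<le> T * (norm x * t + exp (- norm x))"
    by (rule mult_left_mono[OF entropy_fun_le_exp[OF t] T])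
  moreover have "0 \<le> (norm x / 2 - T)\<^sup>2 * t" using t by simp
  ultimately show ?thesis
    by (simp add: shifted_density_def power2_diff power_divide algebra_simps)
qed

lemma shifted_density_nonneg:
  assumes t: "0 \<le> t" "t \<le> 1" and T: "0 \<le> T"
  shows "0 \<le> shifted_density T x t"
proof -
  have "0 \<le> (norm x)\<^sup>2 / 4 * t" using t by simp
  also have "\<dots> \<le> shifted_density T x t" by (rule shifted_density_ge[OF assms])
  finally show ?thesis .
qed

lemma shifted_density_measurable [measurable]:
  assumes [measurable]: "g \<in> borel_measurable borel"
  shows "(\<lambda>x::'a::euclidean_space. shifted_density T x (g x)) \<in> borel_measurable borel"
  unfolding shifted_density_def by measurable

definition shifted_energy :: "real \<Rightarrow> ('a::euclidean_space \<Rightarrow> real) \<Rightarrow> ennreal"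
  where "shifted_energy T g = (\<integral>\<^sup>+x. ennreal (shifted_density T x (g x)) \<partial>lborel)"

text \<open>Pointwise, the positive part of f plus h equals f + h plus the negative part of f. All
  four terms are nonnegative, so the identity integrates without subtraction; the negative part is
  dominated by h and has a finite integral, which can therefore be moved across.\<close>

lemma ext_integral_eq_shift:
  assumes [measurable]: "f \<in> borel_measurable M" and h: "integrable M h" "\<And>x. 0 \<le> h x"
    and fh: "\<And>x. 0 \<le> f x + h x"
  shows "ext_integral M f = enn2ereal (\<integral>\<^sup>+x. ennreal (f x + h x) \<partial>M) - ereal (\<integral>x. h x \<partial>M)"
proof -
  have [measurable]: "h \<in> borel_measurable M" using h by auto
  let ?P = "\<integral>\<^sup>+x. ennreal (f x) \<partial>M" and ?N = "\<integral>\<^sup>+x. ennreal (- f x) \<partial>M"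
    and ?Q = "\<integral>\<^sup>+x. ennreal (f x + h x) \<partial>M"
  have H: "(\<integral>\<^sup>+x. ennreal (h x) \<partial>M) = ennreal (\<integral>x. h x \<partial>M)"
    using h by (intro nn_integral_eq_integral) auto
  have Hge: "0 \<le> (\<integral>x. h x \<partial>M)" using h by (intro integral_nonneg_AE) auto
  have "ennreal (f x) + ennreal (h x) = ennreal (f x + h x) + ennreal (- f x)" for x
  proof (cases "0 \<le> f x")
    case True
    then show ?thesis using h(2)[of x] by (simp add: ennreal_neg)
  next
    case False
    then show ?thesis using fh[of x] by (simp add: ennreal_neg ennreal_plus[symmetric] del: ennreal_plus)
  qed
  then have "(\<integral>\<^sup>+x. ennreal (f x) + ennreal (h x) \<partial>M) = (\<integral>\<^sup>+x. ennreal (f x + h x) + ennreal (- f x) \<partial>M)"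
    by simp
  then have eq: "?P + ennreal (\<integral>x. h x \<partial>M) = ?Q + ?N"
    by (simp add: nn_integral_add H)
  have "?N \<le> (\<integral>\<^sup>+x. ennreal (h x) \<partial>M)"
  proof (intro nn_integral_mono ennreal_leI)
    show "- f x \<le> h x" for x using fh[of x] by simp
  qed
  then have "?N < top" by (simp add: H le_less_trans)
  then obtain n where n: "0 \<le> n" "?N = ennreal n" by (cases ?N) auto
  show ?thesis
  proof (cases ?P)
    case (real p)
    with eq n Hge have "?Q < top" by (auto simp: less_top[symmetric] top_add)
    then obtain q where q: "0 \<le> q" "?Q = ennreal q" by (cases ?Q) auto
    have "ennreal (p + (\<integral>x. h x \<partial>M)) = ennreal (q + n)" using eq real n q Hge by simp
    then have "p + (\<integral>x. h x \<partial>M) = q + n" using real n q Hge by (subst (asm) ennreal_inj) auto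
    then show ?thesis using real n q by (simp add: ext_integral_def enn2ereal_ennreal)
  next
    case top
    with eq n have "?Q + ennreal n = top" by simp
    then have "?Q = top" by (metis ennreal_add_eq_top ennreal_neq_top)
    with top n show ?thesis by (simp add: ext_integral_def enn2ereal_ennreal)
  qed
qed

section \<open>Lower semicontinuity of the kinetic and entropy part\<close>

definition unit_clamp :: "real \<Rightarrow> real \<Rightarrow> real" where "unit_clamp d t = max d (min (1 - d) t)"

text \<open>At interior points the clamp is eventually inactive; at an end point the claim is t ln t
  \<longlonglongrightarrow> 0, up to the symmetry t to 1 - t. Starting at 1/3 keeps the cut-off
  below 1/2, so that the interval [d, 1 - d] is not degenerate.\<close>

lemma entropy_fun_clamp_tendsto:
  assumes "0 \<le> t" "t \<le> 1"
  shows "(\<lambda>k. entropy_fun (unit_clamp (1 / (real k + 3)) t)) \<longlonglongrightarrow> entropy_fun t"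
proof -
  have 0: "(\<lambda>k. entropy_fun (1 / (real k + 3))) \<longlonglongrightarrow> 0"
    unfolding entropy_fun_def by real_asymp
  have small: "1 / (real k + 3) \<le> 1 / 3" for k by (simp add: field_simps)
  consider "t = 0" | "t = 1" | "0 < t" "t < 1" using assms by linarith
  then show ?thesis
  proof cases
    case 1
    then have "unit_clamp (1 / (real k + 3)) t = 1 / (real k + 3)" for k
      using small[of k] by (auto simp: unit_clamp_def)
    then show ?thesis using 0 1 by simp
  next
    case 2
    then have "unit_clamp (1 / (real k + 3)) t = 1 - 1 / (real k + 3)" for k
      using small[of k] by (auto simp: unit_clamp_def)
    then show ?thesis using 0 2 by (simp add: entropy_fun_one_minus)
  next
    case 3
    have lim: "(\<lambda>k. 1 / (real k + 3)) \<longlonglongrightarrow> 0" by real_asymp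
    have "eventually (\<lambda>k. 1 / (real k + 3) < t \<and> 1 / (real k + 3) < 1 - t) sequentially"
      using 3 by (intro eventually_conj order_tendstoD(2)[OF lim]) auto
    then have "eventually (\<lambda>k. entropy_fun (unit_clamp (1 / (real k + 3)) t) = entropy_fun t) sequentially"
      by eventually_elim (auto simp: unit_clamp_def max_def min_def)
    then show ?thesis by (rule tendsto_eventually)
  qed
qed

text \<open>
  Gibbs' inequality bounds the entropy by its tangents. The tangent is taken at the limit \<open>h\<close> cut off to
  \<open>[d, 1 - d]\<close>, where its slope is bounded and can serve as a test function.
\<close>

lemma shifted_energy_lower_semicontinuous:
  fixes g :: "nat \<Rightarrow> 'a::euclidean_space \<Rightarrow> real"
  assumes gm[measurable]: "\<And>n. g n \<in> borel_measurable borel" and g01: "\<And>n x. 0 \<le> g n x \<and> g n x \<le> 1"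
    and hm[measurable]: "h \<in> borel_measurable borel" and h01: "\<And>x. 0 \<le> h x \<and> h x \<le> 1"
    and T: "0 \<le> T"
    and weak: "weakly_convergent g h"
    and le: "\<And>n. shifted_energy T (g n) \<le> ennreal (c n)" and c: "\<And>n. 0 \<le> c n" "c \<longlonglongrightarrow> c0"
  shows "shifted_energy T h \<le> ennreal c0"
  unfolding shifted_energy_def
proof (rule nn_integral_le_if_balls)
  fix N :: nat
  let ?I = "indicator (ball (0::'a) (real N)) :: 'a \<Rightarrow> real"
  have c0: "0 \<le> c0" by (rule LIMSEQ_le_const[OF c(2)]) (use c(1) in auto)
  have abs3: "\<bar>a - b + c\<bar> \<le> A * 1 + B * 1 + C * 1"
    if "\<bar>a\<bar> \<le> A * 1" "\<bar>b\<bar> \<le> B * 1" "\<bar>c\<bar> \<le> C * 1" for a b c A B C :: real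
    using that by linarith
  have sd_bd: "\<bar>shifted_density T x t\<bar> \<le> (real N)\<^sup>2 / 2 + T + T\<^sup>2 + T"
    if "norm x < real N" "0 \<le> t" "t \<le> 1" for x :: 'a and t
  proof -
    have "(norm x)\<^sup>2 * t \<le> (real N)\<^sup>2 * 1" using that by (intro mult_mono power_mono) auto
    moreover have "0 \<le> T * entropy_fun t"
      using entropy_fun_nonneg[of t] that T by simp
    moreover have "T * exp (- norm x) \<le> T * 1" "T\<^sup>2 * t \<le> T\<^sup>2 * 1"
      using that T by (intro mult_left_mono; simp)+
    ultimately show ?thesis
      using shifted_density_nonneg[of t T x] that T unfolding shifted_density_def by simp
  qed
  have isd: "integrable lborel (\<lambda>x. ?I x * shifted_density T x (u x))"
    if [measurable]: "u \<in> borel_measurable borel" and "\<And>x. 0 \<le> u x \<and> u x \<le> 1" for u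
    by (rule integrable_indicator_ball_bounded[OF _ sd_bd]) (use that(2) in auto)
  have nn: "(\<integral>\<^sup>+x. ennreal (shifted_density T x (u x)) * indicator (ball 0 (real N)) x \<partial>lborel)
      = ennreal (\<integral>x. ?I x * shifted_density T x (u x) \<partial>lborel)"
    if u: "u \<in> borel_measurable borel" "\<And>x. 0 \<le> u x \<and> u x \<le> 1" for u
  proof -
    have "(\<integral>\<^sup>+x. ennreal (shifted_density T x (u x)) * indicator (ball 0 (real N)) x \<partial>lborel)
        = (\<integral>\<^sup>+x. ennreal (?I x * shifted_density T x (u x)) \<partial>lborel)"
      by (intro nn_integral_cong) (auto split: split_indicator)
    also have "\<dots> = ennreal (\<integral>x. ?I x * shifted_density T x (u x) \<partial>lborel)"
      using u(2) T by (intro nn_integral_eq_integral isd u) (auto intro!: mult_nonneg_nonneg shifted_density_nonneg)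
    finally show ?thesis .
  qed
  have gn: "(\<integral>x. ?I x * shifted_density T x (g n x) \<partial>lborel) \<le> c n" for n
  proof -
    have "ennreal (\<integral>x. ?I x * shifted_density T x (g n x) \<partial>lborel)
        \<le> (\<integral>\<^sup>+x. ennreal (shifted_density T x (g n x)) \<partial>lborel)"
      unfolding nn[OF gm g01, symmetric] by (intro nn_integral_mono) (auto split: split_indicator)
    also have "\<dots> \<le> ennreal (c n)" using le by (simp add: shifted_energy_def)
    finally show ?thesis using c(1) by simp
  qed
  have clamped: "(\<integral>x. ?I x * (((norm x)\<^sup>2 / 2 + T\<^sup>2) * h x - T * entropy_fun (unit_clamp d (h x)) + T * exp (- norm x)) \<partial>lborel) \<le> c0"
    (is "(\<integral>x. ?F x \<partial>lborel) \<le> c0")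
    and clamped_int: "integrable lborel (\<lambda>x. ?I x * (((norm x)\<^sup>2 / 2 + T\<^sup>2) * h x - T * entropy_fun (unit_clamp d (h x)) + T * exp (- norm x)))"
    if d: "0 < d" "d < 1 / 2" for d
  proof -
    define s where "s x = unit_clamp d (h x)" for x
    have s: "d \<le> s x" "s x \<le> 1 - d" for x using d by (auto simp: s_def unit_clamp_def)
    have sm[measurable]: "s \<in> borel_measurable borel" unfolding s_def unit_clamp_def by measurable
    have ln_bd: "\<bar>ln (s x)\<bar> \<le> - ln d" "\<bar>ln (1 - s x)\<bar> \<le> - ln d" for x
      using s[of x] d by (auto simp: abs_of_nonpos)
    \<comment> \<open>The affine function \<open>\<alpha> x * t + \<beta> x\<close> of t is the
      tangent minorant of \<open>shifted_density T x t\<close> at t = s x. On the ball its slope is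
      bounded, hence an admissible test function.\<close>
    define \<alpha> where "\<alpha> x = (norm x)\<^sup>2 / 2 + T\<^sup>2 + T * (ln (s x) - ln (1 - s x))" for x
    define \<beta> where "\<beta> x = T * ln (1 - s x) + T * exp (- norm x)" for x
    have [measurable]: "\<alpha> \<in> borel_measurable borel" "\<beta> \<in> borel_measurable borel"
      unfolding \<alpha>_def \<beta>_def by measurable
    have \<alpha>_bd: "\<bar>\<alpha> x\<bar> \<le> (real N)\<^sup>2 / 2 + T\<^sup>2 + T * (- 2 * ln d)" if "norm x < real N" for x
    proof -
      have "(norm x)\<^sup>2 \<le> (real N)\<^sup>2" using that by (intro power_mono) auto
      moreover have "\<bar>T * (ln (s x) - ln (1 - s x))\<bar> \<le> T * (- 2 * ln d)"
        unfolding abs_mult abs_of_nonneg[OF T] using ln_bd[of x] T by (intro mult_left_mono) linarith+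
      ultimately show ?thesis unfolding \<alpha>_def by (smt (verit) zero_le_power2 divide_nonneg_pos divide_right_mono)
    qed
    have \<beta>_bd: "\<bar>\<beta> x\<bar> \<le> T * (- ln d) + T" for x
    proof -
      have "\<bar>T * ln (1 - s x)\<bar> \<le> T * (- ln d)"
        unfolding abs_mult abs_of_nonneg[OF T] using ln_bd[of x] T by (intro mult_left_mono) linarith+
      moreover have "\<bar>T * exp (- norm x)\<bar> \<le> T * 1"
        unfolding abs_mult abs_of_nonneg[OF T] using T by (intro mult_left_mono) auto
      ultimately show ?thesis unfolding \<beta>_def by linarith
    qed
    have i\<alpha>: "integrable lborel (\<lambda>x. ?I x * \<alpha> x)"
      by (rule integrable_indicator_ball_bounded[OF _ \<alpha>_bd]) auto
    have i\<beta>: "integrable lborel (\<lambda>x. ?I x * \<beta> x)"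
      by (rule integrable_indicator_ball_bounded[OF _ \<beta>_bd]) auto
    have i\<alpha>u: "integrable lborel (\<lambda>x. ?I x * \<alpha> x * u x)"
      if "u \<in> borel_measurable borel" "\<And>x. 0 \<le> u x \<and> u x \<le> 1" for u
      using that by (intro Bochner_Integration.integrable_bound[OF i\<alpha>]) (auto simp: abs_mult intro!: mult_left_le mult_nonneg_nonneg)
    have "(\<integral>x. ?I x * \<alpha> x * g n x \<partial>lborel) + (\<integral>x. ?I x * \<beta> x \<partial>lborel) \<le> c n" for n
    proof -
      have "(\<integral>x. ?I x * \<alpha> x * g n x \<partial>lborel) + (\<integral>x. ?I x * \<beta> x \<partial>lborel)
          = (\<integral>x. ?I x * \<alpha> x * g n x + ?I x * \<beta> x \<partial>lborel)"
        by (intro Bochner_Integration.integral_add[symmetric] i\<alpha>u i\<beta> gm g01)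
      also have "\<dots> \<le> (\<integral>x. ?I x * shifted_density T x (g n x) \<partial>lborel)"
      proof (intro integral_mono Bochner_Integration.integrable_add i\<alpha>u i\<beta> gm g01 isd)
        fix x :: 'a
        have "entropy_fun (g n x) \<le> - g n x * ln (s x) - (1 - g n x) * ln (1 - s x)"
          using g01[of n x] s[of x] d by (intro entropy_fun_Gibbs) auto
        then have "T * entropy_fun (g n x) \<le> T * (- g n x * ln (s x) - (1 - g n x) * ln (1 - s x))"
          using T by (rule mult_left_mono)
        then have "\<alpha> x * g n x + \<beta> x \<le> shifted_density T x (g n x)"
          unfolding \<alpha>_def \<beta>_def shifted_density_def by (simp add: algebra_simps)
        then show "?I x * \<alpha> x * g n x + ?I x * \<beta> x \<le> ?I x * shifted_density T x (g n x)"
          by (simp split: split_indicator)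
      qed
      also have "\<dots> \<le> c n" by (rule gn)
      finally show ?thesis .
    qed
    moreover have "(\<lambda>n. (\<integral>x. ?I x * \<alpha> x * g n x \<partial>lborel) + (\<integral>x. ?I x * \<beta> x \<partial>lborel))
        \<longlonglongrightarrow> (\<integral>x. ?I x * \<alpha> x * h x \<partial>lborel) + (\<integral>x. ?I x * \<beta> x \<partial>lborel)"
      using weak i\<alpha> unfolding weakly_convergent_def by (intro tendsto_add tendsto_const) auto
    ultimately have lim: "(\<integral>x. ?I x * \<alpha> x * h x \<partial>lborel) + (\<integral>x. ?I x * \<beta> x \<partial>lborel) \<le> c0"
      using LIMSEQ_le[OF _ c(2)] by blast
    show iF: "integrable lborel ?F"
    proof (rule integrable_indicator_ball_bounded)
      fix x :: 'a assume x: "norm x < real N"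
      have sx: "0 \<le> s x" "s x \<le> 1" using s[of x] d by linarith+
      have b1: "\<bar>((norm x)\<^sup>2 / 2 + T\<^sup>2) * h x\<bar> \<le> ((real N)\<^sup>2 / 2 + T\<^sup>2) * 1"
        unfolding abs_mult using h01[of x] x by (intro mult_mono) (auto intro!: divide_right_mono power_mono)
      have b2: "\<bar>T * entropy_fun (s x)\<bar> \<le> T * 1"
        unfolding abs_mult abs_of_nonneg[OF T] using T entropy_fun_nonneg[OF sx] entropy_fun_le_1[OF sx]
        by (intro mult_left_mono) auto
      have b3: "\<bar>T * exp (- norm x)\<bar> \<le> T * 1"
        unfolding abs_mult abs_of_nonneg[OF T] using T by (intro mult_left_mono) auto
      show "\<bar>((norm x)\<^sup>2 / 2 + T\<^sup>2) * h x - T * entropy_fun (unit_clamp d (h x)) + T * exp (- norm x)\<bar>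
          \<le> ((real N)\<^sup>2 / 2 + T\<^sup>2) + T + T"
        using abs3[OF b1 b2 b3] unfolding s_def by simp
    qed (unfold unit_clamp_def, measurable)
    have "(\<integral>x. ?F x \<partial>lborel) \<le> (\<integral>x. ?I x * \<alpha> x * h x + ?I x * \<beta> x \<partial>lborel)"
    proof (intro integral_mono iF Bochner_Integration.integrable_add i\<alpha>u i\<beta> hm h01)
      fix x :: 'a
      \<comment> \<open>The tangent is taken at \<open>s x\<close> but evaluated at
        \<open>h x\<close>. The discrepancy has the right sign: if the clamp raises h to d then ln s
        < ln(1 - s), and if it lowers h both signs are reversed.\<close>
      have "0 \<le> (h x - s x) * (ln (s x) - ln (1 - s x))"
      proof (cases "h x < d \<or> h x > 1 - d")
        case True
        then show ?thesis
        proof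
          assume *: "h x < d"
          then have "s x = d" using d by (simp add: s_def unit_clamp_def)
          then show ?thesis using * d by (intro mult_nonpos_nonpos) auto
        next
          assume *: "h x > 1 - d"
          then have "s x = 1 - d" using d by (simp add: s_def unit_clamp_def)
          then show ?thesis using * d by (intro mult_nonneg_nonneg) auto
        qed
      next
        case False
        then have "s x = h x" by (simp add: s_def unit_clamp_def)
        then show ?thesis by simp
      qed
      then have "0 \<le> T * ((h x - s x) * (ln (s x) - ln (1 - s x)))" using T by simp
      then have "((norm x)\<^sup>2 / 2 + T\<^sup>2) * h x - T * entropy_fun (unit_clamp d (h x)) + T * exp (- norm x) \<le> \<alpha> x * h x + \<beta> x"
        unfolding \<alpha>_def \<beta>_def s_def[symmetric] entropy_fun_def by (simp add: algebra_simps)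
      then show "?F x \<le> ?I x * \<alpha> x * h x + ?I x * \<beta> x" by (simp split: split_indicator)
    qed
    also have "\<dots> = (\<integral>x. ?I x * \<alpha> x * h x \<partial>lborel) + (\<integral>x. ?I x * \<beta> x \<partial>lborel)"
      by (intro Bochner_Integration.integral_add i\<alpha>u i\<beta> hm h01)
    finally show "(\<integral>x. ?F x \<partial>lborel) \<le> c0" using lim by simp
  qed
  define d where "d k = 1 / (real k + 3)" for k :: nat
  have d: "0 < d k" "d k < 1 / 2" for k by (auto simp: d_def field_simps)
  have sx: "0 \<le> unit_clamp (d k) (h x)" "unit_clamp (d k) (h x) \<le> 1" for k x
    using d[of k] by (auto simp: unit_clamp_def)
  \<comment> \<open>The sequence \<open>g\<close> has been eliminated, so the cut-off may tend to 0:
    only the bounded entropy remains, no longer its unbounded slope.\<close>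
  have "(\<lambda>k. \<integral>x. ?I x * (((norm x)\<^sup>2 / 2 + T\<^sup>2) * h x - T * entropy_fun (unit_clamp (d k) (h x)) + T * exp (- norm x)) \<partial>lborel)
      \<longlonglongrightarrow> (\<integral>x. ?I x * (((norm x)\<^sup>2 / 2 + T\<^sup>2) * h x - T * entropy_fun (h x) + T * exp (- norm x)) \<partial>lborel)"
  proof (rule integral_dominated_convergence)
    show "integrable lborel (\<lambda>x. ?I x * (((real N)\<^sup>2 / 2 + T\<^sup>2) + T + T))"
      by (rule integrable_indicator_ball_bounded[of _ _ "\<bar>((real N)\<^sup>2 / 2 + T\<^sup>2) + T + T\<bar>"]) auto
    show "AE x in lborel. (\<lambda>k. ?I x * (((norm x)\<^sup>2 / 2 + T\<^sup>2) * h x - T * entropy_fun (unit_clamp (d k) (h x)) + T * exp (- norm x)))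
        \<longlonglongrightarrow> ?I x * (((norm x)\<^sup>2 / 2 + T\<^sup>2) * h x - T * entropy_fun (h x) + T * exp (- norm x))"
      unfolding d_def using h01
      by (intro AE_I2 tendsto_mult_left tendsto_add tendsto_diff tendsto_const entropy_fun_clamp_tendsto) auto
    show "AE x in lborel. norm (?I x * (((norm x)\<^sup>2 / 2 + T\<^sup>2) * h x - T * entropy_fun (unit_clamp (d k) (h x)) + T * exp (- norm x)))
        \<le> ?I x * (((real N)\<^sup>2 / 2 + T\<^sup>2) + T + T)" for k
    proof (intro AE_I2)
      fix x :: 'a
      have "\<bar>((norm x)\<^sup>2 / 2 + T\<^sup>2) * h x - T * entropy_fun (unit_clamp (d k) (h x)) + T * exp (- norm x)\<bar>
          \<le> ((real N)\<^sup>2 / 2 + T\<^sup>2) + T + T" if x: "norm x < real N"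
      proof -
        have b1: "\<bar>((norm x)\<^sup>2 / 2 + T\<^sup>2) * h x\<bar> \<le> ((real N)\<^sup>2 / 2 + T\<^sup>2) * 1"
          unfolding abs_mult using h01[of x] x by (intro mult_mono) (auto intro!: divide_right_mono power_mono)
        have b2: "\<bar>T * entropy_fun (unit_clamp (d k) (h x))\<bar> \<le> T * 1"
          unfolding abs_mult abs_of_nonneg[OF T] using T entropy_fun_nonneg[OF sx] entropy_fun_le_1[OF sx]
          by (intro mult_left_mono) auto
        have b3: "\<bar>T * exp (- norm x)\<bar> \<le> T * 1"
          unfolding abs_mult abs_of_nonneg[OF T] using T by (intro mult_left_mono) auto
        show ?thesis using abs3[OF b1 b2 b3] by simp
      qed
      then show "norm (?I x * (((norm x)\<^sup>2 / 2 + T\<^sup>2) * h x - T * entropy_fun (unit_clamp (d k) (h x)) + T * exp (- norm x)))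
        \<le> ?I x * (((real N)\<^sup>2 / 2 + T\<^sup>2) + T + T)" by (cases "norm x < real N") auto
    qed
  qed (unfold unit_clamp_def, measurable)
  then have "(\<integral>x. ?I x * (((norm x)\<^sup>2 / 2 + T\<^sup>2) * h x - T * entropy_fun (h x) + T * exp (- norm x)) \<partial>lborel) \<le> c0"
    by (rule LIMSEQ_le_const2) (use clamped[OF d] in auto)
  moreover have "((norm x)\<^sup>2 / 2 + T\<^sup>2) * h x - T * entropy_fun (h x) + T * exp (- norm x) = shifted_density T x (h x)" for x
    by (simp add: shifted_density_def algebra_simps)
  ultimately show "(\<integral>\<^sup>+x. ennreal (shifted_density T x (h x)) * indicator (ball 0 (real N)) x \<partial>lborel) \<le> ennreal c0"
    unfolding nn[OF hm h01] by (simp add: ennreal_leI)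
qed measurable

section \<open>The exchange energy\<close>

lemma distr_lborel_reflect: "distr lborel borel (\<lambda>y. k - y) = (lborel :: 'a::euclidean_space measure)"
proof -
  have "lborel = density (distr lborel borel (\<lambda>y. k - y :: 'a)) (\<lambda>_. 1)"
    using lborel_affine[of "-1" k] by simp
  then show ?thesis by (simp add: density_1)
qed

text \<open>Clamping the bounded part and assigning the rest w - w2 to the integrable part removes
  the exceptional null sets, because w - w2 agrees with the original integrable part almost
  everywhere.\<close>

lemma L1_plus_Linf_decomposition:
  assumes "L1_plus_Linf w"
  obtains w1 w2 C where "integrable lborel w1" "w2 \<in> borel_measurable borel" "\<And>x. \<bar>w2 x\<bar> \<le> C"
    "\<And>x. w x = w1 x + w2 x"
proof -
  from assms obtain u1 u2 C where wm[measurable]: "w \<in> borel_measurable borel" and u1: "integrable lborel u1"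
    and [measurable]: "u2 \<in> borel_measurable borel" and u2: "AE k in lborel. \<bar>u2 k\<bar> \<le> C"
    and eq: "AE k in lborel. w k = u1 k + u2 k"
    by (auto simp: L1_plus_Linf_def)
  define w2 where "w2 x = max (- \<bar>C\<bar>) (min \<bar>C\<bar> (u2 x))" for x
  have [measurable]: "w2 \<in> borel_measurable borel" unfolding w2_def by measurable
  have "AE x in lborel. u1 x = w x - w2 x"
    using u2 eq by eventually_elim (auto simp: w2_def)
  then have "integrable lborel (\<lambda>x. w x - w2 x)"
    using integrable_cong_AE[of u1 lborel "\<lambda>x. w x - w2 x"] u1 by auto
  moreover have "\<bar>w2 x\<bar> \<le> \<bar>C\<bar>" for x by (auto simp: w2_def)
  ultimately show ?thesis using that[of "\<lambda>x. w x - w2 x" w2 "\<bar>C\<bar>"] by auto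
qed

lemma integrable_reflect:
  fixes f :: "'a::euclidean_space \<Rightarrow> real"
  assumes "integrable lborel f"
  shows "integrable lborel (\<lambda>y. f (k - y))"
proof -
  have "integrable (distr lborel borel (\<lambda>y. k - y)) f" using assms by (simp add: distr_lborel_reflect)
  then show ?thesis using assms by (subst (asm) integrable_distr_eq) auto
qed

text \<open>For each x, the bad y lie in the reflected and translated null set x - N, again a null
  set; Fubini does the rest. This carries positivity of \<open>w\<close> over to pairs of
  momenta.\<close>

lemma AE_lborel_diff:
  assumes "AE x in lborel. P (x::'a::euclidean_space)"
  shows "AE (x, y) in lborel \<Otimes>\<^sub>M lborel. P (x - y)"
proof -
  from assms obtain N where N: "N \<in> null_sets lborel" "{x. \<not> P x} \<subseteq> N"
    by (auto elim!: AE_E simp: null_sets_def)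
  then have [measurable]: "N \<in> sets borel" by auto
  have "AE y in lborel. k - y \<notin> N" for k :: 'a
  proof -
    have "AE y in distr lborel borel (\<lambda>y. k - y). y \<notin> N"
      using N(1) by (simp add: distr_lborel_reflect AE_not_in)
    then show ?thesis by (subst (asm) AE_distr_iff) auto
  qed
  then have "AE (x, y) in lborel \<Otimes>\<^sub>M lborel. x - y \<notin> N"
  proof (intro lborel_pair.AE_pair_measure)
    have "Measurable.pred (lborel \<Otimes>\<^sub>M lborel) (\<lambda>p::'a \<times> 'a. fst p - snd p \<notin> N)" by measurable
    then show "{p \<in> space (lborel \<Otimes>\<^sub>M lborel). case p of (x, y) \<Rightarrow> x - y \<notin> N} \<in> sets (lborel \<Otimes>\<^sub>M lborel)"
      by (simp add: split_beta' pred_def)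
  qed auto
  then show ?thesis by (rule AE_mp) (use N(2) in \<open>auto intro!: AE_I2\<close>)
qed

section \<open>Convolution with the interaction\<close>

definition convolve :: "(real^'d \<Rightarrow> real) \<Rightarrow> (real^'d \<Rightarrow> real) \<Rightarrow> real^'d \<Rightarrow> real"
  where "convolve w v x = (\<integral>y. w (x - y) * v y \<partial>lborel)"

text \<open>The integrable part of \<open>w\<close> is paired with the supremum of v, the bounded
  part with its L1 norm: \<open>A\<close> is the L1 norm of the former and \<open>C\<close> the
  bound of the latter. Both constants are independent of x and v, as compactness arguments
  require.\<close>

lemma convolve_bounds:
  fixes w :: "real^'d \<Rightarrow> real"
  assumes "L1_plus_Linf w"
  shows "\<exists>A C. 0 \<le> A \<and> 0 \<le> C \<and> (\<forall>v D x. integrable lborel v \<longrightarrow> (\<forall>y. \<bar>v y\<bar> \<le> D) \<longrightarrow>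
    integrable lborel (\<lambda>y. w (x - y) * v y) \<and>
    (\<integral>y. \<bar>w (x - y) * v y\<bar> \<partial>lborel) \<le> A * D + C * (\<integral>y. \<bar>v y\<bar> \<partial>lborel))"
proof -
  from L1_plus_Linf_decomposition[OF assms] obtain w1 w2 C where w1: "integrable lborel w1"
    and w2[measurable]: "w2 \<in> borel_measurable borel" and C: "\<And>x. \<bar>w2 x\<bar> \<le> C" and w: "\<And>x. w x = w1 x + w2 x"
    by blast
  have [measurable]: "w1 \<in> borel_measurable borel" using w1 by auto
  have C0: "0 \<le> C" using C[of 0] by linarith
  define A where "A = (\<integral>x. \<bar>w1 x\<bar> \<partial>lborel)"
  have A0: "0 \<le> A" unfolding A_def by (intro integral_nonneg_AE) auto
  have A: "(\<integral>y. \<bar>w1 (x - y)\<bar> \<partial>lborel) = A" for x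
  proof -
    have "A = (\<integral>y. \<bar>w1 y\<bar> \<partial>distr lborel borel (\<lambda>y. x - y))" by (simp add: distr_lborel_reflect A_def)
    then show ?thesis by (subst (asm) integral_distr) auto
  qed
  have int: "integrable lborel (\<lambda>y. w (x - y) * v y)"
    and le: "(\<integral>y. \<bar>w (x - y) * v y\<bar> \<partial>lborel) \<le> A * D + C * (\<integral>y. \<bar>v y\<bar> \<partial>lborel)"
    if v: "integrable lborel v" and D: "\<And>y. \<bar>v y\<bar> \<le> D" for v D x
  proof -
    have [measurable]: "v \<in> borel_measurable borel" using v by auto
    have i: "integrable lborel (\<lambda>y. \<bar>w1 (x - y)\<bar> * D + C * \<bar>v y\<bar>)"
      using integrable_reflect[OF w1, of x] v by auto
    have bd: "\<bar>w (x - y) * v y\<bar> \<le> \<bar>w1 (x - y)\<bar> * D + C * \<bar>v y\<bar>" for y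
    proof -
      have "\<bar>w (x - y) * v y\<bar> \<le> \<bar>w1 (x - y)\<bar> * \<bar>v y\<bar> + \<bar>w2 (x - y)\<bar> * \<bar>v y\<bar>"
        unfolding w abs_mult by (simp add: distrib_right[symmetric] mult_right_mono abs_triangle_ineq)
      also have "\<dots> \<le> \<bar>w1 (x - y)\<bar> * D + C * \<bar>v y\<bar>"
        using C[of "x - y"] D[of y] by (intro add_mono mult_left_mono mult_right_mono) auto
      finally show ?thesis .
    qed
    show int: "integrable lborel (\<lambda>y. w (x - y) * v y)"
      by (rule Bochner_Integration.integrable_bound[OF i])
        (use bd in \<open>auto simp: w intro!: AE_I2 order_trans[OF bd[unfolded w]]\<close>)
    have "(\<integral>y. \<bar>w (x - y) * v y\<bar> \<partial>lborel) \<le> (\<integral>y. \<bar>w1 (x - y)\<bar> * D + C * \<bar>v y\<bar> \<partial>lborel)"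
      by (intro integral_mono Bochner_Integration.integrable_abs int i bd)
    also have "\<dots> = A * D + C * (\<integral>y. \<bar>v y\<bar> \<partial>lborel)"
      using integrable_reflect[OF w1, of x] v by (subst Bochner_Integration.integral_add) (auto simp: A)
    finally show "(\<integral>y. \<bar>w (x - y) * v y\<bar> \<partial>lborel) \<le> A * D + C * (\<integral>y. \<bar>v y\<bar> \<partial>lborel)" .
  qed
  show ?thesis using A0 C0 int le by blast
qed

lemma L1_plus_Linf_measurable: "L1_plus_Linf w \<Longrightarrow> w \<in> borel_measurable borel"
  by (simp add: L1_plus_Linf_def)

lemma convolve_measurable:
  assumes [measurable]: "w \<in> borel_measurable borel" "v \<in> borel_measurable borel"
  shows "convolve w v \<in> borel_measurable borel"
proof -
  have "(\<lambda>x. \<integral>y. w (x - y) * v y \<partial>lborel) \<in> borel_measurable lborel" by measurable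
  then show ?thesis by (simp add: convolve_def[abs_def])
qed

text \<open>Tonelli: the inner integral over y is bounded uniformly in x, which leaves a multiple of
  |u|.\<close>

lemma integrable_exchange:
  fixes w :: "real^'d \<Rightarrow> real"
  assumes w: "L1_plus_Linf w" and u: "integrable lborel u" and v: "integrable lborel v" "\<And>y. \<bar>v y\<bar> \<le> D"
  shows "integrable (lborel \<Otimes>\<^sub>M lborel) (\<lambda>(x, y). w (x - y) * u x * v y)"
proof -
  obtain A C where AC0: "0 \<le> A" "0 \<le> C"
    and "\<forall>v D x. integrable lborel v \<longrightarrow> (\<forall>y. \<bar>v y\<bar> \<le> D) \<longrightarrow> integrable lborel (\<lambda>y. w (x - y) * v y) \<and>
      (\<integral>y. \<bar>w (x - y) * v y\<bar> \<partial>lborel) \<le> A * D + C * (\<integral>y. \<bar>v y\<bar> \<partial>lborel)"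
    using convolve_bounds[OF w] by blast
  then have AC: "integrable lborel (\<lambda>y. w (x - y) * v y)"
      "(\<integral>y. \<bar>w (x - y) * v y\<bar> \<partial>lborel) \<le> A * D + C * (\<integral>y. \<bar>v y\<bar> \<partial>lborel)"
    if "integrable lborel v" "\<And>y. \<bar>v y\<bar> \<le> D" for v D x
    using that by auto
  note [measurable] = L1_plus_Linf_measurable[OF w]
  have [measurable]: "u \<in> borel_measurable borel" "v \<in> borel_measurable borel" using u v by auto
  define B where "B = A * D + C * (\<integral>y. \<bar>v y\<bar> \<partial>lborel)"
  have "0 \<le> D" using v(2)[of 0] by linarith
  then have B0: "0 \<le> B" unfolding B_def using AC0 by (intro add_nonneg_nonneg mult_nonneg_nonneg integral_nonneg_AE) auto
  have "(\<integral>\<^sup>+p. ennreal (norm (case p of (x, y) \<Rightarrow> w (x - y) * u x * v y)) \<partial>(lborel \<Otimes>\<^sub>M lborel))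
      = (\<integral>\<^sup>+x. \<integral>\<^sup>+y. ennreal (norm (w (x - y) * u x * v y)) \<partial>lborel \<partial>lborel)"
    by (subst lborel.nn_integral_fst[symmetric]) auto
  also have "\<dots> \<le> (\<integral>\<^sup>+x. ennreal (B * \<bar>u x\<bar>) \<partial>lborel)"
  proof (intro nn_integral_mono)
    fix x :: "real^'d"
    have "(\<integral>\<^sup>+y. ennreal (norm (w (x - y) * u x * v y)) \<partial>lborel)
        = (\<integral>\<^sup>+y. ennreal (\<bar>u x\<bar> * \<bar>w (x - y) * v y\<bar>) \<partial>lborel)"
      by (intro nn_integral_cong arg_cong[of _ _ ennreal]) (simp add: abs_mult)
    also have "\<dots> = ennreal (\<integral>y. \<bar>u x\<bar> * \<bar>w (x - y) * v y\<bar> \<partial>lborel)"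
      by (intro nn_integral_eq_integral integrable_mult_right Bochner_Integration.integrable_abs AC(1)[OF v]) auto
    also have "\<dots> \<le> ennreal (B * \<bar>u x\<bar>)"
      unfolding B_def using mult_right_mono[OF AC(2)[OF v, of x], of "\<bar>u x\<bar>"]
      by (intro ennreal_leI) (simp add: mult.commute)
    finally show "(\<integral>\<^sup>+y. ennreal (norm (w (x - y) * u x * v y)) \<partial>lborel) \<le> ennreal (B * \<bar>u x\<bar>)" .
  qed
  also have "\<dots> < \<infinity>"
    unfolding infinity_ennreal_def top.not_eq_extremum[symmetric]
    using integrableD(2)[OF integrable_mult_right[OF Bochner_Integration.integrable_abs[OF u], of B]] B0 by (simp add: abs_mult)
  finally show ?thesis by (intro integrableI_bounded) auto
qed

definition exchange :: "(real^'d \<Rightarrow> real) \<Rightarrow> (real^'d \<Rightarrow> real) \<Rightarrow> real"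
  where "exchange w g = (\<integral>(x, y). w (x - y) * g x * g y \<partial>(lborel \<Otimes>\<^sub>M lborel))"

lemma exchange_eq_convolve:
  fixes w :: "real^'d \<Rightarrow> real"
  assumes w: "L1_plus_Linf w" and g: "integrable lborel g" "\<And>x. \<bar>g x\<bar> \<le> D"
  shows "exchange w g = (\<integral>x. convolve w g x * g x \<partial>lborel)"
proof -
  have "exchange w g = (\<integral>x. \<integral>y. w (x - y) * g x * g y \<partial>lborel \<partial>lborel)"
    unfolding exchange_def using lborel_pair.integral_fst'[OF integrable_exchange[OF w g(1) g]] by simp
  also have "\<dots> = (\<integral>x. convolve w g x * g x \<partial>lborel)"
  proof (rule Bochner_Integration.integral_cong[OF refl])
    fix x
    have "(\<integral>y. w (x - y) * g x * g y \<partial>lborel) = (\<integral>y. (w (x - y) * g y) * g x \<partial>lborel)"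
      by (rule Bochner_Integration.integral_cong) auto
    then show "(\<integral>y. w (x - y) * g x * g y \<partial>lborel) = convolve w g x * g x"
      by (simp add: convolve_def)
  qed
  finally show ?thesis .
qed

lemma weakly_convergentD_bounded:
  assumes "weakly_convergent g h" "f \<in> borel_measurable borel" "\<And>x. \<bar>f x\<bar> \<le> B"
  shows "(\<lambda>n. \<integral>x. f x * g n x \<partial>lborel) \<longlonglongrightarrow> (\<integral>x. f x * h x \<partial>lborel)"
proof -
  have "bounded (range f)" using assms(3) by (auto simp: bounded_iff)
  then show ?thesis using assms(1,2) by (simp add: weakly_convergent_def)
qed

text \<open>For fixed x, w1(x - y) is an integrable and w2(x - y) a bounded test function of
  y.\<close>

lemma convolve_tendsto:
  fixes w :: "real^'d \<Rightarrow> real"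
  assumes w: "L1_plus_Linf w" and weak: "weakly_convergent g h"
    and g: "\<And>n. integrable lborel (g n)" "\<And>n x. 0 \<le> g n x \<and> g n x \<le> 1"
    and h: "integrable lborel h" "\<And>x. 0 \<le> h x \<and> h x \<le> 1"
  shows "(\<lambda>n. convolve w (g n) x) \<longlonglongrightarrow> convolve w h x"
proof -
  from L1_plus_Linf_decomposition[OF w] obtain w1 w2 C where w1: "integrable lborel w1"
    and w2[measurable]: "w2 \<in> borel_measurable borel" and C: "\<And>x. \<bar>w2 x\<bar> \<le> C" and w12: "\<And>x. w x = w1 x + w2 x"
    by blast
  have split: "convolve w u x = (\<integral>y. w1 (x - y) * u y \<partial>lborel) + (\<integral>y. w2 (x - y) * u y \<partial>lborel)"
    if u: "integrable lborel u" "\<And>x. 0 \<le> u x \<and> u x \<le> 1" for u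
  proof -
    have [measurable]: "u \<in> borel_measurable borel" using u by auto
    have "integrable lborel (\<lambda>y. w1 (x - y) * u y)"
      by (rule Bochner_Integration.integrable_bound[OF integrable_reflect[OF w1, of x]])
        (use u w1 in \<open>auto simp: abs_mult intro!: mult_left_le\<close>)
    moreover have "integrable lborel (\<lambda>y. w2 (x - y) * u y)"
      by (rule Bochner_Integration.integrable_bound[OF integrable_mult_right[OF u(1), of C]])
        (use u C in \<open>auto simp: abs_mult intro!: AE_I2 mult_right_mono intro: order_trans[OF C abs_ge_self]\<close>)
    ultimately show ?thesis by (simp add: convolve_def w12 distrib_right)
  qed
  have "bounded (range (\<lambda>y. w2 (x - y)))" using C by (auto simp: bounded_iff)
  then have "(\<lambda>n. (\<integral>y. w1 (x - y) * g n y \<partial>lborel) + (\<integral>y. w2 (x - y) * g n y \<partial>lborel))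
      \<longlonglongrightarrow> (\<integral>y. w1 (x - y) * h y \<partial>lborel) + (\<integral>y. w2 (x - y) * h y \<partial>lborel)"
    using weak integrable_reflect[OF w1, of x] unfolding weakly_convergent_def
    by (intro tendsto_add) auto
  then show ?thesis using split[OF g] split[OF h] by simp
qed

text \<open>Write w * g_n = (w * g_n - w * h) + w * h and integrate against g_n. The second summand
  is one fixed bounded test function. The first tends to 0 pointwise and boundedly, hence in L1 on
  balls, and the moment bound controls the complement.\<close>

lemma exchange_tendsto:
  fixes w :: "real^'d \<Rightarrow> real"
  assumes w: "L1_plus_Linf w" and weak: "weakly_convergent g h"
    and g: "\<And>n. integrable lborel (g n)" "\<And>n x. 0 \<le> g n x \<and> g n x \<le> 1"
    and h: "integrable lborel h" "\<And>x. 0 \<le> h x \<and> h x \<le> 1"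
    and mass: "\<And>n. (\<integral>x. g n x \<partial>lborel) \<le> M" 
    and moment: "\<And>n. (\<integral>\<^sup>+x. ennreal ((norm x)\<^sup>2 * g n x) \<partial>lborel) \<le> ennreal K" "0 \<le> K"
  shows "(\<lambda>n. exchange w (g n)) \<longlonglongrightarrow> exchange w h"
proof -
  obtain A C where AC0: "0 \<le> A" "0 \<le> C"
    and "\<forall>v D x. integrable lborel v \<longrightarrow> (\<forall>y. \<bar>v y\<bar> \<le> D) \<longrightarrow> integrable lborel (\<lambda>y. w (x - y) * v y) \<and>
      (\<integral>y. \<bar>w (x - y) * v y\<bar> \<partial>lborel) \<le> A * D + C * (\<integral>y. \<bar>v y\<bar> \<partial>lborel)"
    using convolve_bounds[OF w] by blast
  then have AC: "integrable lborel (\<lambda>y. w (x - y) * v y)"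
      "(\<integral>y. \<bar>w (x - y) * v y\<bar> \<partial>lborel) \<le> A * D + C * (\<integral>y. \<bar>v y\<bar> \<partial>lborel)"
    if "integrable lborel v" "\<And>y. \<bar>v y\<bar> \<le> D" for v D x
    using that by auto
  note wm[measurable] = L1_plus_Linf_measurable[OF w]
  have gm[measurable]: "g n \<in> borel_measurable borel" for n using g(1)[of n] by auto
  have hm[measurable]: "h \<in> borel_measurable borel" using h by auto
  have Wm[measurable]: "convolve w (g n) \<in> borel_measurable borel" "convolve w h \<in> borel_measurable borel" for n
    by (intro convolve_measurable; measurable)+
  \<comment> \<open>The maximum lets a single bound \<open>B\<close> cover the convolutions of all
    g_n and of the limit.\<close>
  define M' where "M' = max M (\<integral>x. h x \<partial>lborel)"
  define B where "B = A + C * M'"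
  have conv_bd: "\<bar>convolve w u x\<bar> \<le> B"
    if u: "integrable lborel u" "\<And>x. 0 \<le> u x \<and> u x \<le> 1" "(\<integral>x. u x \<partial>lborel) \<le> M'" for u x
  proof -
    have "\<bar>convolve w u x\<bar> \<le> (\<integral>y. \<bar>w (x - y) * u y\<bar> \<partial>lborel)"
      unfolding convolve_def by (rule integral_abs_bound)
    also have "\<dots> \<le> A * 1 + C * (\<integral>y. \<bar>u y\<bar> \<partial>lborel)"
      using u(2) by (intro AC(2) u(1)) auto
    also have "\<dots> \<le> B" using u(2,3) AC0(2) by (auto simp: B_def intro!: mult_left_mono)
    finally show ?thesis .
  qed
  have Wg: "\<bar>convolve w (g n) x\<bar> \<le> B" for n x
    by (rule conv_bd[OF g]) (use mass[of n] in \<open>simp add: M'_def\<close>)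
  have Wh: "\<bar>convolve w h x\<bar> \<le> B" for x
    by (rule conv_bd[OF h]) (simp add: M'_def)
  have B0: "0 \<le> B" using Wh[of 0] by linarith
  define f where "f n x = convolve w (g n) x - convolve w h x" for n x
  have fm[measurable]: "f n \<in> borel_measurable borel" for n unfolding f_def by measurable
  have f_bd: "\<bar>f n x\<bar> \<le> 2 * B" for n x using Wg[of n x] Wh[of x] by (simp add: f_def)
  have f_lim: "(\<lambda>n. f n x) \<longlonglongrightarrow> 0" for x
    unfolding f_def using LIM_zero[OF convolve_tendsto[OF w weak g h]] .
  have int_W: "integrable lborel (\<lambda>x. v x * u x)"
    if [measurable]: "v \<in> borel_measurable borel" and "\<And>x. \<bar>v x\<bar> \<le> c" "integrable lborel u" "\<And>x. 0 \<le> u x \<and> u x \<le> 1"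
    for v u :: "real^'d \<Rightarrow> real" and c
  proof (rule Bochner_Integration.integrable_bound[OF integrable_mult_right[OF that(3), of c]])
    show "AE x in lborel. norm (v x * u x) \<le> norm (c * u x)"
    proof (intro AE_I2)
      fix x
      have "\<bar>v x\<bar> \<le> \<bar>c\<bar>" using that(2)[of x] by linarith
      then show "norm (v x * u x) \<le> norm (c * u x)" by (simp add: abs_mult mult_right_mono)
    qed
  qed (use that(3) in auto)
  have "(\<lambda>n. \<integral>x. f n x * g n x \<partial>lborel) \<longlonglongrightarrow> 0"
  proof (rule metric_LIMSEQ_I)
    fix e :: real assume e: "e > 0"
    \<comment> \<open>The difference of the convolutions is at most 2 B, and this radius makes the
      tail 2 B K / R^2 smaller than e/2.\<close>
    define R where "R = sqrt (2 * (2 * B * K + 1) / e)"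
    have BK: "0 \<le> 2 * B * K" using B0 moment(2) by simp
    have R: "R > 0" "R\<^sup>2 = 2 * (2 * B * K + 1) / e" unfolding R_def using e BK by auto
    have small: "2 * B * K / R\<^sup>2 < e / 2" unfolding R(2) using e BK by (simp add: field_simps)
    let ?J = "indicator (ball (0::real^'d) R) :: real^'d \<Rightarrow> real"
    have "(\<lambda>n. \<integral>x. \<bar>?J x * f n x\<bar> \<partial>lborel) \<longlonglongrightarrow> (\<integral>x. 0 \<partial>(lborel::(real^'d) measure))"
    proof (rule integral_dominated_convergence)
      show "integrable lborel (\<lambda>x. ?J x * (2 * B))"
        by (rule integrable_indicator_ball_bounded[of _ _ "2 * B"]) (use B0 in auto)
      show "AE x in lborel. (\<lambda>n. \<bar>?J x * f n x\<bar>) \<longlonglongrightarrow> 0"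
        using f_lim by (intro AE_I2 tendsto_rabs_zero tendsto_mult_right_zero)
      show "AE x in lborel. norm \<bar>?J x * f n x\<bar> \<le> ?J x * (2 * B)" for n
        using f_bd by (intro AE_I2) (auto split: split_indicator)
    qed measurable
    then have "(\<lambda>n. \<integral>x. \<bar>?J x * f n x\<bar> \<partial>lborel) \<longlonglongrightarrow> 0" by simp
    from order_tendstoD(2)[OF this, of "e/2"] e obtain N where
      N: "\<And>n. n \<ge> N \<Longrightarrow> (\<integral>x. \<bar>?J x * f n x\<bar> \<partial>lborel) < e/2" by (auto simp: eventually_sequentially)
    have "dist (\<integral>x. f n x * g n x \<partial>lborel) 0 < e" if "n \<ge> N" for n
    proof -
      have iJ: "integrable lborel (\<lambda>x. ?J x * f n x)"
        by (rule integrable_indicator_ball_bounded[OF fm f_bd])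
      have "integrable lborel (\<lambda>x. (?J x * f n x) * g n x)"
        by (rule int_W[of _ "2 * B"]) (use f_bd B0 g in \<open>auto split: split_indicator\<close>)
      then have "\<bar>\<integral>x. (?J x * f n x) * g n x \<partial>lborel\<bar> \<le> (\<integral>x. \<bar>?J x * f n x\<bar> \<partial>lborel)"
        using g(2) by (intro order_trans[OF integral_abs_bound] integral_mono Bochner_Integration.integrable_abs iJ)
          (auto simp: abs_mult intro!: mult_left_le)
      then show ?thesis
        using N[OF that] small second_moment_tail_bound[OF g(1) conjunct1[OF g(2)] moment fm f_bd R(1), of n n]
        unfolding dist_real_def by linarith
    qed
    then show "\<exists>N. \<forall>n\<ge>N. dist (\<integral>x. f n x * g n x \<partial>lborel) 0 < e" by blast
  qed
  moreover have "(\<lambda>n. \<integral>x. convolve w h x * g n x \<partial>lborel) \<longlonglongrightarrow> (\<integral>x. convolve w h x * h x \<partial>lborel)"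
    by (rule weakly_convergentD_bounded[OF weak Wm(2) Wh])
  ultimately have "(\<lambda>n. (\<integral>x. f n x * g n x \<partial>lborel) + (\<integral>x. convolve w h x * g n x \<partial>lborel))
      \<longlonglongrightarrow> 0 + (\<integral>x. convolve w h x * h x \<partial>lborel)" by (rule tendsto_add)
  moreover have "(\<integral>x. f n x * g n x \<partial>lborel) + (\<integral>x. convolve w h x * g n x \<partial>lborel) = exchange w (g n)" for n
  proof -
    have "(\<integral>x. f n x * g n x \<partial>lborel) + (\<integral>x. convolve w h x * g n x \<partial>lborel)
        = (\<integral>x. f n x * g n x + convolve w h x * g n x \<partial>lborel)"
      by (intro Bochner_Integration.integral_add[symmetric] int_W[OF fm f_bd g] int_W[OF Wm(2) Wh g])
    also have "\<dots> = (\<integral>x. convolve w (g n) x * g n x \<partial>lborel)"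
      by (rule Bochner_Integration.integral_cong) (auto simp: f_def algebra_simps)
    also have "\<dots> = exchange w (g n)"
      using g(2)[of n] by (intro exchange_eq_convolve[OF w g(1), symmetric, of _ 1]) auto
    finally show ?thesis .
  qed
  moreover have "exchange w h = (\<integral>x. convolve w h x * h x \<partial>lborel)"
    using h(2) by (intro exchange_eq_convolve[OF w h(1), of 1]) auto
  ultimately show ?thesis by simp
qed

text \<open>Since the exchange term enters the energy with a minus sign, its upper bound at bounded
  mass is what keeps energies bounded below and moments bounded along sequences of bounded
  energy.\<close>

lemma exchange_bounded:
  fixes w :: "real^'d \<Rightarrow> real"
  assumes w: "L1_plus_Linf w"
  obtains B where "\<And>g. integrable lborel g \<Longrightarrow> (\<And>x. 0 \<le> g x \<and> g x \<le> 1) \<Longrightarrow> (\<integral>x. g x \<partial>lborel) \<le> M \<Longrightarrow> exchange w g \<le> B"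
proof -
  obtain A C where AC0: "0 \<le> A" "0 \<le> C"
    and "\<forall>v D x. integrable lborel v \<longrightarrow> (\<forall>y. \<bar>v y\<bar> \<le> D) \<longrightarrow> integrable lborel (\<lambda>y. w (x - y) * v y) \<and>
      (\<integral>y. \<bar>w (x - y) * v y\<bar> \<partial>lborel) \<le> A * D + C * (\<integral>y. \<bar>v y\<bar> \<partial>lborel)"
    using convolve_bounds[OF w] by blast
  then have AC: "integrable lborel (\<lambda>y. w (x - y) * v y)"
      "(\<integral>y. \<bar>w (x - y) * v y\<bar> \<partial>lborel) \<le> A * D + C * (\<integral>y. \<bar>v y\<bar> \<partial>lborel)"
    if "integrable lborel v" "\<And>y. \<bar>v y\<bar> \<le> D" for v D x
    using that by auto
  note wm[measurable] = L1_plus_Linf_measurable[OF w]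
  define B where "B = A + C * \<bar>M\<bar>"
  have B0: "0 \<le> B" using AC0 by (simp add: B_def)
  have "exchange w g \<le> B * \<bar>M\<bar>"
    if g: "integrable lborel g" "\<And>x. 0 \<le> g x \<and> g x \<le> 1" "(\<integral>x. g x \<partial>lborel) \<le> M" for g
  proof -
    have [measurable]: "g \<in> borel_measurable borel" using g by auto
    have [measurable]: "convolve w g \<in> borel_measurable borel" by (rule convolve_measurable; measurable)
    have bd: "\<bar>convolve w g x\<bar> \<le> B" for x
    proof -
      have "\<bar>convolve w g x\<bar> \<le> (\<integral>y. \<bar>w (x - y) * g y\<bar> \<partial>lborel)"
        unfolding convolve_def by (rule integral_abs_bound)
      also have "\<dots> \<le> A * 1 + C * (\<integral>y. \<bar>g y\<bar> \<partial>lborel)"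
        using g(2) by (intro AC(2) g(1)) auto
      also have "\<dots> \<le> B" using g(2,3) AC0(2) by (auto simp: B_def intro!: mult_left_mono)
      finally show ?thesis .
    qed
    have le: "convolve w g x * g x \<le> B * g x" for x
      using bd[of x] g(2)[of x] by (intro mult_right_mono) auto
    have abs: "\<bar>convolve w g x * g x\<bar> \<le> \<bar>B * g x\<bar>" for x
      using bd[of x] g(2)[of x] B0 by (auto simp: abs_mult intro!: mult_right_mono)
    have "exchange w g = (\<integral>x. convolve w g x * g x \<partial>lborel)"
      using g(2) by (intro exchange_eq_convolve[OF w g(1), of 1]) auto
    also have "\<dots> \<le> (\<integral>x. B * g x \<partial>lborel)"
      using abs g(1) by (intro integral_mono le Bochner_Integration.integrable_bound[OF integrable_mult_right[OF g(1), of B]]) auto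
    also have "\<dots> \<le> B * \<bar>M\<bar>" using g(3) B0 by (auto intro!: mult_left_mono)
    finally show ?thesis .
  qed
  then show ?thesis using that by blast
qed

section \<open>The no-spin problem\<close>

definition exp_mass :: "'d::finite itself \<Rightarrow> real"
  where "exp_mass _ = (\<integral>(x::real^'d). exp (- norm x) \<partial>lborel)"

lemma shifted_energy_top_or_real:
  obtains "shifted_energy T g = top" | e where "0 \<le> e" "shifted_energy T g = ennreal e"
  by (cases "shifted_energy T g") auto

lemma ext_integral_eq_shifted_energy:
  fixes g :: "real^'d \<Rightarrow> real"
  assumes g: "integrable lborel g" "\<And>x. 0 \<le> g x \<and> g x \<le> 1" and T: "0 \<le> T"
  shows "ext_integral lborel (\<lambda>k. (norm k)\<^sup>2 / 2 * g k - T * entropy_fun (g k))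
    = enn2ereal (shifted_energy T g) - ereal (T\<^sup>2 * (\<integral>x. g x \<partial>lborel) + T * exp_mass TYPE('d))"
proof -
  have [measurable]: "g \<in> borel_measurable borel" using g by auto
  let ?h = "\<lambda>x. T\<^sup>2 * g x + T * exp (- norm x)"
  have i: "integrable lborel (\<lambda>x. T\<^sup>2 * g x)" "integrable lborel (\<lambda>x::real^'d. T * exp (- norm x))"
    using g(1) integrable_exp_minus_norm by auto
  have "(\<integral>x. ?h x \<partial>lborel) = T\<^sup>2 * (\<integral>x. g x \<partial>lborel) + T * exp_mass TYPE('d)"
    using i by (simp add: exp_mass_def)
  moreover have "ext_integral lborel (\<lambda>k. (norm k)\<^sup>2 / 2 * g k - T * entropy_fun (g k))
    = enn2ereal (\<integral>\<^sup>+x. ennreal ((norm x)\<^sup>2 / 2 * g x - T * entropy_fun (g x) + ?h x) \<partial>lborel) - ereal (\<integral>x. ?h x \<partial>lborel)"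
  proof (rule ext_integral_eq_shift)
    show "integrable lborel ?h" using i by (rule Bochner_Integration.integrable_add)
    show "0 \<le> ?h x" for x using g(2)[of x] T by simp
    show "0 \<le> (norm x)\<^sup>2 / 2 * g x - T * entropy_fun (g x) + ?h x" for x
      using shifted_density_nonneg[of "g x" T x] g(2)[of x] T by (simp add: shifted_density_def)
  qed measurable
  ultimately show ?thesis by (simp add: shifted_energy_def shifted_density_def)
qed

lemma nospin_energy_eq:
  fixes g :: "real^'d \<Rightarrow> real"
  assumes g: "integrable lborel g" "\<And>x. 0 \<le> g x \<and> g x \<le> 1" and T: "0 \<le> T"
  shows "nospin_energy w T g = ereal (1 / (2 * pi) ^ CARD('d)) *
      (enn2ereal (shifted_energy T g) - ereal (T\<^sup>2 * (\<integral>x. g x \<partial>lborel) + T * exp_mass TYPE('d)))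
    - ereal (1 / (2 * (2 * pi) ^ CARD('d)) * exchange w g)"
  unfolding nospin_energy_def ext_integral_eq_shifted_energy[OF assms] exchange_def ..

lemma nospin_energy_real:
  fixes g :: "real^'d \<Rightarrow> real"
  assumes g: "integrable lborel g" "\<And>x. 0 \<le> g x \<and> g x \<le> 1" and T: "0 \<le> T"
    and e: "0 \<le> e" "shifted_energy T g = ennreal e"
  shows "nospin_energy w T g = ereal (1 / (2 * pi) ^ CARD('d) *
      (e - (T\<^sup>2 * (\<integral>x. g x \<partial>lborel) + T * exp_mass TYPE('d)) - exchange w g / 2))"
  unfolding nospin_energy_eq[OF g T] e(2) using e(1) by (simp add: enn2ereal_ennreal field_simps)

lemma nospin_energy_infinite:
  fixes g :: "real^'d \<Rightarrow> real"
  assumes g: "integrable lborel g" "\<And>x. 0 \<le> g x \<and> g x \<le> 1" and T: "0 \<le> T"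
    and e: "shifted_energy T g = top"
  shows "nospin_energy w T g = \<infinity>"
  unfolding nospin_energy_eq[OF g T] e by simp

lemma nospin_admissibleD:
  fixes g :: "real^'d \<Rightarrow> real"
  assumes "nospin_admissible \<rho> g"
  shows "integrable lborel g" "\<And>x. 0 \<le> g x \<and> g x \<le> 1" "(\<integral>x. g x \<partial>lborel) = (2 * pi) ^ CARD('d) * \<rho>"
  using assms by (auto simp: nospin_admissible_def)

lemma nospin_admissibleI:
  fixes g :: "real^'d \<Rightarrow> real"
  assumes "integrable lborel g" "\<And>x. 0 \<le> g x \<and> g x \<le> 1" "(\<integral>x. g x \<partial>lborel) = (2 * pi) ^ CARD('d) * \<rho>"
  shows "nospin_admissible \<rho> g"
  using assms by (auto simp: nospin_admissible_def)

text \<open>The factor 4 inverts the 1/4 in \<open>shifted_density_ge\<close>.\<close>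

lemma second_moment_le_shifted_energy:
  fixes g :: "'a::euclidean_space \<Rightarrow> real"
  assumes [measurable]: "g \<in> borel_measurable borel" and g: "\<And>x. 0 \<le> g x \<and> g x \<le> 1" and T: "0 \<le> T"
    and e: "0 \<le> e" "shifted_energy T g \<le> ennreal e"
  shows "(\<integral>\<^sup>+x. ennreal ((norm x)\<^sup>2 * g x) \<partial>lborel) \<le> ennreal (4 * e)"
proof -
  have "(\<integral>\<^sup>+x. ennreal ((norm x)\<^sup>2 * g x) \<partial>lborel) \<le> (\<integral>\<^sup>+x. ennreal 4 * ennreal (shifted_density T x (g x)) \<partial>lborel)"
  proof (intro nn_integral_mono)
    fix x :: 'a
    have "(norm x)\<^sup>2 * g x \<le> 4 * shifted_density T x (g x)"
      using shifted_density_ge[of "g x" T x] g[of x] T by simp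
    then have "ennreal ((norm x)\<^sup>2 * g x) \<le> ennreal (4 * shifted_density T x (g x))" by (rule ennreal_leI)
    then show "ennreal ((norm x)\<^sup>2 * g x) \<le> ennreal 4 * ennreal (shifted_density T x (g x))"
      by (simp add: ennreal_mult')
  qed
  also have "\<dots> = ennreal 4 * shifted_energy T g"
    unfolding shifted_energy_def by (rule nn_integral_cmult) measurable
  also have "\<dots> \<le> ennreal 4 * ennreal e" using e(2) by (rule mult_left_mono) simp
  also have "\<dots> = ennreal (4 * e)" using e(1) by (intro ennreal_mult'[symmetric]) simp
  finally show ?thesis .
qed

text \<open>Letting the density vary makes one lemma serve two purposes: with constant density it
  gives minimisers, with converging densities the lower semicontinuity of the minimum.\<close>

lemma nospin_energy_compactness:
  fixes w :: "real^'d \<Rightarrow> real"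
  assumes w: "L1_plus_Linf w" and T: "0 \<le> T"
    and adm: "\<And>n. nospin_admissible (\<rho> n) (g n)" and \<rho>: "\<rho> \<longlonglongrightarrow> \<rho>'"
    and le: "\<And>n. nospin_energy w T (g n) \<le> ereal (c n)" and c: "c \<longlonglongrightarrow> c'"
  obtains h where "nospin_admissible \<rho>' h" "nospin_energy w T h \<le> ereal c'"
proof -
  define P where "P = (2 * pi) ^ CARD('d)"
  have P: "P > 0" by (simp add: P_def)
  define E where "E = T * exp_mass TYPE('d)"
  define m where "m n = P * \<rho> n" for n
  define X where "X n = exchange w (g n)" for n
  \<comment> \<open>The energy bound \<open>c n\<close> solved for the shifted energy: multiply by
    P, add the integral of the shift, add half of the exchange term.\<close>
  define b where "b n = P * c n + (T\<^sup>2 * m n + E) + X n / 2" for n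
  have gi: "integrable lborel (g n)" for n by (rule nospin_admissibleD(1)[OF adm])
  have g01: "0 \<le> g n x \<and> g n x \<le> 1" for n x by (rule nospin_admissibleD(2)[OF adm])
  have gm: "(\<integral>x. g n x \<partial>lborel) = m n" for n
    unfolding m_def P_def by (rule nospin_admissibleD(3)[OF adm])
  have gb[measurable]: "g n \<in> borel_measurable borel" for n
    using borel_measurable_integrable[OF gi[of n]] by simp
  have m: "m \<longlonglongrightarrow> P * \<rho>'" unfolding m_def by (intro tendsto_mult_left \<rho>)
  have se: "shifted_energy T (g n) \<le> ennreal (b n)" "0 \<le> b n" for n
  proof -
    have "shifted_energy T (g n) \<le> ennreal (b n) \<and> 0 \<le> b n"
    proof (rule shifted_energy_top_or_real[of T "g n"])
      assume "shifted_energy T (g n) = top"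
      from nospin_energy_infinite[OF gi g01 T this, of w] le[of n] show ?thesis by simp
    next
      fix e assume e: "0 \<le> e" "shifted_energy T (g n) = ennreal e"
      from nospin_energy_real[OF gi g01 T e, of w] le[of n]
      have "1 / P * (e - (T\<^sup>2 * m n + E) - X n / 2) \<le> c n"
        by (simp add: gm P_def E_def X_def)
      then have "e \<le> b n" using P by (simp add: b_def field_simps)
      then show ?thesis using e by (simp add: ennreal_leI)
    qed
    then show "shifted_energy T (g n) \<le> ennreal (b n)" "0 \<le> b n" by auto
  qed
  from m have "Bseq m" by (intro convergent_imp_Bseq) (auto simp: convergent_def)
  then obtain M where M: "\<And>n. \<bar>m n\<bar> \<le> M" by (auto simp: Bseq_def)
  from c have "Bseq c" by (intro convergent_imp_Bseq) (auto simp: convergent_def)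
  then obtain C where C: "\<And>n. \<bar>c n\<bar> \<le> C" by (auto simp: Bseq_def)
  obtain B where B: "\<And>g. integrable lborel g \<Longrightarrow> (\<And>x. 0 \<le> g x \<and> g x \<le> 1) \<Longrightarrow> (\<integral>x. g x \<partial>lborel) \<le> M \<Longrightarrow> exchange w g \<le> B"
    using exchange_bounded[OF w, of M] by blast
  have mM: "m n \<le> M" for n using M[of n] by linarith
  have XB: "X n \<le> B" for n unfolding X_def by (rule B[OF gi g01]) (use mM gm in auto)
  define K where "K = 4 * (P * C + (T\<^sup>2 * M + E) + B / 2)"
  have bK: "4 * b n \<le> K" for n
  proof -
    have "P * c n \<le> P * C" using C[of n] P by (intro mult_left_mono) auto
    moreover have "T\<^sup>2 * m n \<le> T\<^sup>2 * M" using mM by (intro mult_left_mono) auto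
    ultimately show ?thesis using XB[of n] by (simp add: b_def K_def)
  qed
  have K0: "0 \<le> K" using bK[of 0] se(2)[of 0] by linarith
  have moment: "(\<integral>\<^sup>+x. ennreal ((norm x)\<^sup>2 * g n x) \<partial>lborel) \<le> ennreal K" for n
    by (rule order_trans[OF second_moment_le_shifted_energy[OF gb[of n] g01 T se(2)[of n] se(1)[of n]] ennreal_leI[OF bK]])
  obtain r h where r: "strict_mono r" and hi: "integrable lborel h" and h01: "\<And>x. 0 \<le> h x \<and> h x \<le> 1"
    and weak: "weakly_convergent (\<lambda>n. g (r n)) h"
    by (rule weakly_convergent_subsequence[of g K, OF gi g01 moment K0]) blast
  have hb[measurable]: "h \<in> borel_measurable borel" using hi by auto
  have sub: "(\<lambda>n. s (r n)) \<longlonglongrightarrow> l" if "s \<longlonglongrightarrow> l" for s :: "nat \<Rightarrow> real" and l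
    using LIMSEQ_subseq_LIMSEQ[OF that r] by (simp add: o_def)
  \<comment> \<open>The constant test function 1 shows that no mass is lost, so the limit has
    density \<open>\<rho>'\<close>.\<close>
  have "(\<lambda>n. m (r n)) \<longlonglongrightarrow> (\<integral>x. h x \<partial>lborel)"
    using weakly_convergentD_bounded[OF weak, of "\<lambda>_. 1" 1] by (simp add: gm)
  then have hm: "(\<integral>x. h x \<partial>lborel) = P * \<rho>'" using sub[OF m] LIMSEQ_unique by blast
  have X: "(\<lambda>n. X (r n)) \<longlonglongrightarrow> exchange w h"
    unfolding X_def
    by (rule exchange_tendsto[OF w weak gi g01 hi h01 _ moment K0, of M]) (simp add: gm mM)
  have lim: "(\<lambda>n. b (r n)) \<longlonglongrightarrow> P * c' + (T\<^sup>2 * (P * \<rho>') + E) + exchange w h / 2"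
    unfolding b_def using sub[OF c] sub[OF m] X
    by (intro tendsto_add tendsto_divide tendsto_mult_left tendsto_const; simp)
  have le_h: "shifted_energy T h \<le> ennreal (P * c' + (T\<^sup>2 * (P * \<rho>') + E) + exchange w h / 2)"
    by (rule shifted_energy_lower_semicontinuous[OF gb g01 hb h01 T weak se(1) se(2) lim])
  have lim0: "0 \<le> P * c' + (T\<^sup>2 * (P * \<rho>') + E) + exchange w h / 2"
    by (rule LIMSEQ_le_const[OF lim]) (use se(2) in auto)
  have "nospin_energy w T h \<le> ereal c'"
  proof (rule shifted_energy_top_or_real[of T h])
    assume "shifted_energy T h = top"
    with le_h show ?thesis by (simp add: top_unique)
  next
    fix e assume e: "0 \<le> e" "shifted_energy T h = ennreal e"
    with le_h lim0 have "e \<le> P * c' + (T\<^sup>2 * (P * \<rho>') + E) + exchange w h / 2" by simp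
    then have "1 / P * (e - (T\<^sup>2 * (P * \<rho>') + E) - exchange w h / 2) \<le> c'"
      using P by (simp add: field_simps)
    then show ?thesis using nospin_energy_real[OF hi h01 T e, of w] by (simp add: hm P_def E_def)
  qed
  moreover have "nospin_admissible \<rho>' h" by (rule nospin_admissibleI[OF hi h01]) (simp add: hm P_def)
  ultimately show ?thesis using that by blast
qed

section \<open>Existence of no-spin minimisers and of an optimal splitting\<close>

lemma nospin_finite_energy_exists:
  fixes w :: "real^'d \<Rightarrow> real"
  assumes \<rho>: "0 \<le> \<rho>" and T: "0 \<le> T"
  obtains g where "nospin_admissible \<rho> g" "nospin_energy w T g < \<infinity>"
proof -
  define V where "V = unit_ball_vol (real CARD('d))"
  have V: "V > 0" by (simp add: V_def)
  \<comment> \<open>The radius of the ball with volume (2 pi)^d rho. Its indicator takes only the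
    values 0 and 1, so it has no entropy, and bounded support keeps the kinetic energy
    finite.\<close>
  define R where "R = root CARD('d) ((2 * pi) ^ CARD('d) * \<rho> / V)"
  have R: "0 \<le> R" "V * R ^ CARD('d) = (2 * pi) ^ CARD('d) * \<rho>" using \<rho> V by (auto simp: R_def)
  define g :: "real^'d \<Rightarrow> real" where "g = indicator (cball 0 R)"
  have em: "emeasure lborel (cball (0::real^'d) R) = ennreal ((2 * pi) ^ CARD('d) * \<rho>)"
    using emeasure_cball[of R "0::real^'d"] R by (simp add: V_def)
  have gi: "integrable lborel g" unfolding g_def by (simp add: integrable_indicator_iff em)
  have g01: "0 \<le> g x \<and> g x \<le> 1" for x by (simp add: g_def)
  have gm: "(\<integral>x. g x \<partial>lborel) = (2 * pi) ^ CARD('d) * \<rho>"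
    unfolding g_def using em \<rho> by (simp add: measure_def)
  have "shifted_energy T g < top"
  proof -
    have sd: "shifted_density T x (g x) \<le> (R\<^sup>2 / 2 + T\<^sup>2) * g x + T * exp (- norm x)" for x
    proof (cases "x \<in> cball 0 R")
      case True
      then have "(norm x)\<^sup>2 \<le> R\<^sup>2" by (intro power_mono) auto
      then show ?thesis using True by (simp add: shifted_density_def g_def)
    qed (simp add: shifted_density_def g_def)
    have i: "integrable lborel (\<lambda>x. (R\<^sup>2 / 2 + T\<^sup>2) * g x + T * exp (- norm x))"
      using gi integrable_exp_minus_norm by (intro Bochner_Integration.integrable_add integrable_mult_right)
    have "shifted_energy T g \<le> (\<integral>\<^sup>+x. ennreal ((R\<^sup>2 / 2 + T\<^sup>2) * g x + T * exp (- norm x)) \<partial>lborel)"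
      unfolding shifted_energy_def by (intro nn_integral_mono ennreal_leI sd)
    also have "\<dots> < top"
      unfolding top.not_eq_extremum[symmetric] using integrableD(2)[OF i] by simp
    finally show ?thesis .
  qed
  then obtain e where e: "0 \<le> e" "shifted_energy T g = ennreal e"
    by (cases "shifted_energy T g") auto
  show ?thesis
    by (rule that[OF nospin_admissibleI[OF gi g01 gm]]) (simp add: nospin_energy_real[OF gi g01 T e])
qed

text \<open>The shifted energy is nonnegative, and both the shift and the exchange term are
  controlled by the mass. A bound uniform in r up to \<open>\<rho>\<close> is needed when the
  splitting varies.\<close>

lemma nospin_energy_lower_bound:
  fixes w :: "real^'d \<Rightarrow> real"
  assumes w: "L1_plus_Linf w" and T: "0 \<le> T"
  obtains L where "\<And>r g. 0 \<le> r \<Longrightarrow> r \<le> \<rho> \<Longrightarrow> nospin_admissible r g \<Longrightarrow> ereal L \<le> nospin_energy w T g"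
proof -
  define P where "P = (2 * pi) ^ CARD('d)"
  have P: "P > 0" by (simp add: P_def)
  obtain B where B: "\<And>g. integrable lborel g \<Longrightarrow> (\<And>x. 0 \<le> g x \<and> g x \<le> 1) \<Longrightarrow> (\<integral>x. g x \<partial>lborel) \<le> P * \<rho> \<Longrightarrow> exchange w g \<le> B"
    using exchange_bounded[OF w, of "P * \<rho>"] by blast
  have "ereal (1 / P * (0 - (T\<^sup>2 * (P * \<rho>) + T * exp_mass TYPE('d)) - B / 2)) \<le> nospin_energy w T g"
    if r: "0 \<le> r" "r \<le> \<rho>" and adm: "nospin_admissible r g" for r g
  proof -
    note g = nospin_admissibleD[OF adm]
    have m: "(\<integral>x. g x \<partial>lborel) \<le> P * \<rho>"
      unfolding g(3) P_def[symmetric] using r P by (simp add: mult_left_mono)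
    have X: "exchange w g \<le> B" by (rule B[OF g(1,2) m])
    show ?thesis
    proof (rule shifted_energy_top_or_real[of T g])
      assume "shifted_energy T g = top"
      from nospin_energy_infinite[OF g(1,2) T this] show ?thesis by simp
    next
      fix e assume e: "0 \<le> e" "shifted_energy T g = ennreal e"
      have "T\<^sup>2 * (\<integral>x. g x \<partial>lborel) \<le> T\<^sup>2 * (P * \<rho>)" using m by (intro mult_left_mono) auto
      then have "1 / P * (0 - (T\<^sup>2 * (P * \<rho>) + T * exp_mass TYPE('d)) - B / 2)
          \<le> 1 / P * (e - (T\<^sup>2 * (\<integral>x. g x \<partial>lborel) + T * exp_mass TYPE('d)) - exchange w g / 2)"
        using X e(1) P by (intro mult_left_mono) auto
      then show ?thesis unfolding nospin_energy_real[OF g(1,2) T e] P_def by simp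
    qed
  qed
  then show ?thesis using that by blast
qed

lemma E_nospin_le: "nospin_admissible r g \<Longrightarrow> E_nospin w r T \<le> nospin_energy w T g"
  unfolding E_nospin_def by (rule Inf_lower) simp

lemma nospin_minimiser_iff:
  "nospin_minimiser w r T g \<longleftrightarrow> nospin_admissible r g \<and> nospin_energy w T g = E_nospin w r T"
proof
  assume "nospin_minimiser w r T g"
  then have adm: "nospin_admissible r g"
    and min: "\<And>h. nospin_admissible r h \<Longrightarrow> nospin_energy w T g \<le> nospin_energy w T h"
    by (auto simp: nospin_minimiser_def is_arg_min_def not_less)
  have "nospin_energy w T g \<le> E_nospin w r T"
    unfolding E_nospin_def by (rule Inf_greatest) (use min in auto)
  then show "nospin_admissible r g \<and> nospin_energy w T g = E_nospin w r T"
    using adm E_nospin_le[OF adm] by (metis antisym)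
next
  assume "nospin_admissible r g \<and> nospin_energy w T g = E_nospin w r T"
  then show "nospin_minimiser w r T g"
    using E_nospin_le by (auto simp: nospin_minimiser_def is_arg_min_def not_less[symmetric])
qed

text \<open>The real value \<open>e\<close> is returned along with the minimiser because later
  cancellations in \<open>ereal\<close> depend on finiteness.\<close>

lemma nospin_minimiser_exists:
  fixes w :: "real^'d \<Rightarrow> real"
  assumes w: "L1_plus_Linf w" and T: "0 \<le> T" and r: "0 \<le> r"
  obtains g e where "nospin_minimiser w r T g" "E_nospin w r T = ereal e"
proof -
  obtain L where L: "\<And>g. nospin_admissible r g \<Longrightarrow> ereal L \<le> nospin_energy w T g"
    using nospin_energy_lower_bound[OF w T, of r] r by (metis order_refl)
  have ge: "ereal L \<le> E_nospin w r T" unfolding E_nospin_def by (rule Inf_greatest) (use L in auto)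
  obtain g0 where "nospin_admissible r g0" "nospin_energy w T g0 < \<infinity>"
    using nospin_finite_energy_exists[OF r T] by blast
  then have "E_nospin w r T < \<infinity>" using E_nospin_le le_less_trans by blast
  then obtain e where e: "E_nospin w r T = ereal e" using ge by (cases "E_nospin w r T") auto
  have "\<exists>g. nospin_admissible r g \<and> nospin_energy w T g \<le> ereal (e + 1 / (real n + 1))" for n
  proof -
    have "E_nospin w r T < ereal (e + 1 / (real n + 1))" by (simp add: e)
    then show ?thesis unfolding E_nospin_def Inf_less_iff by (auto intro: less_imp_le)
  qed
  then obtain g where g: "\<And>n. nospin_admissible r (g n)" "\<And>n. nospin_energy w T (g n) \<le> ereal (e + 1 / (real n + 1))"
    by metis
  have lim: "(\<lambda>n. e + 1 / (real n + 1)) \<longlonglongrightarrow> e"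
    using tendsto_add[OF tendsto_const LIMSEQ_Suc[OF lim_1_over_n], of e] by (simp add: add.commute)
  obtain h where h: "nospin_admissible r h" "nospin_energy w T h \<le> ereal e"
    using nospin_energy_compactness[OF w T g(1) tendsto_const g(2) lim] by blast
  then have "nospin_minimiser w r T h"
    unfolding nospin_minimiser_iff e using E_nospin_le[OF h(1), of w T] by (auto simp: e)
  then show ?thesis using that e by blast
qed

lemma E_nospin_lower_semicontinuous:
  fixes w :: "real^'d \<Rightarrow> real"
  assumes w: "L1_plus_Linf w" and T: "0 \<le> T" and r: "\<And>n. 0 \<le> r n" "r \<longlonglongrightarrow> r'"
    and le: "\<And>n. E_nospin w (r n) T \<le> ereal (c n)" and c: "c \<longlonglongrightarrow> c'"
  shows "E_nospin w r' T \<le> ereal c'"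
proof -
  have "\<exists>g. nospin_minimiser w (r n) T g" for n using nospin_minimiser_exists[OF w T r(1)] by metis
  then obtain g where g: "\<And>n. nospin_minimiser w (r n) T (g n)" by metis
  then have adm: "nospin_admissible (r n) (g n)" and en: "nospin_energy w T (g n) \<le> ereal (c n)" for n
    using le[of n] by (auto simp: nospin_minimiser_iff)
  obtain h where "nospin_admissible r' h" "nospin_energy w T h \<le> ereal c'"
    using nospin_energy_compactness[OF w T adm r(2) en c] by blast
  then show ?thesis using E_nospin_le order_trans by blast
qed

text \<open>Each summand is only lower semicontinuous in its density. Along a subsequence on which
  the value of the first summand also converges, say to c, the limits of the two summands are
  bounded by c and m - c, with sum the infimum m.\<close>

lemma optimal_split_exists:
  fixes w :: "real^'d \<Rightarrow> real"
  assumes w: "L1_plus_Linf w" and T: "0 \<le> T" and \<rho>: "0 \<le> \<rho>"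
  obtains r where "0 \<le> r" "r \<le> \<rho>"
    "\<And>s. 0 \<le> s \<Longrightarrow> s \<le> \<rho> \<Longrightarrow> E_nospin w r T + E_nospin w (\<rho> - r) T \<le> E_nospin w s T + E_nospin w (\<rho> - s) T"
proof -
  obtain L where L: "\<And>r g. 0 \<le> r \<Longrightarrow> r \<le> \<rho> \<Longrightarrow> nospin_admissible r g \<Longrightarrow> ereal L \<le> nospin_energy w T g"
    using nospin_energy_lower_bound[OF w T, of \<rho>] by blast
  have "\<exists>e. E_nospin w r T = ereal e" if "0 \<le> r" for r
    using nospin_minimiser_exists[OF w T that] by metis
  then have "\<exists>e. \<forall>r. 0 \<le> r \<longrightarrow> E_nospin w r T = ereal (e r)" by metis
  then obtain e where e: "\<And>r. 0 \<le> r \<Longrightarrow> E_nospin w r T = ereal (e r)" by blast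
  have eL: "L \<le> e r" if "0 \<le> r" "r \<le> \<rho>" for r
  proof -
    have "ereal L \<le> E_nospin w r T" unfolding E_nospin_def by (rule Inf_greatest) (use L that in auto)
    then show ?thesis using e[OF that(1)] by simp
  qed
  define f where "f r = e r + e (\<rho> - r)" for r
  define m where "m = Inf (f ` {0..\<rho>})"
  have bdd: "bdd_below (f ` {0..\<rho>})"
  proof (rule bdd_belowI2[of _ "L + L"])
    show "L + L \<le> f r" if "r \<in> {0..\<rho>}" for r
      unfolding f_def using that by (intro add_mono eL) auto
  qed
  have ne: "f ` {0..\<rho>} \<noteq> {}" using \<rho> by auto
  have m_le: "m \<le> f s" if "0 \<le> s" "s \<le> \<rho>" for s
    unfolding m_def by (rule cInf_lower[OF _ bdd]) (use that in auto)
  have "\<exists>r\<in>{0..\<rho>}. f r < m + 1 / (real n + 1)" for n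
  proof -
    have "m < m + 1 / (real n + 1)" by simp
    then show ?thesis using cInf_lessD[OF ne, of "m + 1 / (real n + 1)"] by (auto simp: m_def)
  qed
  then obtain r where r: "\<And>n. r n \<in> {0..\<rho>}" "\<And>n. f (r n) < m + 1 / (real n + 1)" by metis
  \<comment> \<open>The upper edge holds because f(r n) < m + 1 while the second summand is at least
    \<open>L\<close>.\<close>
  have "compact ({0..\<rho>} \<times> {L..m + 1 - L})" by (intro compact_Times) auto
  moreover have "(r n, e (r n)) \<in> {0..\<rho>} \<times> {L..m + 1 - L}" for n
  proof -
    have "1 / (real n + 1) \<le> 1" by simp
    moreover have rn: "0 \<le> r n" "r n \<le> \<rho>" using r(1)[of n] by auto
    ultimately have "e (r n) \<le> m + 1 - L"
      using r(2)[of n] eL[of "\<rho> - r n"] unfolding f_def by linarith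
    then show ?thesis using rn eL[of "r n"] by auto
  qed
  ultimately have "\<exists>l\<in>{0..\<rho>} \<times> {L..m + 1 - L}. \<exists>s. strict_mono s \<and> ((\<lambda>n. (r n, e (r n))) \<circ> s) \<longlonglongrightarrow> l"
    unfolding compact_eq_seq_compact_metric seq_compact_def
    by (elim allE[of _ "\<lambda>n. (r n, e (r n))"]) simp
  then obtain l s where l: "l \<in> {0..\<rho>} \<times> {L..m + 1 - L}" "strict_mono s"
    "((\<lambda>n. (r n, e (r n))) \<circ> s) \<longlonglongrightarrow> l"
    by blast
  obtain r' c where rc: "l = (r', c)" by (cases l)
  have rlim: "(\<lambda>n. r (s n)) \<longlonglongrightarrow> r'" and clim: "(\<lambda>n. e (r (s n))) \<longlonglongrightarrow> c"
    using tendsto_fst[OF l(3)] tendsto_snd[OF l(3)] by (auto simp: o_def rc)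
  have r': "0 \<le> r'" "r' \<le> \<rho>" using l(1) rc by auto
  have "(\<lambda>n. 1 / (real n + 1)) \<longlonglongrightarrow> 0" using LIMSEQ_Suc[OF lim_1_over_n] by (simp add: add.commute)
  from LIMSEQ_subseq_LIMSEQ[OF this l(2)] have slim: "(\<lambda>n. 1 / (real (s n) + 1)) \<longlonglongrightarrow> 0" by (simp add: o_def)
  have c1: "E_nospin w r' T \<le> ereal c"
  proof (rule E_nospin_lower_semicontinuous[OF w T _ rlim _ clim])
    show "0 \<le> r (s n)" for n using r(1)[of "s n"] by simp
    then show "E_nospin w (r (s n)) T \<le> ereal (e (r (s n)))" for n by (simp add: e)
  qed
  have c2: "E_nospin w (\<rho> - r') T \<le> ereal (m + 0 - c)"
  proof (rule E_nospin_lower_semicontinuous[OF w T])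
    show "(\<lambda>n. \<rho> - r (s n)) \<longlonglongrightarrow> \<rho> - r'" by (intro tendsto_diff tendsto_const rlim)
    show "(\<lambda>n. m + 1 / (real (s n) + 1) - e (r (s n))) \<longlonglongrightarrow> m + 0 - c"
      by (intro tendsto_diff tendsto_add tendsto_const slim clim)
    show "0 \<le> \<rho> - r (s n)" for n using r(1)[of "s n"] by simp
    then show "E_nospin w (\<rho> - r (s n)) T \<le> ereal (m + 1 / (real (s n) + 1) - e (r (s n)))" for n
      using r(2)[of "s n"] e[of "\<rho> - r (s n)"] by (simp add: f_def)
  qed
  have "f r' \<le> m" using c1 c2 e[of r'] e[of "\<rho> - r'"] r' by (simp add: f_def)
  then have "E_nospin w r' T + E_nospin w (\<rho> - r') T \<le> E_nospin w s T + E_nospin w (\<rho> - s) T"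
    if "0 \<le> s" "s \<le> \<rho>" for s
    using m_le[OF that] e[of r'] e[of "\<rho> - r'"] e[of s] e[of "\<rho> - s"] r' that by (simp add: f_def)
  then show ?thesis using that[OF r'] by blast
qed

section \<open>Hermitian two-by-two matrices\<close>

text \<open>The general element of SU(2); the columns (x, y) and (- cnj y, cnj x) will be the
  spin-up and spin-down eigenvectors.\<close>

definition su2 :: "complex \<Rightarrow> complex \<Rightarrow> complex^2^2"
  where "su2 x y = vector [vector [x, - cnj y], vector [y, cnj x]]"

lemma su2_nth [simp]:
  "su2 x y $ 1 $ 1 = x" "su2 x y $ 1 $ 2 = - cnj y" "su2 x y $ 2 $ 1 = y" "su2 x y $ 2 $ 2 = cnj x"
  by (simp_all add: su2_def)

lemma su2_unitary:
  assumes "(cmod x)\<^sup>2 + (cmod y)\<^sup>2 = 1"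
  shows "unitary (su2 x y)" "det (su2 x y) = 1"
proof -
  have "x * cnj x + y * cnj y = complex_of_real ((cmod x)\<^sup>2 + (cmod y)\<^sup>2)"
    by (simp only: of_real_add complex_norm_square)
  then have *: "x * cnj x + y * cnj y = 1" unfolding assms by simp
  then show "unitary (su2 x y)"
    by (simp add: unitary_def conj_transpose_def matrix_matrix_mult_def mat_def vec_eq_iff forall_2 sum_2 algebra_simps)
  show "det (su2 x y) = 1" using * by (simp add: det_2 algebra_simps)
qed

text \<open>
  The Bloch vector \<open>(n\<^sub>1, n\<^sub>2, n\<^sub>3)\<close> of a hermitian \<open>A = (t I + n \<cdot> \<sigma>) / 2\<close>, encoded as
  \<open>(n\<^sub>1 - \<i> n\<^sub>2, n\<^sub>3)\<close>.
\<close>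

definition bloch :: "complex^2^2 \<Rightarrow> complex \<times> real"
  where "bloch A = (2 * A $ 1 $ 2, Re (A $ 1 $ 1) - Re (A $ 2 $ 2))"

lemma hermitian_2_iff:
  "hermitian (A :: complex^2^2) \<longleftrightarrow> A $ 2 $ 1 = cnj (A $ 1 $ 2) \<and> Im (A $ 1 $ 1) = 0 \<and> Im (A $ 2 $ 2) = 0"
  by (auto simp: hermitian_def conj_transpose_def vec_eq_iff forall_2 complex_eq_iff)

text \<open>A preimage under the Hopf map: (x, y) is a unit spinor pointing in the direction n.
  Choosing x real and positive determines y by division by x, which fails only at the south pole c =
  -1, where (0, 1) is taken.\<close>

lemma bloch_direction:
  fixes n :: "complex \<times> real"
  assumes "norm n = 1"
  obtains x y where "(cmod x)\<^sup>2 = (1 + snd n) / 2" "(cmod y)\<^sup>2 = (1 - snd n) / 2" "2 * x * cnj y = fst n"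
proof -
  obtain b c where n: "n = (b, c)" by (cases n)
  have bc: "(cmod b)\<^sup>2 + c\<^sup>2 = 1" using assms by (simp add: n norm_Pair)
  show ?thesis
  proof (cases "c = -1")
    case True
    with bc have "b = 0" by simp
    then show ?thesis using that[of 0 1] True n by simp
  next
    case False
    have "c\<^sup>2 \<le> 1" using bc zero_le_power2[of "cmod b"] by linarith
    then have c: "0 < 1 + c" using False abs_le_square_iff[of c 1] by (auto simp: abs_le_iff)
    define s where "s = sqrt ((1 + c) / 2)"
    have s: "0 < s" "s\<^sup>2 = (1 + c) / 2" using c by (auto simp: s_def)
    have "(cmod (complex_of_real s))\<^sup>2 = (1 + snd n) / 2" using s n by simp
    moreover have "(cmod (cnj b / (2 * s)))\<^sup>2 = (1 - snd n) / 2"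
    proof -
      have "(cmod (cnj b / (2 * s)))\<^sup>2 = (cmod b)\<^sup>2 / (4 * s\<^sup>2)"
        by (simp add: norm_divide norm_mult power_divide power_mult_distrib)
      also have "(cmod b)\<^sup>2 = (1 + c) * (1 - c)"
        using bc by (simp add: power2_eq_square algebra_simps)
      also have "(1 + c) * (1 - c) / (4 * s\<^sup>2) = (1 - c) / 2"
        unfolding s(2) using c by (simp add: divide_eq_eq)
      finally show ?thesis by (simp add: n)
    qed
    moreover have "2 * complex_of_real s * cnj (cnj b / (2 * s)) = fst n" using s n by simp
    ultimately show ?thesis by (rule that)
  qed
qed

text \<open>The order of the quantifiers is the point: \<open>U\<close> depends on the direction
  only and serves all hermitian matrices whose Bloch vector is a real multiple of n. It has the
  spinor of n as first column.\<close>

lemma diagonalise_along_direction: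
  fixes n :: "complex \<times> real"
  assumes "norm n = 1"
  obtains U where "unitary U" "det U = 1"
    "\<And>A s. hermitian A \<Longrightarrow> bloch A = s *\<^sub>R n \<Longrightarrow>
      A = U ** diag_mat (vector [(Re (trace A) + s) / 2, (Re (trace A) - s) / 2]) ** conj_transpose U"
proof -
  obtain x y where x: "(cmod x)\<^sup>2 = (1 + snd n) / 2" and y: "(cmod y)\<^sup>2 = (1 - snd n) / 2"
    and xy: "2 * x * cnj y = fst n" using bloch_direction[OF assms] by blast
  have "(cmod x)\<^sup>2 + (cmod y)\<^sup>2 = 1" unfolding x y by (simp add: field_simps)
  note U = su2_unitary[OF this]
  have "A = su2 x y ** diag_mat (vector [(Re (trace A) + s) / 2, (Re (trace A) - s) / 2]) ** conj_transpose (su2 x y)"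
    (is "A = ?B") if herm: "hermitian A" and bl: "bloch A = s *\<^sub>R n" for A s
  proof -
    let ?l = "(Re (trace A) + s) / 2" and ?m = "(Re (trace A) - s) / 2"
    have xx: "x * cnj x = complex_of_real ((1 + snd n) / 2)" and yy: "y * cnj y = complex_of_real ((1 - snd n) / 2)"
      unfolding x[symmetric] y[symmetric] complex_norm_square by simp_all
    have b: "2 * A $ 1 $ 2 = s *\<^sub>R (2 * x * cnj y)" and c: "Re (A $ 1 $ 1) - Re (A $ 2 $ 2) = s * snd n"
      using bl xy by (auto simp: bloch_def prod_eq_iff)
    have t: "Re (trace A) = Re (A $ 1 $ 1) + Re (A $ 2 $ 2)" by (simp add: trace_def sum_2)
    have a: "A $ 1 $ 1 = complex_of_real (Re (A $ 1 $ 1))" and d: "A $ 2 $ 2 = complex_of_real (Re (A $ 2 $ 2))"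
      and o: "A $ 2 $ 1 = cnj (A $ 1 $ 2)"
      using herm by (auto simp: hermitian_2_iff complex_eq_iff)
    define p q where "p = complex_of_real ?l" and "q = complex_of_real ?m"
    have B: "?B $ i $ j = su2 x y $ i $ 1 * p * cnj (su2 x y $ j $ 1) + su2 x y $ i $ 2 * q * cnj (su2 x y $ j $ 2)" for i j
      by (simp add: matrix_matrix_mult_def conj_transpose_def diag_mat_def sum_2 p_def q_def)
    have "?B $ 1 $ 1 = p * (x * cnj x) + q * (y * cnj y)" unfolding B by (simp add: mult_ac)
    also have "\<dots> = complex_of_real (?l * ((1 + snd n) / 2) + ?m * ((1 - snd n) / 2))"
      unfolding xx yy p_def q_def by simp
    also have "?l * ((1 + snd n) / 2) + ?m * ((1 - snd n) / 2) = Re (A $ 1 $ 1)"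
      using c unfolding t by (simp add: field_simps)
    finally have 11: "?B $ 1 $ 1 = A $ 1 $ 1" using a by simp
    have "?B $ 2 $ 2 = p * (y * cnj y) + q * (x * cnj x)" unfolding B by (simp add: mult_ac)
    also have "\<dots> = complex_of_real (?l * ((1 - snd n) / 2) + ?m * ((1 + snd n) / 2))"
      unfolding xx yy p_def q_def by simp
    also have "?l * ((1 - snd n) / 2) + ?m * ((1 + snd n) / 2) = Re (A $ 2 $ 2)"
      using c unfolding t by (simp add: field_simps)
    finally have 22: "?B $ 2 $ 2 = A $ 2 $ 2" using d by simp
    have "?l - ?m = s" by (simp add: field_simps)
    then have pq: "p - q = complex_of_real s" unfolding p_def q_def by (metis of_real_diff)
    have "?B $ 1 $ 2 = (p - q) * (x * cnj y)" unfolding B by (simp add: algebra_simps)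
    also have "\<dots> = A $ 1 $ 2" unfolding pq using b by (simp add: scaleR_conv_of_real)
    finally have 12: "?B $ 1 $ 2 = A $ 1 $ 2" .
    have "cnj p = p" "cnj q = q" by (simp_all add: p_def q_def)
    then have "?B $ 2 $ 1 = cnj (?B $ 1 $ 2)" unfolding B by (simp add: algebra_simps)
    then have 21: "?B $ 2 $ 1 = A $ 2 $ 1" unfolding 12 o .
    show ?thesis using 11 12 21 22 by (simp add: vec_eq_iff forall_2)
  qed
  then show ?thesis using that[OF U] by blast
qed

section \<open>Eigenvalues and traces\<close>

definition eig_up :: "complex^2^2 \<Rightarrow> real" where "eig_up A = (Re (trace A) + norm (bloch A)) / 2"
definition eig_down :: "complex^2^2 \<Rightarrow> real" where "eig_down A = (Re (trace A) - norm (bloch A)) / 2"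

definition has_eigenvalues :: "complex^2^2 \<Rightarrow> real \<Rightarrow> real \<Rightarrow> bool"
  where "has_eigenvalues A l m \<longleftrightarrow> (\<exists>U. unitary U \<and> A = U ** diag_mat (vector [l, m]) ** conj_transpose U)"

lemma hermitian_has_eigenvalues:
  assumes "hermitian A" shows "has_eigenvalues A (eig_up A) (eig_down A)"
proof -
  obtain n where n: "norm n = 1" "bloch A = norm (bloch A) *\<^sub>R n"
  proof (cases "bloch A = 0")
    case True
    then show ?thesis using that[of "(0, 1)"] by (simp add: zero_prod_def)
  next
    case False
    then show ?thesis using that[of "bloch A /\<^sub>R norm (bloch A)"] by simp
  qed
  obtain U where U: "unitary U" "\<And>A s. hermitian A \<Longrightarrow> bloch A = s *\<^sub>R n \<Longrightarrow>
      A = U ** diag_mat (vector [(Re (trace A) + s) / 2, (Re (trace A) - s) / 2]) ** conj_transpose U"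
    using diagonalise_along_direction[OF n(1)] by blast
  show ?thesis
    unfolding has_eigenvalues_def eig_up_def eig_down_def using U(1) U(2)[OF assms n(2)] by blast
qed

lemma trace_matrix_fun:
  assumes "has_eigenvalues A l m"
  shows "trace (matrix_fun f A) = complex_of_real (f l + f m)"
proof -
  obtain U where U: "unitary U" and A: "A = U ** diag_mat (vector [l, m]) ** conj_transpose U"
    using assms by (auto simp: has_eigenvalues_def)
  let ?D = "diag_mat (\<chi> i. f (vector [l, m] $ i)) :: complex^2^2"
  have "trace (matrix_fun f A) = trace (conj_transpose U ** (U ** ?D))"
    unfolding A matrix_fun_diag[OF U] by (rule trace_mul_sym)
  also have "\<dots> = trace ?D" using U by (simp add: matrix_mul_assoc unitary_def)
  also have "\<dots> = complex_of_real (f l + f m)" by (simp add: trace_def diag_mat_def sum_2)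
  finally show ?thesis .
qed

lemma trace_eq_sum_eigenvalues:
  assumes "has_eigenvalues A l m"
  shows "Re (trace A) = l + m"
proof -
  obtain U where U: "unitary U" and A: "A = U ** diag_mat (vector [l, m]) ** conj_transpose U"
    using assms by (auto simp: has_eigenvalues_def)
  have "trace A = trace (conj_transpose U ** (U ** diag_mat (vector [l, m])))"
    unfolding A by (rule trace_mul_sym)
  also have "\<dots> = trace (diag_mat (vector [l, m]) :: complex^2^2)" using U by (simp add: matrix_mul_assoc unitary_def)
  finally show ?thesis by (simp add: trace_def diag_mat_def sum_2)
qed

text \<open>Column i of \<open>U\<close> is a unit eigenvector, so the quadratic form evaluated
  there is m.\<close>

lemma pos_semidef_eigenvalue_nonneg:
  fixes B :: "complex^'n^'n"
  assumes U: "unitary U" and B: "pos_semidef B" and ev: "\<And>j. (B ** U) $ j $ i = U $ j $ i * complex_of_real m"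
  shows "0 \<le> m"
proof -
  let ?v = "\<chi> j. U $ j $ i"
  have Bv: "(B *v ?v) $ j = U $ j $ i * complex_of_real m" for j
    using ev[of j] by (simp add: matrix_vector_mult_def matrix_matrix_mult_def)
  have "(conj_transpose U ** U) $ i $ i = 1" using U by (simp add: unitary_def mat_def)
  then have one: "(\<Sum>j\<in>UNIV. cnj (U $ j $ i) * U $ j $ i) = 1"
    by (simp add: matrix_matrix_mult_def conj_transpose_def)
  have "(\<Sum>j\<in>UNIV. cnj (?v $ j) * (B *v ?v) $ j) = (\<Sum>j\<in>UNIV. cnj (U $ j $ i) * U $ j $ i) * complex_of_real m"
    unfolding Bv sum_distrib_right by (intro sum.cong) (auto simp: mult_ac)
  then have m: "Re (\<Sum>j\<in>UNIV. cnj (?v $ j) * (B *v ?v) $ j) = m" unfolding one by simp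
  have "0 \<le> Re (\<Sum>j\<in>UNIV. cnj (?v $ j) * (B *v ?v) $ j)" using B unfolding pos_semidef_def by blast
  then show ?thesis unfolding m .
qed

lemma eigenvalue_bounds:
  assumes psd: "pos_semidef A" "pos_semidef (mat 1 - A)" and "has_eigenvalues A l m"
  shows "0 \<le> l" "l \<le> 1" "0 \<le> m" "m \<le> 1"
proof -
  obtain U where U: "unitary U" and A: "A = U ** diag_mat (vector [l, m]) ** conj_transpose U"
    using assms by (auto simp: has_eigenvalues_def)
  have "A ** U = U ** diag_mat (vector [l, m]) ** (conj_transpose U ** U)" unfolding A by (simp add: matrix_mul_assoc)
  then have AU: "A ** U = U ** diag_mat (vector [l, m])" using U by (simp add: unitary_def)
  have e: "(A ** U) $ j $ i = U $ j $ i * complex_of_real (vector [l, m] $ i)" for i j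
    unfolding AU diag_mat_mult_right ..
  have MU: "(mat 1 - A) ** U = mat 1 ** U - A ** U"
    by (simp add: vec_eq_iff matrix_matrix_mult_def left_diff_distrib sum_subtractf)
  then have f: "((mat 1 - A) ** U) $ j $ i = U $ j $ i * complex_of_real (1 - vector [l, m] $ i)" for i j
    unfolding MU matrix_mul_lid vector_minus_component e by (simp add: algebra_simps)
  have "0 \<le> vector [l, m] $ (i::2)" "0 \<le> 1 - vector [l, m] $ (i::2)" for i
    using pos_semidef_eigenvalue_nonneg[OF U psd(1), of i "vector [l, m] $ i"] e
      pos_semidef_eigenvalue_nonneg[OF U psd(2), of i "1 - vector [l, m] $ i"] f by auto
  from this[of 1] this[of 2] show "0 \<le> l" "l \<le> 1" "0 \<le> m" "m \<le> 1" by auto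
qed

text \<open>Orthogonality of the identity and the Pauli matrices under the trace. The inner product
  on pairs of a complex and a real number is the Euclidean one, so the encoding by
  \<open>bloch\<close> keeps lengths and angles.\<close>

lemma Re_trace_mult:
  fixes A B :: "complex^2^2"
  assumes "hermitian A" "hermitian B"
  shows "Re (trace (A ** B)) = (Re (trace A) * Re (trace B) + bloch A \<bullet> bloch B) / 2"
  using assms by (simp add: trace_def matrix_matrix_mult_def sum_2 bloch_def hermitian_2_iff inner_prod_def
      inner_complex_def field_simps)

lemma has_eigenvalues_diag: "has_eigenvalues (diag_mat (vector [l, m])) l m"
proof -
  have "conj_transpose (mat 1) = (mat 1 :: complex^2^2)"
    by (auto simp: conj_transpose_def mat_def vec_eq_iff)
  then show ?thesis
    unfolding has_eigenvalues_def by (intro exI[of _ "mat 1"]) (simp add: unitary_def)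
qed

lemma pos_semidef_diag_mat:
  assumes "\<And>i. 0 \<le> l $ i" shows "pos_semidef (diag_mat l)"
proof -
  have "(diag_mat l *v v) $ i = complex_of_real (l $ i) * v $ i" for v :: "complex^'a" and i
    by (simp add: matrix_vector_mult_def diag_mat_def if_distrib[of "\<lambda>x. x * _"] cong: if_cong)
  then have "cnj (v $ i) * (diag_mat l *v v) $ i = complex_of_real (l $ i * (cmod (v $ i))\<^sup>2)" for v i
    by (simp only: of_real_mult complex_norm_square mult_ac)
  moreover have "hermitian (diag_mat l)"
    by (simp add: hermitian_def conj_transpose_def diag_mat_def vec_eq_iff)
  ultimately show ?thesis using assms by (simp add: pos_semidef_def sum_nonneg)
qed

section \<open>The spin problem\<close>

lemma Re_trace_measurable [measurable]: "(\<lambda>A::complex^2^2. Re (trace A)) \<in> borel_measurable borel"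
  unfolding trace_def by (intro borel_measurable_continuous_onI continuous_intros)

lemma bloch_measurable [measurable]: "bloch \<in> borel_measurable borel"
  unfolding bloch_def[abs_def] by (intro borel_measurable_continuous_onI continuous_intros)

lemma diag_mat_2_measurable:
  assumes [measurable]: "f \<in> borel_measurable M" "g \<in> borel_measurable M"
  shows "(\<lambda>x. diag_mat (vector [f x, g x]) :: complex^2^2) \<in> borel_measurable M"
proof -
  have "(\<lambda>x. diag_mat (vector [f x, g x]) :: complex^2^2)
      = (\<lambda>x. f x *\<^sub>R diag_mat (vector [1, 0]) + g x *\<^sub>R diag_mat (vector [0, 1]))"
    by (auto simp: fun_eq_iff vec_eq_iff forall_2 diag_mat_def of_real_def)
  then show ?thesis by simp
qed

section \<open>Comparison of the spin energy with two no-spin energies\<close>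

definition spin_exchange :: "(real^'d \<Rightarrow> real) \<Rightarrow> (real^'d \<Rightarrow> complex^2^2) \<Rightarrow> real"
  where "spin_exchange w \<gamma> = (\<integral>(k, k'). w (k - k') * Re (trace (\<gamma> k ** \<gamma> k')) \<partial>(lborel \<Otimes>\<^sub>M lborel))"

text \<open>Kinetic energy and entropy are spectral and split over the eigenvalues; only the
  exchange term sees the eigenvectors. No order of \<open>l\<close> and \<open>m\<close> is assumed,
  so the identity applies both to the eigenvalues of a given state and to diagonal test
  states.\<close>

lemma spin_energy_decomposition:
  fixes \<gamma> :: "real^'d \<Rightarrow> complex^2^2"
  assumes T: "0 \<le> T" and ev: "\<And>k. has_eigenvalues (\<gamma> k) (l k) (m k)"
    and l: "integrable lborel l" "\<And>x. 0 \<le> l x \<and> l x \<le> 1"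
    and m: "integrable lborel m" "\<And>x. 0 \<le> m x \<and> m x \<le> 1"
  shows "spin_energy w T \<gamma> = nospin_energy w T l + nospin_energy w T m
    + ereal (1 / (2 * (2 * pi) ^ CARD('d)) * (exchange w l + exchange w m - spin_exchange w \<gamma>))"
proof -
  have [measurable]: "l \<in> borel_measurable borel" "m \<in> borel_measurable borel" using l m by auto
  define P where "P = (2 * pi) ^ CARD('d)"
  have P: "P > 0" by (simp add: P_def)
  define H where "H u = T\<^sup>2 * (\<integral>x. u x \<partial>lborel) + T * exp_mass TYPE('d)" for u :: "real^'d \<Rightarrow> real"
  let ?h = "\<lambda>u x. T\<^sup>2 * u x + T * exp (- norm x) :: real"
  let ?f = "\<lambda>k. (norm k)\<^sup>2 / 2 * (l k + m k) - T * (entropy_fun (l k) + entropy_fun (m k))"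
  have fh: "?f x + (?h l x + ?h m x) = shifted_density T x (l x) + shifted_density T x (m x)" for x
    by (simp add: shifted_density_def algebra_simps)
  have nn: "0 \<le> shifted_density T x (l x)" "0 \<le> shifted_density T x (m x)" for x
    using l(2)[of x] m(2)[of x] T by (auto intro: shifted_density_nonneg)
  have ih: "integrable lborel (?h u)" "(\<integral>x. ?h u x \<partial>lborel) = H u" if "integrable lborel u" for u :: "real^'d \<Rightarrow> real"
    using that integrable_exp_minus_norm[where 'a="real^'d"] by (auto simp: H_def exp_mass_def)
  have "ext_integral lborel ?f
      = enn2ereal (\<integral>\<^sup>+x. ennreal (?f x + (?h l x + ?h m x)) \<partial>lborel) - ereal (\<integral>x. ?h l x + ?h m x \<partial>lborel)"
  proof (rule ext_integral_eq_shift)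
    show "integrable lborel (\<lambda>x. ?h l x + ?h m x)" by (intro Bochner_Integration.integrable_add[OF ih(1) ih(1)] l m)
    show "0 \<le> ?h l x + ?h m x" for x using l(2)[of x] m(2)[of x] T by simp
    show "0 \<le> ?f x + (?h l x + ?h m x)" for x unfolding fh using nn[of x] by simp
  qed measurable
  also have "(\<integral>\<^sup>+x. ennreal (?f x + (?h l x + ?h m x)) \<partial>lborel) = shifted_energy T l + shifted_energy T m"
    unfolding fh shifted_energy_def
    by (subst nn_integral_add[symmetric]) (auto intro!: nn_integral_cong simp: nn ennreal_plus)
  also have "(\<integral>x. ?h l x + ?h m x \<partial>lborel) = H l + H m"
    using Bochner_Integration.integral_add[OF ih(1)[OF l(1)] ih(1)[OF m(1)]] ih(2) l(1) m(1) by simp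
  finally have ext: "ext_integral lborel ?f = enn2ereal (shifted_energy T l + shifted_energy T m) - ereal (H l + H m)" .
  have spin: "spin_energy w T \<gamma> = ereal (1 / P) * (enn2ereal (shifted_energy T l + shifted_energy T m) - ereal (H l + H m))
      - ereal (1 / (2 * P) * spin_exchange w \<gamma>)"
    unfolding spin_energy_def trace_matrix_fun[OF ev] trace_eq_sum_eigenvalues[OF ev] Re_complex_of_real ext
      spin_exchange_def P_def ..
  have inf: "nospin_energy w T u = \<infinity> \<or> (\<exists>x. nospin_energy w T u = ereal x)"
    if u: "integrable lborel u" "\<And>x. 0 \<le> u x \<and> u x \<le> 1" for u :: "real^'d \<Rightarrow> real"
    by (rule shifted_energy_top_or_real[of T u])
      (use nospin_energy_infinite[OF u T] nospin_energy_real[OF u T] in auto)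
  show ?thesis
  \<comment> \<open>Rearranging sums and differences in \<open>ereal\<close> is safe only for finite
    terms; in the other case both sides are infinite.\<close>
  proof (cases "shifted_energy T l = top \<or> shifted_energy T m = top")
    case True
    then have sum: "shifted_energy T l + shifted_energy T m = top" by auto
    have "spin_energy w T \<gamma> = \<infinity>" unfolding spin sum using P by simp
    moreover have "nospin_energy w T l + nospin_energy w T m = \<infinity>"
      using True nospin_energy_infinite[OF l T, of w] nospin_energy_infinite[OF m T, of w] inf[OF l] inf[OF m] by auto
    ultimately show ?thesis by simp
  next
    case False
    then obtain a b where a: "0 \<le> a" "shifted_energy T l = ennreal a" and b: "0 \<le> b" "shifted_energy T m = ennreal b"
      by (metis shifted_energy_top_or_real)
    have sum: "shifted_energy T l + shifted_energy T m = ennreal (a + b)" using a b by simp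
    have "spin_energy w T \<gamma> = ereal (1 / P * (a + b - (H l + H m)) - 1 / (2 * P) * spin_exchange w \<gamma>)"
      unfolding spin sum using a(1) b(1) by (simp add: enn2ereal_ennreal del: ennreal_plus)
    moreover have "nospin_energy w T l = ereal (1 / P * (a - H l - exchange w l / 2))"
      unfolding nospin_energy_real[OF l T a] P_def H_def ..
    moreover have "nospin_energy w T m = ereal (1 / P * (b - H m - exchange w m / 2))"
      unfolding nospin_energy_real[OF m T b] P_def H_def ..
    ultimately show ?thesis using P unfolding P_def[symmetric] by (simp add: field_simps)
  qed
qed

lemma spin_exchange_diag:
  fixes w :: "real^'d \<Rightarrow> real"
  assumes w: "L1_plus_Linf w" and l: "integrable lborel l" "\<And>x. 0 \<le> l x \<and> l x \<le> 1"
    and m: "integrable lborel m" "\<And>x. 0 \<le> m x \<and> m x \<le> 1"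
  shows "spin_exchange w (\<lambda>k. diag_mat (vector [l k, m k])) = exchange w l + exchange w m"
proof -
  have tr: "Re (trace (diag_mat (vector [a, b]) ** diag_mat (vector [c, d]) :: complex^2^2)) = a * c + b * d" for a b c d
    by (simp add: trace_def sum_2 diag_mat_mult_left) (simp add: diag_mat_def)
  have "\<bar>l x\<bar> \<le> 1" "\<bar>m x\<bar> \<le> 1" for x using l(2)[of x] m(2)[of x] by auto
  then have "integrable (lborel \<Otimes>\<^sub>M lborel) (\<lambda>(x, y). w (x - y) * l x * l y)"
    "integrable (lborel \<Otimes>\<^sub>M lborel) (\<lambda>(x, y). w (x - y) * m x * m y)"
    using integrable_exchange[OF w l(1) l(1)] integrable_exchange[OF w m(1) m(1)] by blast+
  from Bochner_Integration.integral_add[OF this] show ?thesis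
    by (simp add: spin_exchange_def exchange_def tr split_beta' distrib_left mult.assoc)
qed

lemma spin_admissible_hermitian:
  assumes "spin_admissible \<rho> \<gamma>" shows "hermitian (\<gamma> k)"
  using assms by (auto simp: spin_admissible_def pos_semidef_def)

lemma eig_up_plus_eig_down: "eig_up A + eig_down A = Re (trace A)"
  by (simp add: eig_up_def eig_down_def field_simps)

text \<open>Both eigenvalues are nonnegative with sum the trace, so each is dominated by the trace
  and inherits its integrability.\<close>

lemma spin_admissible_eigenvalues:
  fixes \<gamma> :: "real^'d \<Rightarrow> complex^2^2"
  assumes adm: "spin_admissible \<rho> \<gamma>"
  obtains \<rho>_up \<rho>_down where "0 \<le> \<rho>_up" "0 \<le> \<rho>_down" "\<rho>_up + \<rho>_down = \<rho>"
    "nospin_admissible \<rho>_up (\<lambda>k. eig_up (\<gamma> k))" "nospin_admissible \<rho>_down (\<lambda>k. eig_down (\<gamma> k))"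
proof -
  have [measurable]: "\<gamma> \<in> borel_measurable borel" using adm by (simp add: spin_admissible_def)
  have t: "integrable lborel (\<lambda>k. Re (trace (\<gamma> k)))" using adm by (simp add: spin_admissible_def)
  have psd: "pos_semidef (\<gamma> k)" "pos_semidef (mat 1 - \<gamma> k)" for k using adm by (auto simp: spin_admissible_def)
  note bounds = eigenvalue_bounds[OF psd hermitian_has_eigenvalues[OF spin_admissible_hermitian[OF adm]]]
  have le: "eig_up (\<gamma> k) \<le> Re (trace (\<gamma> k))" "eig_down (\<gamma> k) \<le> Re (trace (\<gamma> k))" for k
    using bounds[of k] eig_up_plus_eig_down[of "\<gamma> k"] by linarith+
  have [measurable]: "(\<lambda>k. eig_up (\<gamma> k)) \<in> borel_measurable borel" "(\<lambda>k. eig_down (\<gamma> k)) \<in> borel_measurable borel"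
    unfolding eig_up_def eig_down_def by measurable
  have i: "integrable lborel (\<lambda>k. eig_up (\<gamma> k))" "integrable lborel (\<lambda>k. eig_down (\<gamma> k))"
    by (rule Bochner_Integration.integrable_bound[OF t]; use bounds le in \<open>auto intro!: AE_I2 order_trans[OF le(1) abs_ge_self] order_trans[OF le(2) abs_ge_self]\<close>)+
  define P where "P = (2 * pi) ^ CARD('d)"
  have P: "P > 0" by (simp add: P_def)
  have adm_part: "nospin_admissible ((\<integral>k. u k \<partial>lborel) / P) u" if "integrable lborel u" "\<And>k. 0 \<le> u k \<and> u k \<le> 1" for u :: "real^'d \<Rightarrow> real"
    by (rule nospin_admissibleI[OF that], unfold P_def[symmetric]) (use P in simp)
  have "(\<integral>k. eig_up (\<gamma> k) \<partial>lborel) + (\<integral>k. eig_down (\<gamma> k) \<partial>lborel) = (\<integral>k. Re (trace (\<gamma> k)) \<partial>lborel)"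
    unfolding eig_up_plus_eig_down[symmetric] using i by simp
  then have "(\<integral>k. eig_up (\<gamma> k) \<partial>lborel) / P + (\<integral>k. eig_down (\<gamma> k) \<partial>lborel) / P = \<rho>"
    using adm unfolding spin_admissible_def P_def[symmetric] by (simp add: add_divide_distrib[symmetric])
  moreover have "0 \<le> (\<integral>k. eig_up (\<gamma> k) \<partial>lborel) / P" "0 \<le> (\<integral>k. eig_down (\<gamma> k) \<partial>lborel) / P"
    using bounds P by (auto intro!: divide_nonneg_pos integral_nonneg_AE)
  ultimately show ?thesis using adm_part[OF i(1)] adm_part[OF i(2)] bounds that by blast
qed

text \<open>The products of equal eigenvalues add up to (t t' + |n| |n'|) / 2, and subtracting the
  trace of the product leaves (|n| |n'| - n . n') / 2. Integrability of the three parts is shown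
  first, since the integral is split.\<close>

lemma exchange_deficit:
  fixes \<gamma> :: "real^'d \<Rightarrow> complex^2^2" and w :: "real^'d \<Rightarrow> real"
  assumes w: "L1_plus_Linf w" and adm: "spin_admissible \<rho> \<gamma>"
  defines "D \<equiv> \<lambda>(k, k'). w (k - k') * ((norm (bloch (\<gamma> k)) * norm (bloch (\<gamma> k')) - bloch (\<gamma> k) \<bullet> bloch (\<gamma> k')) / 2)"
  shows "integrable (lborel \<Otimes>\<^sub>M lborel) D"
    and "exchange w (\<lambda>k. eig_up (\<gamma> k)) + exchange w (\<lambda>k. eig_down (\<gamma> k)) - spin_exchange w \<gamma>
      = (\<integral>p. D p \<partial>(lborel \<Otimes>\<^sub>M lborel))"
proof -
  note [measurable] = L1_plus_Linf_measurable[OF w]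
  have [measurable]: "\<gamma> \<in> borel_measurable borel" using adm by (simp add: spin_admissible_def)
  obtain \<rho>_up \<rho>_down where "nospin_admissible \<rho>_up (\<lambda>k. eig_up (\<gamma> k))" "nospin_admissible \<rho>_down (\<lambda>k. eig_down (\<gamma> k))"
    by (rule spin_admissible_eigenvalues[OF adm]) blast
  note u = nospin_admissibleD[OF this(1)] and d = nospin_admissibleD[OF this(2)]
  have ud: "\<bar>eig_up (\<gamma> k)\<bar> \<le> 1" "\<bar>eig_down (\<gamma> k)\<bar> \<le> 1" for k using u(2)[of k] d(2)[of k] by auto
  let ?U = "\<lambda>(x, y). w (x - y) * eig_up (\<gamma> x) * eig_up (\<gamma> y)"
  let ?V = "\<lambda>(x, y). w (x - y) * eig_down (\<gamma> x) * eig_down (\<gamma> y)"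
  let ?W = "\<lambda>(x, y). w (x - y) * Re (trace (\<gamma> x)) * Re (trace (\<gamma> y))"
  let ?S = "\<lambda>(x, y). w (x - y) * Re (trace (\<gamma> x ** \<gamma> y))"
  have iU: "integrable (lborel \<Otimes>\<^sub>M lborel) ?U" by (rule integrable_exchange[OF w u(1) u(1) ud(1)])
  have iV: "integrable (lborel \<Otimes>\<^sub>M lborel) ?V" by (rule integrable_exchange[OF w d(1) d(1) ud(2)])
  have it: "integrable lborel (\<lambda>k. Re (trace (\<gamma> k)))" using adm by (simp add: spin_admissible_def)
  have t2: "\<bar>Re (trace (\<gamma> k))\<bar> \<le> 2" for k using u(2)[of k] d(2)[of k] eig_up_plus_eig_down[of "\<gamma> k"] by linarith
  have iW: "integrable (lborel \<Otimes>\<^sub>M lborel) ?W" by (rule integrable_exchange[OF w it it t2])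
  have S: "?S = (\<lambda>(x, y). w (x - y) * ((Re (trace (\<gamma> x)) * Re (trace (\<gamma> y)) + bloch (\<gamma> x) \<bullet> bloch (\<gamma> y)) / 2))"
    using Re_trace_mult[OF spin_admissible_hermitian[OF adm] spin_admissible_hermitian[OF adm]] by (simp add: fun_eq_iff)
  \<comment> \<open>Nonnegativity of the lower eigenvalue. By Cauchy-Schwarz, the spin kernel is
    then dominated by the kernel of the traces.\<close>
  have nt: "norm (bloch (\<gamma> k)) \<le> Re (trace (\<gamma> k))" for k
    using d(2)[of k] by (simp add: eig_down_def)
  have half: "\<bar>(p + q) / 2\<bar> \<le> \<bar>p\<bar>" if "\<bar>q\<bar> \<le> p" for p q :: real
    using that by (auto simp: abs_le_iff)
  have iS: "integrable (lborel \<Otimes>\<^sub>M lborel) ?S"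
  proof (rule Bochner_Integration.integrable_bound[OF iW])
    show "?S \<in> borel_measurable (lborel \<Otimes>\<^sub>M lborel)" unfolding S by measurable
    show "AE p in lborel \<Otimes>\<^sub>M lborel. norm (?S p) \<le> norm (?W p)"
    proof (intro AE_I2, clarify)
      fix x y :: "real^'d"
      have "\<bar>bloch (\<gamma> x) \<bullet> bloch (\<gamma> y)\<bar> \<le> norm (bloch (\<gamma> x)) * norm (bloch (\<gamma> y))" by (rule Cauchy_Schwarz_ineq2)
      also have "\<dots> \<le> Re (trace (\<gamma> x)) * Re (trace (\<gamma> y))"
        using nt[of x] nt[of y] norm_ge_zero[of "bloch (\<gamma> x)"] norm_ge_zero[of "bloch (\<gamma> y)"]
        by (intro mult_mono) linarith+
      finally have "\<bar>(Re (trace (\<gamma> x)) * Re (trace (\<gamma> y)) + bloch (\<gamma> x) \<bullet> bloch (\<gamma> y)) / 2\<bar>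
          \<le> \<bar>Re (trace (\<gamma> x)) * Re (trace (\<gamma> y))\<bar>" by (rule half)
      then show "norm (w (x - y) * Re (trace (\<gamma> x ** \<gamma> y))) \<le> norm (w (x - y) * Re (trace (\<gamma> x)) * Re (trace (\<gamma> y)))"
        unfolding Re_trace_mult[OF spin_admissible_hermitian[OF adm] spin_admissible_hermitian[OF adm]]
        by (simp add: abs_mult mult.assoc mult_left_mono)
    qed
  qed
  have D: "D = (\<lambda>p. ?U p + ?V p - ?S p)"
    unfolding D_def S by (auto simp: fun_eq_iff eig_up_def eig_down_def field_simps)
  show "integrable (lborel \<Otimes>\<^sub>M lborel) D"
    unfolding D by (intro Bochner_Integration.integrable_diff Bochner_Integration.integrable_add iU iV iS)
  show "exchange w (\<lambda>k. eig_up (\<gamma> k)) + exchange w (\<lambda>k. eig_down (\<gamma> k)) - spin_exchange w \<gamma>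
      = (\<integral>p. D p \<partial>(lborel \<Otimes>\<^sub>M lborel))"
    unfolding D exchange_def spin_exchange_def
    using Bochner_Integration.integral_diff[OF Bochner_Integration.integrable_add[OF iU iV] iS]
      Bochner_Integration.integral_add[OF iU iV] by simp
qed

lemma spin_energy_ge:
  fixes \<gamma> :: "real^'d \<Rightarrow> complex^2^2" and w :: "real^'d \<Rightarrow> real"
  assumes w: "L1_plus_Linf w" and pos: "AE k in lborel. 0 < w k" and T: "0 \<le> T" and adm: "spin_admissible \<rho> \<gamma>"
  obtains d where "0 \<le> d"
    "spin_energy w T \<gamma> = nospin_energy w T (\<lambda>k. eig_up (\<gamma> k)) + nospin_energy w T (\<lambda>k. eig_down (\<gamma> k)) + ereal d"
    "d = 0 \<longrightarrow> (\<exists>n. norm n = 1 \<and> (AE k in lborel. bloch (\<gamma> k) = norm (bloch (\<gamma> k)) *\<^sub>R n))"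
proof -
  let ?D = "\<lambda>(k, k'). w (k - k') * ((norm (bloch (\<gamma> k)) * norm (bloch (\<gamma> k')) - bloch (\<gamma> k) \<bullet> bloch (\<gamma> k')) / 2)"
  note D = exchange_deficit[OF w adm]
  define d where "d = 1 / (2 * (2 * pi) ^ CARD('d)) * (\<integral>p. ?D p \<partial>(lborel \<Otimes>\<^sub>M lborel))"
  obtain \<rho>_up \<rho>_down where "nospin_admissible \<rho>_up (\<lambda>k. eig_up (\<gamma> k))" "nospin_admissible \<rho>_down (\<lambda>k. eig_down (\<gamma> k))"
    by (rule spin_admissible_eigenvalues[OF adm]) blast
  note u = nospin_admissibleD[OF this(1)] and v = nospin_admissibleD[OF this(2)]
  have posp: "AE (k, k') in lborel \<Otimes>\<^sub>M lborel. 0 < w (k - k')" by (rule AE_lborel_diff[OF pos])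
  then have nn: "AE p in lborel \<Otimes>\<^sub>M lborel. 0 \<le> ?D p"
  proof (rule AE_mp, intro AE_I2 impI, clarify)
    fix x y assume "0 < w (x - y)"
    then show "0 \<le> w (x - y) * ((norm (bloch (\<gamma> x)) * norm (bloch (\<gamma> y)) - bloch (\<gamma> x) \<bullet> bloch (\<gamma> y)) / 2)"
      using norm_cauchy_schwarz[of "bloch (\<gamma> x)" "bloch (\<gamma> y)"] by (intro mult_nonneg_nonneg) auto
  qed
  have "0 \<le> d" unfolding d_def using nn by (intro mult_nonneg_nonneg integral_nonneg_AE) auto
  moreover have "spin_energy w T \<gamma> = nospin_energy w T (\<lambda>k. eig_up (\<gamma> k)) + nospin_energy w T (\<lambda>k. eig_down (\<gamma> k)) + ereal d"
    unfolding d_def D(2)[symmetric]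
    by (rule spin_energy_decomposition[OF T hermitian_has_eigenvalues[OF spin_admissible_hermitian[OF adm]] u(1,2) v(1,2)])
  moreover have "d = 0 \<longrightarrow> (\<exists>n. norm n = 1 \<and> (AE k in lborel. bloch (\<gamma> k) = norm (bloch (\<gamma> k)) *\<^sub>R n))"
  proof
    assume "d = 0"
    have "(\<integral>p. ?D p \<partial>(lborel \<Otimes>\<^sub>M lborel)) = 0" using \<open>d = 0\<close> by (simp add: d_def)
    then have "AE p in lborel \<Otimes>\<^sub>M lborel. ?D p = 0"
      using integral_nonneg_eq_0_iff_AE[OF D(1) nn] by simp
    with posp have "AE (k, k') in lborel \<Otimes>\<^sub>M lborel. bloch (\<gamma> k) \<bullet> bloch (\<gamma> k') = norm (bloch (\<gamma> k)) * norm (bloch (\<gamma> k'))"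
      by eventually_elim auto
    from lborel_pair.AE_pair[OF this]
    have ae: "AE k in lborel. AE k' in lborel. bloch (\<gamma> k) \<bullet> bloch (\<gamma> k') = norm (bloch (\<gamma> k)) * norm (bloch (\<gamma> k'))"
      by simp
    show "\<exists>n. norm n = 1 \<and> (AE k in lborel. bloch (\<gamma> k) = norm (bloch (\<gamma> k)) *\<^sub>R n)"
    proof (cases "AE k in lborel. bloch (\<gamma> k) = 0")
      case True
      then have "AE k in lborel. bloch (\<gamma> k) = norm (bloch (\<gamma> k)) *\<^sub>R (0, 1)" by eventually_elim (simp add: zero_prod_def)
      then show ?thesis by (intro exI[of _ "(0, 1)"]) simp
    next
      case False
      \<comment> \<open>By Fubini, almost every k is parallel to almost all k'. As the Bloch vector
        is not almost everywhere 0, one of these k has a nonzero vector and fixes the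
        direction.\<close>
      have "\<exists>k. bloch (\<gamma> k) \<noteq> 0 \<and> (AE k' in lborel. bloch (\<gamma> k) \<bullet> bloch (\<gamma> k') = norm (bloch (\<gamma> k)) * norm (bloch (\<gamma> k')))"
      proof (rule ccontr)
        assume "\<not> ?thesis"
        with ae have "AE k in lborel. bloch (\<gamma> k) = 0" by (auto elim!: eventually_mono)
        with False show False ..
      qed
      then obtain k0 where k0: "bloch (\<gamma> k0) \<noteq> 0"
        and aek: "AE k' in lborel. bloch (\<gamma> k0) \<bullet> bloch (\<gamma> k') = norm (bloch (\<gamma> k0)) * norm (bloch (\<gamma> k'))" by blast
      let ?n = "bloch (\<gamma> k0) /\<^sub>R norm (bloch (\<gamma> k0))"
      from aek have "AE k in lborel. bloch (\<gamma> k) = norm (bloch (\<gamma> k)) *\<^sub>R ?n"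
      proof eventually_elim
        case (elim k)
        \<comment> \<open>The equality case of Cauchy-Schwarz without absolute value, so the vectors
          are parallel with equal orientation and not merely collinear.\<close>
        then have "norm (bloch (\<gamma> k0)) *\<^sub>R bloch (\<gamma> k) = norm (bloch (\<gamma> k)) *\<^sub>R bloch (\<gamma> k0)"
          by (simp add: norm_cauchy_schwarz_eq)
        then have "bloch (\<gamma> k) = (norm (bloch (\<gamma> k)) *\<^sub>R bloch (\<gamma> k0)) /\<^sub>R norm (bloch (\<gamma> k0))"
          using k0 by (metis norm_eq_zero scaleR_scaleR left_inverse scaleR_one)
        then show ?case by (simp add: mult.commute)
      qed
      then show ?thesis using k0 by (intro exI[of _ ?n]) simp
    qed
  qed
  ultimately show ?thesis by (rule that)
qed

lemma spin_admissible_diag: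
  fixes l m :: "real^'d \<Rightarrow> real"
  assumes "nospin_admissible r l" "nospin_admissible s m"
  shows "spin_admissible (r + s) (\<lambda>k. diag_mat (vector [l k, m k]))"
proof -
  note l = nospin_admissibleD[OF assms(1)] and m = nospin_admissibleD[OF assms(2)]
  have tr: "Re (trace (diag_mat (vector [a, b]) :: complex^2^2)) = a + b" for a b
    by (simp add: trace_def sum_2 diag_mat_def)
  have one: "mat 1 - diag_mat (vector [a, b]) = (diag_mat (vector [1 - a, 1 - b]) :: complex^2^2)" for a b
    by (simp add: vec_eq_iff forall_2 mat_def diag_mat_def)
  have psd: "pos_semidef (diag_mat (vector [a, b]) :: complex^2^2)" if "0 \<le> a" "0 \<le> b" for a b
  proof (rule pos_semidef_diag_mat)
    show "0 \<le> vector [a, b] $ i" for i :: 2 using that exhaust_2[of i] by auto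
  qed
  have "l \<in> borel_measurable borel" "m \<in> borel_measurable borel" using l m by auto
  then show ?thesis
    unfolding spin_admissible_def
    using l m by (auto simp: tr one intro!: psd diag_mat_2_measurable) (simp add: field_simps)
qed

lemma spin_energy_diag:
  fixes w :: "real^'d \<Rightarrow> real"
  assumes w: "L1_plus_Linf w" and T: "0 \<le> T" and "nospin_admissible r l" "nospin_admissible s m"
  shows "spin_energy w T (\<lambda>k. diag_mat (vector [l k, m k])) = nospin_energy w T l + nospin_energy w T m"
proof -
  note l = nospin_admissibleD[OF assms(3)] and m = nospin_admissibleD[OF assms(4)]
  show ?thesis
    using spin_energy_decomposition[OF T has_eigenvalues_diag l(1,2) m(1,2), of w]
      spin_exchange_diag[OF w l(1,2) m(1,2)] by simp
qed

theorem theorem2: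
  fixes w :: "real^'d \<Rightarrow> real" and \<rho> T :: real
  assumes "L1_plus_Linf w"
    and "radial w"
    and "AE k in lborel. 0 < w k"
    and "0 \<le> \<rho>" and "0 \<le> T"
  shows "(\<forall>\<gamma>. spin_minimiser w \<rho> T \<gamma> \<longrightarrow>
            (\<exists>U g_up g_down \<rho>_up \<rho>_down.
               unitary U \<and> det U = 1 \<and>
               0 \<le> \<rho>_up \<and> 0 \<le> \<rho>_down \<and> \<rho>_up + \<rho>_down = \<rho> \<and>
               nospin_minimiser w \<rho>_up T g_up \<and> nospin_minimiser w \<rho>_down T g_down \<and>
               (AE k in lborel.
                  \<gamma> k = U ** diag_mat (vector [g_up k, g_down k]) ** conj_transpose U)))
       \<and> (\<exists>\<gamma>. spin_minimiser w \<rho> T \<gamma>)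
       \<and> (\<forall>\<rho>'\<in>{0..\<rho>}. \<exists>g. nospin_minimiser w \<rho>' T g)
       \<and> is_minimum (E_spin w \<rho> T)
           {E_nospin w \<rho>_up T + E_nospin w \<rho>_down T | \<rho>_up \<rho>_down.
              0 \<le> \<rho>_up \<and> 0 \<le> \<rho>_down \<and> \<rho>_up + \<rho>_down = \<rho>}
       \<and> is_minimum (E_spin w \<rho> T)
           {E_nospin w (t * \<rho>) T + E_nospin w ((1 - t) * \<rho>) T | t. 0 \<le> t \<and> t \<le> 1/2}"
proof -
  note w = assms(1) and pos = assms(3) and \<rho> = assms(4) and T = assms(5)
  obtain r where r: "0 \<le> r" "r \<le> \<rho>"
    and opt: "\<And>s. 0 \<le> s \<Longrightarrow> s \<le> \<rho> \<Longrightarrow>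
      E_nospin w r T + E_nospin w (\<rho> - r) T \<le> E_nospin w s T + E_nospin w (\<rho> - s) T"
    using optimal_split_exists[OF w T \<rho>] by blast
  define E where "E = E_nospin w r T + E_nospin w (\<rho> - r) T"
  have diag_min: "\<exists>\<gamma>. spin_admissible \<rho> \<gamma> \<and> spin_energy w T \<gamma> = E_nospin w s T + E_nospin w (\<rho> - s) T"
    if s: "0 \<le> s" "s \<le> \<rho>" for s
  proof -
    obtain l m where "nospin_minimiser w s T l" "nospin_minimiser w (\<rho> - s) T m"
      using nospin_minimiser_exists[OF w T] s by (metis diff_ge_0_iff_ge)
    then have l: "nospin_admissible s l" "nospin_energy w T l = E_nospin w s T"
      and m: "nospin_admissible (\<rho> - s) m" "nospin_energy w T m = E_nospin w (\<rho> - s) T"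
      by (auto simp: nospin_minimiser_iff)
    show ?thesis
      using spin_admissible_diag[OF l(1) m(1)] spin_energy_diag[OF w T l(1) m(1)] l(2) m(2) by auto
  qed
  have lower: "E \<le> spin_energy w T \<gamma>" if adm: "spin_admissible \<rho> \<gamma>" for \<gamma>
  proof -
    obtain a b where ab: "0 \<le> a" "0 \<le> b" "a + b = \<rho>"
      "nospin_admissible a (\<lambda>k. eig_up (\<gamma> k))" "nospin_admissible b (\<lambda>k. eig_down (\<gamma> k))"
      by (rule spin_admissible_eigenvalues[OF adm])
    obtain d where d: "0 \<le> d" "spin_energy w T \<gamma>
        = nospin_energy w T (\<lambda>k. eig_up (\<gamma> k)) + nospin_energy w T (\<lambda>k. eig_down (\<gamma> k)) + ereal d"
      by (rule spin_energy_ge[OF w pos T adm])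
    have "b = \<rho> - a" "a \<le> \<rho>" using ab by auto
    then have "E \<le> E_nospin w a T + E_nospin w b T + ereal 0" unfolding E_def using opt[OF ab(1)] by simp
    also have "\<dots> \<le> spin_energy w T \<gamma>"
      unfolding d(2) using d(1) ab by (intro add_mono E_nospin_le) auto
    finally show ?thesis .
  qed
  obtain \<gamma>0 where \<gamma>0: "spin_admissible \<rho> \<gamma>0" "spin_energy w T \<gamma>0 = E"
    using diag_min[OF r] unfolding E_def by blast
  have E_spin: "E_spin w \<rho> T = E"
    unfolding E_spin_def by (rule antisym) (use \<gamma>0 lower in \<open>auto intro!: Inf_greatest intro: Inf_lower2[of E]\<close>)
  have exists: "spin_minimiser w \<rho> T \<gamma>0"
    using \<gamma>0 lower by (auto simp: spin_minimiser_def is_arg_min_def not_less)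
  have shape: "\<exists>U g_up g_down \<rho>_up \<rho>_down.
      unitary U \<and> det U = 1 \<and> 0 \<le> \<rho>_up \<and> 0 \<le> \<rho>_down \<and> \<rho>_up + \<rho>_down = \<rho> \<and>
      nospin_minimiser w \<rho>_up T g_up \<and> nospin_minimiser w \<rho>_down T g_down \<and>
      (AE k in lborel. \<gamma> k = U ** diag_mat (vector [g_up k, g_down k]) ** conj_transpose U)"
    if min: "spin_minimiser w \<rho> T \<gamma>" for \<gamma>
  proof -
    have adm: "spin_admissible \<rho> \<gamma>" using min by (simp add: spin_minimiser_def is_arg_min_def)
    obtain a b where ab: "0 \<le> a" "0 \<le> b" "a + b = \<rho>"
      "nospin_admissible a (\<lambda>k. eig_up (\<gamma> k))" "nospin_admissible b (\<lambda>k. eig_down (\<gamma> k))"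
      by (rule spin_admissible_eigenvalues[OF adm])
    obtain d where d: "0 \<le> d" "spin_energy w T \<gamma>
        = nospin_energy w T (\<lambda>k. eig_up (\<gamma> k)) + nospin_energy w T (\<lambda>k. eig_down (\<gamma> k)) + ereal d"
      "d = 0 \<longrightarrow> (\<exists>n. norm n = 1 \<and> (AE k in lborel. bloch (\<gamma> k) = norm (bloch (\<gamma> k)) *\<^sub>R n))"
      by (rule spin_energy_ge[OF w pos T adm])
    obtain ea eb where e: "E_nospin w a T = ereal ea" "E_nospin w b T = ereal eb"
      using nospin_minimiser_exists[OF w T] ab(1,2) by metis
    \<comment> \<open>The competitor is diagonal and has the same division a, b of the density as
      the eigenvalues of the given minimiser; optimality of that division is not assumed.\<close>
    have "spin_energy w T \<gamma> \<le> ereal ea + ereal eb"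
    proof -
      have "b = \<rho> - a" "a \<le> \<rho>" using ab by auto
      then obtain \<gamma>' where "spin_admissible \<rho> \<gamma>'" "spin_energy w T \<gamma>' = ereal ea + ereal eb"
        using diag_min[of a] ab(1) e by auto
      then show ?thesis using min by (auto simp: spin_minimiser_def is_arg_min_def not_less)
    qed
    moreover have "ereal ea \<le> nospin_energy w T (\<lambda>k. eig_up (\<gamma> k))" "ereal eb \<le> nospin_energy w T (\<lambda>k. eig_down (\<gamma> k))"
      using E_nospin_le[OF ab(4), of w T] E_nospin_le[OF ab(5), of w T] e by auto
    \<comment> \<open>Two energies bounded below by \<open>ea\<close> and \<open>eb\<close> and a
      nonnegative \<open>d\<close> have total at most ea + eb. Since these values are finite, all
      three inequalities are equalities.\<close>
    ultimately have eq: "nospin_energy w T (\<lambda>k. eig_up (\<gamma> k)) = ereal ea"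
        "nospin_energy w T (\<lambda>k. eig_down (\<gamma> k)) = ereal eb" "d = 0"
      unfolding d(2) using d(1)
      by (cases "nospin_energy w T (\<lambda>k. eig_up (\<gamma> k))"; cases "nospin_energy w T (\<lambda>k. eig_down (\<gamma> k))"; simp)+
    obtain n where n: "norm n = 1" "AE k in lborel. bloch (\<gamma> k) = norm (bloch (\<gamma> k)) *\<^sub>R n" using d(3) eq(3) by blast
    obtain U where U: "unitary U" "det U = 1" "\<And>A s. hermitian A \<Longrightarrow> bloch A = s *\<^sub>R n \<Longrightarrow>
        A = U ** diag_mat (vector [(Re (trace A) + s) / 2, (Re (trace A) - s) / 2]) ** conj_transpose U"
      by (rule diagonalise_along_direction[OF n(1)]) blast
    have "AE k in lborel. \<gamma> k = U ** diag_mat (vector [eig_up (\<gamma> k), eig_down (\<gamma> k)]) ** conj_transpose U"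
      using n(2) by eventually_elim (unfold eig_up_def eig_down_def, rule U(3)[OF spin_admissible_hermitian[OF adm]])
    moreover have "nospin_minimiser w a T (\<lambda>k. eig_up (\<gamma> k))" "nospin_minimiser w b T (\<lambda>k. eig_down (\<gamma> k))"
      using ab(4,5) eq e by (simp_all add: nospin_minimiser_iff)
    ultimately show ?thesis using U(1,2) ab(1-3) by blast
  qed
  have min1: "is_minimum (E_spin w \<rho> T)
      {E_nospin w \<rho>_up T + E_nospin w \<rho>_down T | \<rho>_up \<rho>_down. 0 \<le> \<rho>_up \<and> 0 \<le> \<rho>_down \<and> \<rho>_up + \<rho>_down = \<rho>}"
    unfolding is_minimum_def E_spin
  proof (intro conjI ballI)
    show "E \<in> {E_nospin w \<rho>_up T + E_nospin w \<rho>_down T | \<rho>_up \<rho>_down. 0 \<le> \<rho>_up \<and> 0 \<le> \<rho>_down \<and> \<rho>_up + \<rho>_down = \<rho>}"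
      unfolding E_def using r by (intro CollectI exI[of _ r] exI[of _ "\<rho> - r"]) auto
    fix x assume "x \<in> {E_nospin w \<rho>_up T + E_nospin w \<rho>_down T | \<rho>_up \<rho>_down. 0 \<le> \<rho>_up \<and> 0 \<le> \<rho>_down \<and> \<rho>_up + \<rho>_down = \<rho>}"
    then obtain a b where x: "x = E_nospin w a T + E_nospin w b T" "0 \<le> a" "0 \<le> b" "a + b = \<rho>" by blast
    then have "b = \<rho> - a" "a \<le> \<rho>" by auto
    then show "E \<le> x" unfolding E_def x(1) using opt[OF x(2)] by simp
  qed
  have min2: "is_minimum (E_spin w \<rho> T)
      {E_nospin w (t * \<rho>) T + E_nospin w ((1 - t) * \<rho>) T | t. 0 \<le> t \<and> t \<le> 1/2}"
    unfolding is_minimum_def E_spin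
  proof (intro conjI ballI)
    \<comment> \<open>Addition commutes, so the smaller share may be called t rho, which gives t
      \<le> 1/2. For rho = 0 division by zero yields t = 0, which is consistent.\<close>
    define t where "t = min r (\<rho> - r) / \<rho>"
    have t: "0 \<le> t" "t \<le> 1 / 2" "t * \<rho> = min r (\<rho> - r)" "(1 - t) * \<rho> = \<rho> - min r (\<rho> - r)"
      using r by (cases "\<rho> = 0"; auto simp: t_def field_simps min_def)+
    have "E = E_nospin w (t * \<rho>) T + E_nospin w ((1 - t) * \<rho>) T"
      unfolding t(3,4) E_def by (auto simp: min_def add.commute)
    then show "E \<in> {E_nospin w (t * \<rho>) T + E_nospin w ((1 - t) * \<rho>) T | t. 0 \<le> t \<and> t \<le> 1/2}"
      using t(1,2) by blast
    fix x assume "x \<in> {E_nospin w (t * \<rho>) T + E_nospin w ((1 - t) * \<rho>) T | t. 0 \<le> t \<and> t \<le> 1/2}"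
    then obtain t where x: "x = E_nospin w (t * \<rho>) T + E_nospin w ((1 - t) * \<rho>) T" "0 \<le> t" "t \<le> 1/2" by blast
    have "(1 - t) * \<rho> = \<rho> - t * \<rho>" by (simp add: algebra_simps)
    moreover have "0 \<le> t * \<rho>" "t * \<rho> \<le> \<rho>" using x(2,3) \<rho> by (auto simp: mult_left_le_one_le)
    ultimately show "E \<le> x" unfolding E_def x(1) using opt by simp
  qed
  have "\<forall>\<rho>'\<in>{0..\<rho>}. \<exists>g. nospin_minimiser w \<rho>' T g"
    using nospin_minimiser_exists[OF w T] by (metis atLeastAtMost_iff)
  then show ?thesis using shape exists min1 min2 by blast
qed

end
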